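(* Let $\vec\xi\in\mathbf{B}(H_0^{\operatorname{div}}(\Omega,\mathbb{R}^2))$, $\alpha>0$ and $d_0\in L^2(\Omega,\mathbb{R})$. Let $d$ be the solution of $$\min_{d\in BV(\Omega,\mathbb{R})\cap L^2(\Omega,\mathbb{R})}TV(d)+\langle d,\operatorname{div}\vec\xi\rangle_{L^2}+\frac{\alpha}{2}\|d-d_0\|_{L^2}^2$$ (equivalently, of $\min_{d\in BV(\Omega,\mathbb{R})\cap L^2(\Omega,\mathbb{R})}TV(d)+\frac{\alpha}{2}\|d-d_0+\frac1\alpha\operatorname{div}\vec\xi\|_{L^2}^2$). Then $$d=d_0-\frac1\alpha\big(\operatorname{div}\vec p+\operatorname{div}\vec\xi\big),$$ where $\vec p$ is a solution (any solution) of the optimization problem $$\min_{\vec p\in\mathbf{B}(H_0^{\operatorname{div}}(\Omega,\mathbb{R}^2))}\big\|\operatorname{div}\vec p-(\alpha d_0-\operatorname{div}\vec\xi)\big\|_{L^2}^2 .$$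
   Context: $\Omega\subset\mathbb{R}^2$ is an open, bounded, simply connected domain with Lipschitz boundary. $TV(d)=\sup\{\int_\Omega d\,\operatorname{div}\vec p\,dx:\vec p\in C_0^1(\Omega,\mathbb{R}^2),\ |\vec p|\le1\text{ a.e. in }\Omega\}$, with $C_0^1$ the compactly supported $C^1$ functions and $|\cdot|$ the Euclidean norm, and $BV(\Omega,\mathbb{R})=\{d\in L^1(\Omega,\mathbb{R}):TV(d)<\infty\}$. $H_0^{\operatorname{div}}(\Omega,\mathbb{R}^2)=\{\vec p\in L^2(\Omega,\mathbb{R}^2):\operatorname{div}\vec p\in L^2(\Omega,\mathbb{R}),\ \vec p\cdot\vec e|_{\partial\Omega}=0\}$, with $\vec e$ the outward normal, and $\mathbf{B}(H_0^{\operatorname{div}}(\Omega,\mathbb{R}^2))=\{\vec p\in H_0^{\operatorname{div}}(\Omega,\mathbb{R}^2):|\vec p|\le1\text{ a.e. in }\Omega\}$. *)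

theory Defs
  imports "HOL-Analysis.Analysis"
begin

text \<open>
  Elements of Lebesgue and Sobolev spaces on \<open>\<Omega>\<close> are represented by functions on the whole space;
  only their values on \<open>\<Omega>\<close>, up to null sets, matter.
\<close>

definition L1 :: "'a::euclidean_space set \<Rightarrow> ('a \<Rightarrow> real) set" where
  "L1 \<Omega> = {f. integrable (lebesgue_on \<Omega>) f}"

definition L2 :: "'a::euclidean_space set \<Rightarrow> ('a \<Rightarrow> 'b::euclidean_space) set" where
  "L2 \<Omega> = {f \<in> borel_measurable (lebesgue_on \<Omega>). integrable (lebesgue_on \<Omega>) (\<lambda>x. (norm (f x))\<^sup>2)}"

definition L2_inner :: "'a::euclidean_space set \<Rightarrow> ('a \<Rightarrow> 'b::euclidean_space) \<Rightarrow> ('a \<Rightarrow> 'b) \<Rightarrow> real" where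
  "L2_inner \<Omega> f g = (LINT x|lebesgue_on \<Omega>. f x \<bullet> g x)"

definition L2_norm :: "'a::euclidean_space set \<Rightarrow> ('a \<Rightarrow> 'b::euclidean_space) \<Rightarrow> real" where
  "L2_norm \<Omega> f = sqrt (L2_inner \<Omega> f f)"

text \<open>Near each boundary point, \<open>\<Omega>\<close> is, in suitable orthonormal coordinates with last axis \<open>v\<close>, the
  region above the graph of a Lipschitz function of the coordinates orthogonal to \<open>v\<close>.\<close>

definition lipschitz_boundary :: "'a::euclidean_space set \<Rightarrow> bool" where
  "lipschitz_boundary \<Omega> \<longleftrightarrow>
    (\<forall>x \<in> frontier \<Omega>. \<exists>r > 0. \<exists>v \<gamma> L. norm v = 1 \<and> L-lipschitz_on {z. z \<bullet> v = 0} \<gamma> \<and>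
      \<Omega> \<inter> ball x r = {y \<in> ball x r. \<gamma> (y - (y \<bullet> v) *\<^sub>R v) < y \<bullet> v})"

text \<open>Compactly supported \<open>C\<^sup>1\<close> functions on the open set \<open>\<Omega>\<close>, extended by zero.\<close>

definition C1c :: "'a::euclidean_space set \<Rightarrow> ('a \<Rightarrow> 'b::euclidean_space) set" where
  "C1c \<Omega> = {f.
    (\<exists>f' :: 'a \<Rightarrow> 'a \<Rightarrow>\<^sub>L 'b. continuous_on UNIV f' \<and>
        (\<forall>x. (f has_derivative blinfun_apply (f' x)) (at x))) \<and>
    (\<exists>K. compact K \<and> K \<subseteq> \<Omega> \<and> (\<forall>x. x \<notin> K \<longrightarrow> f x = 0))}"

definition classical_div :: "('a::euclidean_space \<Rightarrow> 'a) \<Rightarrow> 'a \<Rightarrow> real" where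
  "classical_div p x = (\<Sum>b\<in>Basis. frechet_derivative p (at x) b \<bullet> b)"

definition classical_grad :: "('a::euclidean_space \<Rightarrow> real) \<Rightarrow> 'a \<Rightarrow> 'a" where
  "classical_grad \<phi> x = (\<Sum>b\<in>Basis. frechet_derivative \<phi> (at x) b *\<^sub>R b)"

definition TV :: "'a::euclidean_space set \<Rightarrow> ('a \<Rightarrow> real) \<Rightarrow> ereal" where
  "TV \<Omega> d = (SUP p \<in> {p \<in> C1c \<Omega>. AE x in lebesgue_on \<Omega>. norm (p x) \<le> 1}.
     ereal (LINT x|lebesgue_on \<Omega>. d x * classical_div p x))"

definition BV :: "'a::euclidean_space set \<Rightarrow> ('a \<Rightarrow> real) set" where
  "BV \<Omega> = {d \<in> L1 \<Omega>. TV \<Omega> d < \<infinity>}"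

text \<open>Weak derivatives in \<open>L\<^sup>2\<close>. They are unique up to null sets; \<open>weak_div\<close> and \<open>weak_grad\<close> pick a
  representative, and are meaningful only where one exists.\<close>

definition has_weak_div :: "'a::euclidean_space set \<Rightarrow> ('a \<Rightarrow> 'a) \<Rightarrow> ('a \<Rightarrow> real) \<Rightarrow> bool" where
  "has_weak_div \<Omega> p g \<longleftrightarrow>
    g \<in> L2 \<Omega> \<and> (\<forall>\<phi> \<in> C1c \<Omega>. L2_inner \<Omega> p (classical_grad \<phi>) = - L2_inner \<Omega> g \<phi>)"

definition weak_div :: "'a::euclidean_space set \<Rightarrow> ('a \<Rightarrow> 'a) \<Rightarrow> 'a \<Rightarrow> real" where
  "weak_div \<Omega> p = (SOME g. has_weak_div \<Omega> p g)"

definition has_weak_grad :: "'a::euclidean_space set \<Rightarrow> ('a \<Rightarrow> real) \<Rightarrow> ('a \<Rightarrow> 'a) \<Rightarrow> bool" where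
  "has_weak_grad \<Omega> \<phi> G \<longleftrightarrow>
    G \<in> L2 \<Omega> \<and> (\<forall>\<psi> \<in> C1c \<Omega>. L2_inner \<Omega> \<phi> (classical_div \<psi>) = - L2_inner \<Omega> G \<psi>)"

definition weak_grad :: "'a::euclidean_space set \<Rightarrow> ('a \<Rightarrow> real) \<Rightarrow> 'a \<Rightarrow> 'a" where
  "weak_grad \<Omega> \<phi> = (SOME G. has_weak_grad \<Omega> \<phi> G)"

definition H1 :: "'a::euclidean_space set \<Rightarrow> ('a \<Rightarrow> real) set" where
  "H1 \<Omega> = {\<phi> \<in> L2 \<Omega>. \<exists>G. has_weak_grad \<Omega> \<phi> G}"

definition Hdiv :: "'a::euclidean_space set \<Rightarrow> ('a \<Rightarrow> 'a) set" where
  "Hdiv \<Omega> = {p \<in> L2 \<Omega>. \<exists>g. has_weak_div \<Omega> p g}"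

text \<open>For a field in \<open>H(div)\<close> the normal component on the boundary is an element of
  \<open>H\<^sup>-\<^sup>1\<^sup>/\<^sup>2(\<partial>\<Omega>)\<close>, defined through Green's formula: its pairing with the boundary trace of
  \<open>\<phi> \<in> H\<^sup>1(\<Omega>)\<close> is the number below. As the traces of \<open>H\<^sup>1(\<Omega>)\<close> exhaust \<open>H\<^sup>1\<^sup>/\<^sup>2(\<partial>\<Omega>)\<close>, it vanishes
  iff all these pairings do.\<close>

definition normal_trace :: "'a::euclidean_space set \<Rightarrow> ('a \<Rightarrow> 'a) \<Rightarrow> ('a \<Rightarrow> real) \<Rightarrow> real" where
  "normal_trace \<Omega> p \<phi> = L2_inner \<Omega> p (weak_grad \<Omega> \<phi>) + L2_inner \<Omega> (weak_div \<Omega> p) \<phi>"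

definition H0div :: "'a::euclidean_space set \<Rightarrow> ('a \<Rightarrow> 'a) set" where
  "H0div \<Omega> = {p \<in> Hdiv \<Omega>. \<forall>\<phi> \<in> H1 \<Omega>. normal_trace \<Omega> p \<phi> = 0}"

definition ball_H0div :: "'a::euclidean_space set \<Rightarrow> ('a \<Rightarrow> 'a) set" where
  "ball_H0div \<Omega> = {p \<in> H0div \<Omega>. AE x in lebesgue_on \<Omega>. norm (p x) \<le> 1}"

definition primal_objective ::
    "'a::euclidean_space set \<Rightarrow> real \<Rightarrow> ('a \<Rightarrow> real) \<Rightarrow> ('a \<Rightarrow> 'a) \<Rightarrow> ('a \<Rightarrow> real) \<Rightarrow> ereal" where
  "primal_objective \<Omega> \<alpha> d0 \<xi> d =
    TV \<Omega> d + ereal (L2_inner \<Omega> d (weak_div \<Omega> \<xi>))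
      + ereal (\<alpha> / 2 * (L2_norm \<Omega> (\<lambda>x. d x - d0 x))\<^sup>2)"

definition shifted_objective ::
    "'a::euclidean_space set \<Rightarrow> real \<Rightarrow> ('a \<Rightarrow> real) \<Rightarrow> ('a \<Rightarrow> 'a) \<Rightarrow> ('a \<Rightarrow> real) \<Rightarrow> ereal" where
  "shifted_objective \<Omega> \<alpha> d0 \<xi> d =
    TV \<Omega> d + ereal (\<alpha> / 2 * (L2_norm \<Omega> (\<lambda>x. d x - d0 x + 1 / \<alpha> * weak_div \<Omega> \<xi> x))\<^sup>2)"

definition dual_objective ::
    "'a::euclidean_space set \<Rightarrow> real \<Rightarrow> ('a \<Rightarrow> real) \<Rightarrow> ('a \<Rightarrow> 'a) \<Rightarrow> ('a \<Rightarrow> 'a) \<Rightarrow> real" where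
  "dual_objective \<Omega> \<alpha> d0 \<xi> p =
    (L2_norm \<Omega> (\<lambda>x. weak_div \<Omega> p x - (\<alpha> * d0 x - weak_div \<Omega> \<xi> x)))\<^sup>2"

end

(* Write f = alpha d0 - div xi and let div p be the L2 projection of f onto
   {div q | q in the unit ball of H0(div)}. With e = (f - div p) / alpha the variational inequality
   for the projection says TV(e) <= <e, div p>, whereas Green's inequality gives
   <u, div p> <= TV(u) for all u in L2. Completing the square, the objective at u exceeds its value
   at e by at least alpha/2 |u - e|^2, so e is the only minimizer.

   Green's inequality needs compactly supported C1 fields q with |q| <= 1 + eps and div q -> div p
   weakly in L2. Vanishing normal trace means that the extension of p by zero has the extension of
   div p as divergence. Near a boundary point the domain lies above a Lipschitz graph, so pushing
   theta p inwards, theta a member of a finite partition of unity, and mollifying keeps the support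
   inside; summing over the partition preserves |q| <= 1 up to the modulus of continuity of the
   cut-off functions. The projection exists because almost minimizers of almost least L2 norm form
   a Cauchy sequence. *)

theory Submission
  imports Defs
begin

text \<open>The supremum in \<open>TV\<close> runs over compactly supported fields, whereas a field
  with vanishing normal trace may keep a tangential part up to the boundary. Multiplying it by a
  cut-off \<chi> would add grad \<chi> . p to the divergence, and grad \<chi> blows up as \<chi>
  tends to 1. Translation costs no such term, which is why the field is pushed inwards; only the
  fixed functions \<theta> get differentiated, and their gradients cancel in the sum because they
  add up to 1 on the domain. Weak convergence of the divergences is enough since Green's inequality
  is tested against one u at a time, and the factor 1 + eps is removed by rescaling q. The obstacle
  to the existence of a projection is that the dual objective sees a field only through its
  divergence: along a minimizing sequence the divergences converge, but the fields need not. The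
  norm of the field serves as a second criterion that singles out a convergent sequence.\<close>

section \<open>Calculus of compactly supported \<open>C\<^sup>1\<close> functions\<close>

lemma lborel_integral_reflect:
  fixes f :: "'a::euclidean_space \<Rightarrow> 'b::{banach, second_countable_topology}"
  assumes [measurable]: "f \<in> borel_measurable borel"
  shows "(LBINT x. f (t - x)) = (LBINT x. f x)"
proof -
  have "lborel = distr lborel borel (\<lambda>x::'a. t - x)"
    using lborel_affine[of "-1" t] by (simp add: density_1)
  then show ?thesis
    by (subst (2) \<open>lborel = _\<close>, subst integral_distr) simp_all
qed

lemma lborel_integral_translation:
  fixes f :: "'a::euclidean_space \<Rightarrow> 'b::{banach, second_countable_topology}"
  assumes [measurable]: "f \<in> borel_measurable borel"
  shows "(LBINT x. f (t + x)) = (LBINT x. f x)"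
  by (subst (2) lborel_distr_plus[of t, symmetric], subst integral_distr) simp_all

lemma lborel_integrable_translation:
  fixes f :: "'a::euclidean_space \<Rightarrow> 'b::{banach, second_countable_topology}"
  assumes "integrable lborel f"
  shows "integrable lborel (\<lambda>x. f (t + x))"
  using assms by (subst (asm) lborel_distr_plus[of t, symmetric], subst (asm) integrable_distr_eq) auto

lemma integrable_continuous_compact_support:
  fixes f :: "'a::euclidean_space \<Rightarrow> 'b::{banach, second_countable_topology}"
  assumes "continuous_on UNIV f" "compact K" "\<And>x. x \<notin> K \<Longrightarrow> f x = 0"
  shows "integrable lborel f"
proof -
  have "integrable lborel (\<lambda>x. indicator K x *\<^sub>R f x)"
    by (rule borel_integrable_compact) (use assms in \<open>auto intro: continuous_on_subset[OF assms(1)]\<close>)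
  moreover have "(\<lambda>x. indicator K x *\<^sub>R f x) = f"
    using assms(3) by (auto simp: indicator_def fun_eq_iff)
  ultimately show ?thesis by simp
qed

lemma bounded_continuous_compact_support:
  fixes f :: "'a::t2_space \<Rightarrow> 'b::real_normed_vector"
  assumes "continuous_on UNIV f" "compact K" "\<And>x. x \<notin> K \<Longrightarrow> f x = 0"
  obtains B where "B > 0" "\<And>x. norm (f x) \<le> B"
proof -
  have "bounded (f ` K)"
    using assms by (intro compact_imp_bounded compact_continuous_image) (auto intro: continuous_on_subset[OF assms(1)])
  then obtain B where B: "B > 0" "\<And>x. x \<in> K \<Longrightarrow> norm (f x) \<le> B"
    unfolding bounded_pos by auto
  have "norm (f x) \<le> B" for x
    using B assms(3)[of x] by (cases "x \<in> K") auto
  with B(1) show ?thesis using that by blast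
qed

lemma uniformly_continuous_compact_support:
  fixes f :: "'a::euclidean_space \<Rightarrow> 'b::real_normed_vector"
  assumes c: "continuous_on UNIV f" and K: "compact K" "\<And>x. x \<notin> K \<Longrightarrow> f x = 0" and "e > 0"
  obtains d where "d > 0" "\<And>x y. dist x y < d \<Longrightarrow> norm (f x - f y) < e"
proof -
  \<comment> \<open>The closed 1-neighbourhood of K: of two points at distance less than 1, either
    both lie in it or f vanishes at both.\<close>
  define K' where "K' = {x + y |x y. x \<in> K \<and> y \<in> cball 0 1}"
  have "compact K'" unfolding K'_def by (intro compact_sums K) auto
  then have "uniformly_continuous_on K' f"
    using c by (intro compact_uniformly_continuous) (auto intro: continuous_on_subset[OF c])
  then obtain d where d: "d > 0" "\<And>x y. x \<in> K' \<Longrightarrow> y \<in> K' \<Longrightarrow> dist y x < d \<Longrightarrow> dist (f y) (f x) < e"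
    unfolding uniformly_continuous_on_def using \<open>e > 0\<close> by metis
  have sub: "y \<in> K'" if "x \<in> K" "dist x y \<le> 1" for x y
    using that unfolding K'_def
    by (intro CollectI exI[of _ x] exI[of _ "y - x"]) (auto simp: dist_norm norm_minus_commute)
  have "norm (f x - f y) < e" if "dist x y < min d 1" for x y
  proof (cases "x \<in> K \<or> y \<in> K")
    case True
    then have "x \<in> K'" "y \<in> K'"
      using sub[of x y] sub[of y x] sub[of x x] sub[of y y] that by (auto simp: dist_commute)
    then show ?thesis using d(2)[of y x] that by (simp add: dist_norm)
  next
    case False
    then show ?thesis using K(2) \<open>e > 0\<close> by auto
  qed
  with d(1) show ?thesis using that[of "min d 1"] by auto
qed

section \<open>The class \<open>C1c\<close>: closure properties, gradients and divergences\<close>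

lemma C1cI:
  fixes f :: "'a::euclidean_space \<Rightarrow> 'b::euclidean_space"
  assumes D: "\<And>x. (f has_derivative D x) (at x)"
    and c: "\<And>b. b \<in> Basis \<Longrightarrow> continuous_on UNIV (\<lambda>x. D x b)"
    and K: "compact K" "K \<subseteq> U" "\<And>x. x \<notin> K \<Longrightarrow> f x = 0"
  shows "f \<in> C1c U"
proof -
  have *: "blinfun_apply (Blinfun (D x)) = D x" for x
    by (rule bounded_linear_Blinfun_apply[OF has_derivative_bounded_linear[OF D]])
  \<comment> \<open>In finite dimension the operator norm is controlled by the values on
    \<open>Basis\<close>, so only partial derivatives have to be continuous.\<close>
  have "continuous_on UNIV (\<lambda>x. Blinfun (D x))"
    by (rule continuous_on_blinfun_componentwise) (simp add: * c)
  then show ?thesis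
    unfolding C1c_def using K D * by (auto intro!: exI[of _ "\<lambda>x. Blinfun (D x)"])
qed

lemma C1c_support:
  assumes "f \<in> C1c U"
  obtains K where "compact K" "K \<subseteq> U" "\<And>x. x \<notin> K \<Longrightarrow> f x = 0"
  using assms unfolding C1c_def by auto

lemma C1c_has_derivative:
  assumes "f \<in> C1c U"
  shows "(f has_derivative frechet_derivative f (at x)) (at x)"
proof -
  from assms have "f differentiable (at x)"
    unfolding C1c_def differentiable_def by blast
  then show ?thesis by (simp add: frechet_derivative_works)
qed

lemma C1c_continuous: "f \<in> C1c U \<Longrightarrow> continuous_on S f"
  using C1c_has_derivative has_derivative_continuous continuous_at_imp_continuous_on by metis

lemma C1c_borel: "f \<in> C1c U \<Longrightarrow> f \<in> borel_measurable borel"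
  by (rule borel_measurable_continuous_onI[OF C1c_continuous])

lemma C1c_continuous_derivative:
  assumes "f \<in> C1c U"
  shows "continuous_on S (\<lambda>x. frechet_derivative f (at x) v)"
proof -
  from assms obtain f' where f': "continuous_on UNIV f'"
    "\<And>x. (f has_derivative blinfun_apply (f' x)) (at x)"
    unfolding C1c_def by blast
  have "frechet_derivative f (at x) v = f' x v" for x
    using frechet_derivative_at[OF f'(2)] by simp
  moreover have "continuous_on S (\<lambda>x. blinfun_apply (f' x) v)"
    using f'(1) by (intro continuous_intros) (auto intro: continuous_on_subset[OF f'(1)])
  ultimately show ?thesis by simp
qed

lemma frechet_derivative_zero_off_support:
  assumes "closed K" "\<And>x. x \<notin> K \<Longrightarrow> f x = 0" "x \<notin> K"
  shows "frechet_derivative f (at x) = (\<lambda>_. 0)"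
proof -
  have "((\<lambda>_. 0) has_derivative (\<lambda>_. 0)) (at x)" by simp
  then have "(f has_derivative (\<lambda>_. 0)) (at x)"
    by (rule has_derivative_transform_within_open[of _ _ _ _ "- K"]) (use assms in auto)
  then show ?thesis using frechet_derivative_at by metis
qed

lemma C1c_eq_frechet_derivative:
  "f \<in> C1c U \<Longrightarrow> (f has_derivative D) (at x) \<Longrightarrow> frechet_derivative f (at x) = D"
  using frechet_derivative_at by metis

lemma C1c_derivative_linear:
  assumes "f \<in> C1c U" shows "linear (frechet_derivative f (at x))"
  using C1c_has_derivative[OF assms] has_derivative_linear by blast

lemma C1c_add:
  assumes "f \<in> C1c U" "g \<in> C1c U"
  shows "(\<lambda>x. f x + g x) \<in> C1c U"
proof -
  obtain K L where "compact K" "K \<subseteq> U" "\<And>x. x \<notin> K \<Longrightarrow> f x = 0"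
    "compact L" "L \<subseteq> U" "\<And>x. x \<notin> L \<Longrightarrow> g x = 0"
    using assms by (metis C1c_support)
  then show ?thesis
    using assms
    by (intro C1cI[where K = "K \<union> L"
          and D = "\<lambda>x v. frechet_derivative f (at x) v + frechet_derivative g (at x) v"])
      (auto intro!: has_derivative_add C1c_has_derivative continuous_intros C1c_continuous_derivative)
qed

lemma C1c_zero: "(\<lambda>x. 0) \<in> C1c U"
  by (intro C1cI[where K = "{}" and D = "\<lambda>x v. 0"]) auto

lemma C1c_sum:
  "(\<And>i. i \<in> I \<Longrightarrow> f i \<in> C1c U) \<Longrightarrow> (\<lambda>x. \<Sum>i\<in>I. f i x) \<in> C1c U"
  by (induction I rule: infinite_finite_induct) (auto intro: C1c_zero C1c_add)

lemma C1c_bounded_linear: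
  assumes "bounded_linear h" "f \<in> C1c U"
  shows "(\<lambda>x. h (f x)) \<in> C1c U"
proof -
  interpret bounded_linear h by fact
  obtain K where "compact K" "K \<subseteq> U" "\<And>x. x \<notin> K \<Longrightarrow> f x = 0"
    using assms by (metis C1c_support)
  then show ?thesis
    using assms
    by (intro C1cI[where K = K and D = "\<lambda>x v. h (frechet_derivative f (at x) v)"])
      (auto intro!: has_derivative C1c_has_derivative continuous_on C1c_continuous_derivative simp: zero)
qed

lemma C1c_scaleR_derivative:
  fixes f :: "'a::euclidean_space \<Rightarrow> real" and g :: "'a \<Rightarrow> 'b::euclidean_space"
  assumes "f \<in> C1c U" "g \<in> C1c U'"
  shows "((\<lambda>x. f x *\<^sub>R g x) has_derivative
      (\<lambda>v. f x *\<^sub>R frechet_derivative g (at x) v + frechet_derivative f (at x) v *\<^sub>R g x)) (at x)"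
  using assms by (auto intro!: has_derivative_scaleR C1c_has_derivative)

lemma C1c_scaleR:
  fixes f :: "'a::euclidean_space \<Rightarrow> real" and g :: "'a \<Rightarrow> 'b::euclidean_space"
  assumes f: "f \<in> C1c U" and g: "g \<in> C1c U'"
  shows "(\<lambda>x. f x *\<^sub>R g x) \<in> C1c (U \<inter> U')"
proof -
  obtain K L where "compact K" "K \<subseteq> U" "\<And>x. x \<notin> K \<Longrightarrow> f x = 0"
    "compact L" "L \<subseteq> U'" "\<And>x. x \<notin> L \<Longrightarrow> g x = 0"
    using assms by (metis C1c_support)
  then show ?thesis
    using assms
    by (intro C1cI[where K = "K \<inter> L", OF C1c_scaleR_derivative[OF f g]])
      (auto intro!: continuous_intros C1c_continuous[OF f] C1c_continuous[OF g]
        C1c_continuous_derivative[OF f] C1c_continuous_derivative[OF g])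
qed

lemma C1c_compose_real:
  fixes f :: "'a::euclidean_space \<Rightarrow> real"
  assumes f: "f \<in> C1c U" and h: "\<And>t. (h has_real_derivative h' t) (at t)" "continuous_on UNIV h'" "h 0 = 0"
  shows "(\<lambda>x. h (f x)) \<in> C1c U"
proof -
  obtain K where K: "compact K" "K \<subseteq> U" "\<And>x. x \<notin> K \<Longrightarrow> f x = 0"
    using assms by (metis C1c_support)
  have "((\<lambda>x. h (f x)) has_derivative (\<lambda>v. h' (f x) * frechet_derivative f (at x) v)) (at x)" for x
    by (rule has_derivative_compose[OF C1c_has_derivative[OF f] h(1)[unfolded has_field_derivative_def]])
  moreover have "continuous_on UNIV (\<lambda>x. h' (f x))"
    by (rule continuous_on_compose2[OF h(2) C1c_continuous[OF f]]) simp
  ultimately show ?thesis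
    using K h(3)
    by (intro C1cI[where K = K and D = "\<lambda>x v. h' (f x) * frechet_derivative f (at x) v"])
      (auto intro!: continuous_intros C1c_continuous_derivative[OF f])
qed

lemma classical_grad_inner:
  assumes "f \<in> C1c U"
  shows "classical_grad f x \<bullet> v = frechet_derivative f (at x) v"
proof -
  interpret linear "frechet_derivative f (at x)" by (rule C1c_derivative_linear[OF assms])
  have "frechet_derivative f (at x) v = frechet_derivative f (at x) (\<Sum>b\<in>Basis. (v \<bullet> b) *\<^sub>R b)"
    by (simp add: euclidean_representation)
  also have "\<dots> = classical_grad f x \<bullet> v"
    by (simp add: sum scaleR classical_grad_def inner_sum_left mult.commute inner_commute[of v])
  finally show ?thesis by simp
qed

lemma classical_grad_eqI:
  assumes "f \<in> C1c U" "(f has_derivative (\<lambda>v. G \<bullet> v)) (at x)"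
  shows "classical_grad f x = G"
proof (rule euclidean_eqI)
  fix b :: 'a
  show "classical_grad f x \<bullet> b = G \<bullet> b"
    using classical_grad_inner[OF assms(1), of x b] C1c_eq_frechet_derivative[OF assms] by metis
qed

lemma C1c_has_derivative_grad:
  assumes "f \<in> C1c U"
  shows "(f has_derivative (\<lambda>v. classical_grad f x \<bullet> v)) (at x)"
  using C1c_has_derivative[OF assms, of x] by (simp add: classical_grad_inner[OF assms])

lemma continuous_classical_grad: "f \<in> C1c U \<Longrightarrow> continuous_on S (classical_grad f)"
  unfolding classical_grad_def[abs_def] by (intro continuous_intros C1c_continuous_derivative)

lemma continuous_classical_div: "f \<in> C1c U \<Longrightarrow> continuous_on S (classical_div f)"
  unfolding classical_div_def[abs_def] by (intro continuous_intros C1c_continuous_derivative)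

lemma C1c_derivatives_support:
  assumes "f \<in> C1c U"
  obtains K where "compact K" "K \<subseteq> U" "\<And>x. x \<notin> K \<Longrightarrow> f x = 0"
    "\<And>x. x \<notin> K \<Longrightarrow> frechet_derivative f (at x) = (\<lambda>_. 0)"
  using assms by (metis C1c_support frechet_derivative_zero_off_support compact_imp_closed)

lemma classical_grad_support:
  assumes "f \<in> C1c U"
  obtains K where "compact K" "K \<subseteq> U" "\<And>x. x \<notin> K \<Longrightarrow> f x = 0" "\<And>x. x \<notin> K \<Longrightarrow> classical_grad f x = 0"
proof -
  obtain K where "compact K" "K \<subseteq> U" "\<And>x. x \<notin> K \<Longrightarrow> f x = 0"
    "\<And>x. x \<notin> K \<Longrightarrow> frechet_derivative f (at x) = (\<lambda>_. 0)"
    by (rule C1c_derivatives_support[OF assms]) blast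
  then show ?thesis by (intro that[of K]) (auto simp: classical_grad_def)
qed

lemma classical_div_support:
  assumes "f \<in> C1c U"
  obtains K where "compact K" "K \<subseteq> U" "\<And>x. x \<notin> K \<Longrightarrow> f x = 0" "\<And>x. x \<notin> K \<Longrightarrow> classical_div f x = 0"
proof -
  obtain K where "compact K" "K \<subseteq> U" "\<And>x. x \<notin> K \<Longrightarrow> f x = 0"
    "\<And>x. x \<notin> K \<Longrightarrow> frechet_derivative f (at x) = (\<lambda>_. 0)"
    by (rule C1c_derivatives_support[OF assms]) blast
  then show ?thesis by (intro that[of K]) (auto simp: classical_div_def)
qed

lemma classical_div_scaleR:
  fixes f :: "'a::euclidean_space \<Rightarrow> real" and g :: "'a \<Rightarrow> 'a"
  assumes f: "f \<in> C1c U" and g: "g \<in> C1c U'"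
  shows "classical_div (\<lambda>x. f x *\<^sub>R g x) x = f x * classical_div g x + classical_grad f x \<bullet> g x"
proof -
  have "classical_div (\<lambda>x. f x *\<^sub>R g x) x =
    (\<Sum>b\<in>Basis. (f x *\<^sub>R frechet_derivative g (at x) b + frechet_derivative f (at x) b *\<^sub>R g x) \<bullet> b)"
    unfolding classical_div_def
    by (simp add: C1c_eq_frechet_derivative[OF C1c_scaleR[OF f g] C1c_scaleR_derivative[OF f g]])
  also have "\<dots> = f x * classical_div g x + (\<Sum>b\<in>Basis. frechet_derivative f (at x) b * (g x \<bullet> b))"
    by (simp add: inner_add_left sum.distrib classical_div_def sum_distrib_left)
  finally show ?thesis
    by (simp add: classical_grad_def inner_sum_left inner_commute[of "g x"])
qed

lemma classical_grad_mult:
  fixes f g :: "'a::euclidean_space \<Rightarrow> real"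
  assumes f: "f \<in> C1c U" and g: "g \<in> C1c U'"
  shows "classical_grad (\<lambda>x. f x * g x) x = f x *\<^sub>R classical_grad g x + g x *\<^sub>R classical_grad f x"
proof (rule classical_grad_eqI)
  show "(\<lambda>x. f x * g x) \<in> C1c (U \<inter> U')" using C1c_scaleR[OF f g] by simp
  show "((\<lambda>x. f x * g x) has_derivative (\<bullet>) (f x *\<^sub>R classical_grad g x + g x *\<^sub>R classical_grad f x)) (at x)"
  proof -
    have "(\<lambda>v. f x *\<^sub>R frechet_derivative g (at x) v + frechet_derivative f (at x) v *\<^sub>R g x)
        = (\<lambda>v. (f x *\<^sub>R classical_grad g x + g x *\<^sub>R classical_grad f x) \<bullet> v)"
    proof
      fix v
      show "f x *\<^sub>R frechet_derivative g (at x) v + frechet_derivative f (at x) v *\<^sub>R g x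
        = (f x *\<^sub>R classical_grad g x + g x *\<^sub>R classical_grad f x) \<bullet> v"
        by (simp add: inner_add_left classical_grad_inner[OF f] classical_grad_inner[OF g])
    qed
    then show ?thesis
      using C1c_scaleR_derivative[OF f g, of x] by simp
  qed
qed

text \<open>In a convolution evaluated at a, the kernel enters as this function of the integration
  variable; it is used there as a test function.\<close>

lemma C1c_reflect:
  fixes f :: "'a::euclidean_space \<Rightarrow> real"
  assumes f: "f \<in> C1c UNIV"
  shows "(\<lambda>y. f (a - y)) \<in> C1c UNIV" "classical_grad (\<lambda>y. f (a - y)) y = - classical_grad f (a - y)"
proof -
  have D: "((\<lambda>y. f (a - y)) has_derivative (\<lambda>v. - classical_grad f (a - y) \<bullet> v)) (at y)" for y
  proof -
    have "((\<lambda>y. a - y) has_derivative (\<lambda>v. 0 - v)) (at y)"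
      by (rule has_derivative_diff[OF has_derivative_const has_derivative_ident])
    from has_derivative_compose[OF this C1c_has_derivative_grad[OF f]]
    show ?thesis by simp
  qed
  obtain K where K: "compact K" "\<And>x. x \<notin> K \<Longrightarrow> f x = 0" using f by (metis C1c_support)
  have "continuous_on UNIV (\<lambda>y. classical_grad f (a - y))"
    by (rule continuous_on_compose2[OF continuous_classical_grad[OF f, of UNIV]]) (auto intro!: continuous_intros)
  moreover have "compact ((\<lambda>x. a - x) ` K)" using K by (intro compact_continuous_image continuous_intros)
  moreover have "f (a - y) = 0" if "y \<notin> (\<lambda>x. a - x) ` K" for y
    using K(2)[of "a - y"] that by (force simp: image_iff)
  ultimately show C: "(\<lambda>y. f (a - y)) \<in> C1c UNIV"
    by (intro C1cI[OF D, where K = "(\<lambda>x. a - x) ` K"]) (auto intro!: continuous_intros)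
  show "classical_grad (\<lambda>y. f (a - y)) y = - classical_grad f (a - y)"
    by (rule classical_grad_eqI[OF C D[of y]])
qed

lemma C1c_DERIV_line:
  fixes f :: "'a::euclidean_space \<Rightarrow> real"
  assumes f: "f \<in> C1c U"
  shows "((\<lambda>t. f (t *\<^sub>R v + x)) has_real_derivative classical_grad f (t *\<^sub>R v + x) \<bullet> v) (at t)"
proof -
  have "((\<lambda>t. t *\<^sub>R v + x) has_derivative (\<lambda>t. t *\<^sub>R v)) (at t)"
    using has_derivative_add[OF has_derivative_scaleR_left[OF has_derivative_ident] has_derivative_const] by simp
  from has_derivative_compose[OF this C1c_has_derivative_grad[OF f]]
  show ?thesis
    unfolding has_field_derivative_def by (rule has_derivative_eq_rhs) (simp add: fun_eq_iff mult.commute)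
qed

lemma C1c_mean_value:
  fixes f :: "'a::euclidean_space \<Rightarrow> real"
  assumes f: "f \<in> C1c U"
  obtains z where "0 < z" "z < 1" "f (x + v) - f x = classical_grad f (x + z *\<^sub>R v) \<bullet> v"
proof -
  have "\<exists>z. 0 < z \<and> z < 1 \<and> f (1 *\<^sub>R v + x) - f (0 *\<^sub>R v + x) = (1 - 0) * (classical_grad f (z *\<^sub>R v + x) \<bullet> v)"
    by (rule MVT2) (auto intro: C1c_DERIV_line[OF f])
  then show ?thesis using that by (auto simp: add.commute)
qed

text \<open>By translation invariance every difference quotient of f has integral zero. The mean
  value theorem bounds the quotients by the maximum of the derivative, so dominated convergence
  applies.\<close>

lemma integral_C1c_derivative:
  fixes f :: "'a::euclidean_space \<Rightarrow> real"
  assumes f: "f \<in> C1c U"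
  shows "(LBINT x. frechet_derivative f (at x) v) = 0"
proof -
  let ?D = "\<lambda>x. frechet_derivative f (at x) v"
  obtain K where K: "compact K" "\<And>x. x \<notin> K \<Longrightarrow> f x = 0" "\<And>x. x \<notin> K \<Longrightarrow> ?D x = 0"
    using C1c_derivatives_support[OF f] by metis
  obtain B where B: "B > 0" "\<And>x. norm (?D x) \<le> B"
    using bounded_continuous_compact_support[OF C1c_continuous_derivative[OF f] K(1) K(3)] by metis
  define s where "s n x = (f (inverse (real (Suc n)) *\<^sub>R v + x) - f x) / inverse (real (Suc n))" for n x
  \<comment> \<open>Step lengths are at most 1, so all difference quotients vanish outside this one
    compact set.\<close>
  define K' where "K' = {x + y |x y. x \<in> K \<and> y \<in> cball 0 (norm v)}"
  have cf: "continuous_on UNIV f" using f by (rule C1c_continuous)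
  have [measurable]: "f \<in> borel_measurable borel"
    by (rule borel_measurable_continuous_onI[OF cf])
  have [measurable]: "?D \<in> borel_measurable borel"
    by (rule borel_measurable_continuous_onI[OF C1c_continuous_derivative[OF f]])
  have line: "((\<lambda>t. f (t *\<^sub>R v + x)) has_real_derivative ?D (t *\<^sub>R v + x)) (at t)" for t x
    using C1c_DERIV_line[OF f] by (simp add: classical_grad_inner[OF f])
  have "compact K'" unfolding K'_def by (intro compact_sums K) auto
  have intf: "integrable lborel f" by (rule integrable_continuous_compact_support[OF cf K(1,2)])
  have s0: "(LBINT x. s n x) = 0" for n
  proof -
    have "(LBINT x. s n x) = ((LBINT x. f (inverse (real (Suc n)) *\<^sub>R v + x)) - (LBINT x. f x)) / inverse (real (Suc n))"
      unfolding s_def using intf lborel_integrable_translation[OF intf] by simp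
    then show ?thesis by (simp add: lborel_integral_translation)
  qed
  have "(\<lambda>n. LBINT x. s n x) \<longlonglongrightarrow> (LBINT x. ?D x)"
  proof (rule integral_dominated_convergence[where w = "\<lambda>x. B * indicator K' x"])
    show "integrable lborel (\<lambda>x. B * indicator K' x)"
      using \<open>compact K'\<close> by (intro integrable_mult_right integrable_real_indicator)
        (use emeasure_compact_finite[of K'] in \<open>auto simp: compact_imp_closed borel_closed\<close>)
    show "AE x in lborel. (\<lambda>n. s n x) \<longlonglongrightarrow> ?D x"
    proof (rule AE_I2)
      fix x
      have "((\<lambda>t. f (t *\<^sub>R v + x)) has_real_derivative ?D x) (at 0)"
        using line[where x = x and t = 0] by simp
      then have "((\<lambda>h. (f (h *\<^sub>R v + x) - f x) / h) \<longlongrightarrow> ?D x) (at 0)"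
        by (simp add: DERIV_def)
      moreover have "filterlim (\<lambda>n. inverse (real (Suc n))) (at 0) sequentially"
        unfolding filterlim_at using LIMSEQ_inverse_real_of_nat by auto
      ultimately show "(\<lambda>n. s n x) \<longlonglongrightarrow> ?D x"
        unfolding s_def by (rule filterlim_compose)
    qed
    show "AE x in lborel. norm (s n x) \<le> B * indicator K' x" for n
    proof (rule AE_I2)
      fix x
      let ?h = "inverse (real (Suc n))"
      have h: "0 < ?h" "?h \<le> 1" by (auto simp: divide_simps)
      show "norm (s n x) \<le> B * indicator K' x"
      proof (cases "x \<in> K'")
        case True
        have "\<exists>z. 0 < z \<and> z < ?h \<and> f (?h *\<^sub>R v + x) - f (0 *\<^sub>R v + x) = (?h - 0) * ?D (z *\<^sub>R v + x)"
          by (rule MVT2[OF h(1) line])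
        then obtain z where "f (?h *\<^sub>R v + x) - f x = ?h * ?D (z *\<^sub>R v + x)" by auto
        then have "s n x = ?D (z *\<^sub>R v + x)" using h(1) unfolding s_def by simp
        then show ?thesis using B True by simp
      next
        case False
        have "x \<notin> K" using False unfolding K'_def by (auto intro!: exI[of _ x])
        moreover have "?h *\<^sub>R v + x \<notin> K"
        proof
          assume "?h *\<^sub>R v + x \<in> K"
          moreover have "norm (- (?h *\<^sub>R v)) \<le> norm v" using h by (simp add: mult_left_le_one_le)
          ultimately have "x \<in> K'" unfolding K'_def
            by (intro CollectI exI[of _ "?h *\<^sub>R v + x"] exI[of _ "- (?h *\<^sub>R v)"]) auto
          then show False using False by simp
        qed
        ultimately show ?thesis using K(2) False unfolding s_def by simp
      qed
    qed
  qed (auto simp: s_def)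
  then have "(\<lambda>n. 0) \<longlonglongrightarrow> (LBINT x. ?D x)" by (simp add: s0)
  then show ?thesis by (simp add: LIMSEQ_const_iff)
qed

lemma integral_classical_div:
  fixes f :: "'a::euclidean_space \<Rightarrow> 'a"
  assumes f: "f \<in> C1c U"
  shows "(LBINT x. classical_div f x) = 0"
proof -
  have C: "(\<lambda>x. f x \<bullet> b) \<in> C1c U" for b
    by (rule C1c_bounded_linear[OF bounded_linear_inner_left f])
  have e: "frechet_derivative (\<lambda>x. f x \<bullet> b) (at x) = (\<lambda>v. frechet_derivative f (at x) v \<bullet> b)" for b x
    by (rule C1c_eq_frechet_derivative[OF C]) (auto intro!: derivative_eq_intros C1c_has_derivative[OF f])
  have "integrable lborel (\<lambda>x. frechet_derivative (\<lambda>x. f x \<bullet> b) (at x) b)" for b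
    using C1c_derivatives_support[OF C[of b]] integrable_continuous_compact_support[OF C1c_continuous_derivative[OF C[of b]]]
    by metis
  then have "(LBINT x. classical_div f x) = (\<Sum>b\<in>Basis. LBINT x. frechet_derivative (\<lambda>x. f x \<bullet> b) (at x) b)"
    unfolding classical_div_def e by (intro Bochner_Integration.integral_sum) (simp add: e)
  then show ?thesis by (simp add: integral_C1c_derivative[OF C])
qed

text \<open>The product rule makes the sum of the two integrands the divergence of the compactly
  supported field f g.\<close>

lemma integral_by_parts_C1c:
  fixes f :: "'a::euclidean_space \<Rightarrow> real" and g :: "'a \<Rightarrow> 'a"
  assumes f: "f \<in> C1c U" and g: "g \<in> C1c U'"
  shows "(LBINT x. f x * classical_div g x) = - (LBINT x. classical_grad f x \<bullet> g x)"
proof -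
  obtain K where K: "compact K" "\<And>x. x \<notin> K \<Longrightarrow> f x = 0" "\<And>x. x \<notin> K \<Longrightarrow> classical_grad f x = 0"
    using classical_grad_support[OF f] by metis
  have "integrable lborel (\<lambda>x. f x * classical_div g x)" "integrable lborel (\<lambda>x. classical_grad f x \<bullet> g x)"
    by (rule integrable_continuous_compact_support[OF _ K(1)];
        auto simp: K intro!: continuous_intros C1c_continuous[OF f] C1c_continuous[OF g]
          continuous_classical_div[OF g] continuous_classical_grad[OF f])+
  moreover have "(LBINT x. f x * classical_div g x + classical_grad f x \<bullet> g x) = 0"
    using integral_classical_div[OF C1c_scaleR[OF f g]] by (simp add: classical_div_scaleR[OF f g])
  ultimately show ?thesis by simp
qed

section \<open>Bump functions and partitions of unity\<close>

text \<open>The square of the positive part is of class C1 and vanishes on the negative axis. Since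
  test functions are only required to be C1, it can stand in for exp(-1/t) as the building block of
  bumps.\<close>

definition sqp :: "real \<Rightarrow> real" where "sqp t = (max 0 t)\<^sup>2"

lemma sqp_has_real_derivative: "(sqp has_real_derivative 2 * max 0 t) (at t)"
proof -
  consider "t < 0" | "t > 0" | "t = 0" by linarith
  then show ?thesis
  proof cases
    case 1
    have "((\<lambda>_. 0) has_real_derivative 2 * max 0 t) (at t)" using 1 by simp
    then show ?thesis
      by (rule has_field_derivative_transform_within_open[of _ _ _ "{..<0}"]) (use 1 in \<open>auto simp: sqp_def\<close>)
  next
    case 2
    have "((\<lambda>t. t\<^sup>2) has_real_derivative 2 * max 0 t) (at t)" using 2 by (auto intro!: derivative_eq_intros)
    then show ?thesis
      by (rule has_field_derivative_transform_within_open[of _ _ _ "{0<..}"]) (use 2 in \<open>auto simp: sqp_def\<close>)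
  next
    case 3
    have "((\<lambda>h. sqp h / h) \<longlongrightarrow> 0) (at 0)"
    proof (rule Lim_null_comparison)
      show "\<forall>\<^sub>F h in at 0. norm (sqp h / h) \<le> \<bar>h\<bar>"
        by (rule always_eventually) (auto simp: sqp_def max_def power2_eq_square)
      show "((\<lambda>h::real. \<bar>h\<bar>) \<longlongrightarrow> 0) (at 0)" by (rule tendsto_rabs_zero) simp
    qed
    then show ?thesis by (simp add: 3 DERIV_def sqp_def)
  qed
qed

lemma sqp_bounds: "0 \<le> sqp t" "t \<le> 1 \<Longrightarrow> sqp t \<le> 1" "t \<le> 0 \<Longrightarrow> sqp t = 0" "t > 0 \<Longrightarrow> sqp t > 0"
  by (auto simp: sqp_def power_le_one)

lemma C1c_radial_bump:
  fixes a :: "'a::euclidean_space"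
  assumes r: "r > 0"
  shows "(\<lambda>x. sqp (1 - (norm (x - a))\<^sup>2 / r\<^sup>2)) \<in> C1c UNIV"
    "x \<notin> ball a r \<Longrightarrow> sqp (1 - (norm (x - a))\<^sup>2 / r\<^sup>2) = 0"
proof -
  let ?h = "\<lambda>x. 1 - (norm (x - a))\<^sup>2 / r\<^sup>2"
  have D1: "(?h has_derivative (\<lambda>v. - (2 * ((x - a) \<bullet> v)) / r\<^sup>2)) (at x)" for x
  proof -
    have "((\<lambda>x. (x - a) \<bullet> (x - a)) has_derivative (\<lambda>v. (x - a) \<bullet> v + v \<bullet> (x - a))) (at x)"
      by (auto intro!: derivative_eq_intros)
    from has_derivative_diff[OF has_derivative_const has_derivative_mult_left[OF this], of 1 "1 / r\<^sup>2"]
    show ?thesis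
      by (simp add: power2_norm_eq_inner inner_commute[of _ "x - a"])
  qed
  have D: "((\<lambda>x. sqp (?h x)) has_derivative (\<lambda>v. 2 * max 0 (?h x) * (- (2 * ((x - a) \<bullet> v)) / r\<^sup>2))) (at x)" for x
    using has_derivative_compose[OF D1 sqp_has_real_derivative[unfolded has_field_derivative_def]] .
  show z: "sqp (?h x) = 0" if "x \<notin> ball a r" for x
  proof -
    have "r\<^sup>2 \<le> (norm (x - a))\<^sup>2"
      using that r by (intro power_mono) (auto simp: dist_norm norm_minus_commute)
    then show ?thesis using r by (intro sqp_bounds) (simp add: divide_simps)
  qed
  show "(\<lambda>x. sqp (?h x)) \<in> C1c UNIV"
    by (rule C1cI[OF D _ compact_cball[of a r] _ z]) (use r in \<open>auto intro!: continuous_intros\<close>)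
qed

text \<open>The centre is arbitrary because convolution with a kernel centred at a also translates
  by a; the inward shift near the boundary is built in this way.\<close>

lemma C1c_mollifier:
  fixes a :: "'a::euclidean_space"
  assumes r: "r > 0"
  obtains \<eta> :: "'a \<Rightarrow> real" where "\<eta> \<in> C1c UNIV" "\<And>x. \<eta> x \<ge> 0" "(LBINT x. \<eta> x) = 1" "\<And>x. x \<notin> ball a r \<Longrightarrow> \<eta> x = 0"
proof -
  define b where "b = (\<lambda>x. sqp (1 - (norm (x - a))\<^sup>2 / r\<^sup>2))"
  have b: "b \<in> C1c UNIV" unfolding b_def by (rule C1c_radial_bump(1)[OF r])
  have nonneg: "b x \<ge> 0" for x by (simp add: b_def sqp_bounds)
  have pos: "b x > 0" if "x \<in> ball a r" for x
  proof -
    have "(norm (x - a))\<^sup>2 < r\<^sup>2"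
      using that r by (intro power_strict_mono) (auto simp: dist_norm norm_minus_commute)
    then show ?thesis unfolding b_def using r by (intro sqp_bounds) (simp add: divide_simps)
  qed
  have zero: "b x = 0" if "x \<notin> ball a r" for x unfolding b_def by (rule C1c_radial_bump(2)[OF r that])
  obtain K where K: "compact K" "\<And>x. x \<notin> K \<Longrightarrow> b x = 0" using b by (metis C1c_support)
  have int: "integrable lborel b"
    by (rule integrable_continuous_compact_support[OF C1c_continuous[OF b] K])
  \<comment> \<open>b is positive on the ball, so a vanishing integral would make the ball a null
    set.\<close>
  have "(LBINT x. b x) \<noteq> 0"
  proof
    assume "(LBINT x. b x) = 0"
    then have "AE x in lborel. b x = 0"
      using integral_nonneg_eq_0_iff_AE[OF int] nonneg by simp
    then have "emeasure lborel (ball a r) = 0"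
      by (intro AE_iff_measurable[THEN iffD1, rotated 2]) (use pos zero in \<open>force intro: order.strict_implies_not_eq\<close>)+
    then have "negligible (ball a r)"
      by (intro negligible_iff_null_sets[THEN iffD2] null_sets_completionI) auto
    then show False using open_not_negligible[of "ball a r"] r by simp
  qed
  then have I: "(LBINT x. b x) > 0"
    using integral_nonneg_AE[of b lborel] nonneg by (simp add: less_le)
  show ?thesis
  proof (rule that[of "\<lambda>x. b x / (LBINT x. b x)"])
    show "(\<lambda>x. b x / (LBINT x. b x)) \<in> C1c UNIV"
      by (rule C1c_bounded_linear[OF _ b]) (rule bounded_linear_divide)
  qed (use I nonneg zero in auto)
qed

lemma C1c_plateau:
  fixes a :: "'a::euclidean_space"
  assumes r: "r > 0"
  obtains b :: "'a \<Rightarrow> real" where "b \<in> C1c UNIV" "\<And>x. 0 \<le> b x" "\<And>x. b x \<le> 1" "\<And>x. x \<notin> ball a r \<Longrightarrow> b x = 0"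
    "\<And>x. x \<in> ball a (r / 2) \<Longrightarrow> b x = 1"
proof -
  define w where "w = (\<lambda>x. sqp (1 - (norm (x - a))\<^sup>2 / r\<^sup>2))"
  have w: "w \<in> C1c UNIV" unfolding w_def by (rule C1c_radial_bump(1)[OF r])
  \<comment> \<open>h maps 0 to 0 and is constantly 1 from 1/2 on. On the half ball \<open>w\<close>
    is at least (1 - 1/4) squared, that is 9/16, so \<open>h (w x)\<close> has its plateau
    there.\<close>
  define h where "h t = 1 - sqp (1 - 2 * t)" for t
  have "(h has_real_derivative 2 * (2 * max 0 (1 - 2 * t))) (at t)" for t
    unfolding h_def
    by (rule derivative_eq_intros refl DERIV_chain2[OF sqp_has_real_derivative] | simp)+
  then have C: "(\<lambda>x. h (w x)) \<in> C1c UNIV"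
    by (rule C1c_compose_real[OF w]) (auto intro!: continuous_intros simp: h_def sqp_def)
  have wn: "w x \<ge> 0" for x by (simp add: w_def sqp_bounds)
  show ?thesis
  proof (rule that[OF C])
    show "0 \<le> h (w x)" for x using sqp_bounds(2)[of "1 - 2 * w x"] wn[of x] by (simp add: h_def)
    show "h (w x) \<le> 1" for x by (simp add: h_def sqp_bounds)
    show "h (w x) = 0" if "x \<notin> ball a r" for x
      using C1c_radial_bump(2)[OF r that] by (simp add: w_def h_def sqp_def)
    show "h (w x) = 1" if "x \<in> ball a (r / 2)" for x
    proof -
      have "(norm (x - a))\<^sup>2 \<le> (r / 2)\<^sup>2"
        using that r by (intro power_mono) (auto simp: dist_norm norm_minus_commute)
      then have "(norm (x - a))\<^sup>2 / r\<^sup>2 \<le> 1 / 4" using r by (simp add: divide_simps)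
      then have "(3/4)\<^sup>2 \<le> (max 0 (1 - (norm (x - a))\<^sup>2 / r\<^sup>2))\<^sup>2" by (intro power_mono) linarith+
      then have "9/16 \<le> w x" by (simp add: w_def sqp_def power2_eq_square)
      then have "sqp (1 - 2 * w x) = 0" by (intro sqp_bounds) simp
      then show ?thesis by (simp add: h_def)
    qed
  qed
qed

text \<open>Each new function is b_j times what the earlier ones leave of 1, so the remainder gets
  multiplied by 1 - b_j at every step. No division by the sum of the b_i occurs, and the total is 1
  wherever some b_i equals 1.\<close>

lemma C1c_subordinate_partition:
  fixes b :: "'i \<Rightarrow> 'a::euclidean_space \<Rightarrow> real"
  assumes "finite I" "\<And>i. i \<in> I \<Longrightarrow> b i \<in> C1c UNIV" "\<And>i x. i \<in> I \<Longrightarrow> 0 \<le> b i x" "\<And>i x. i \<in> I \<Longrightarrow> b i x \<le> 1"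
  obtains \<theta> where "\<And>i. i \<in> I \<Longrightarrow> \<theta> i \<in> C1c UNIV" "\<And>i x. i \<in> I \<Longrightarrow> 0 \<le> \<theta> i x"
    "\<And>i x. i \<in> I \<Longrightarrow> \<theta> i x \<le> b i x" "\<And>x. (\<Sum>i\<in>I. \<theta> i x) = 1 - (\<Prod>i\<in>I. 1 - b i x)"
proof -
  have "\<exists>\<theta>. (\<forall>i\<in>I. \<theta> i \<in> C1c UNIV \<and> (\<forall>x. 0 \<le> \<theta> i x \<and> \<theta> i x \<le> b i x)) \<and>
      (\<forall>x. (\<Sum>i\<in>I. \<theta> i x) = 1 - (\<Prod>i\<in>I. 1 - b i x))"
    using assms
  proof (induction I rule: finite_induct)
    case empty
    then show ?case by simp
  next
    case (insert j I)
    from insert.IH insert.prems obtain \<theta> where \<theta>: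
      "\<And>i. i \<in> I \<Longrightarrow> \<theta> i \<in> C1c UNIV" "\<And>i x. i \<in> I \<Longrightarrow> 0 \<le> \<theta> i x" "\<And>i x. i \<in> I \<Longrightarrow> \<theta> i x \<le> b i x"
      "\<And>x. (\<Sum>i\<in>I. \<theta> i x) = 1 - (\<Prod>i\<in>I. 1 - b i x)"
      by (metis insert_iff)
    define S where "S x = (\<Sum>i\<in>I. \<theta> i x)" for x
    have "(\<lambda>x. S x) \<in> C1c UNIV" unfolding S_def by (rule C1c_sum) (rule \<theta>)
    then have C: "(\<lambda>x. b j x + (- 1) *\<^sub>R (S x *\<^sub>R b j x)) \<in> C1c UNIV"
      using C1c_scaleR[of S UNIV "b j" UNIV] insert.prems(1)
      by (intro C1c_add C1c_bounded_linear[OF bounded_linear_scaleR_right[of "-1"]]) auto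
    have "0 \<le> (\<Prod>i\<in>I. 1 - b i x)" "(\<Prod>i\<in>I. 1 - b i x) \<le> 1" for x
      using insert.prems by (auto intro!: prod_nonneg prod_le_1)
    then have S01: "0 \<le> S x" "S x \<le> 1" for x by (auto simp: S_def \<theta>(4))
    define \<theta>' where "\<theta>' = \<theta>(j := \<lambda>x. b j x * (1 - S x))"
    have eq: "\<theta>' i = \<theta> i" if "i \<in> I" for i using that insert.hyps by (auto simp: \<theta>'_def)
    have "b j \<in> C1c UNIV" and bj: "\<And>x. 0 \<le> b j x" using insert.prems by auto
    have "\<theta>' j \<in> C1c UNIV" using C by (simp add: \<theta>'_def algebra_simps)
    moreover have "0 \<le> \<theta>' j x" "\<theta>' j x \<le> b j x" for x
      using S01[of x] bj[of x] by (auto simp: \<theta>'_def mult_left_le)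
    moreover have "(\<Sum>i\<in>insert j I. \<theta>' i x) = 1 - (\<Prod>i\<in>insert j I. 1 - b i x)" for x
    proof -
      have "(\<Sum>i\<in>insert j I. \<theta>' i x) = b j x * (1 - S x) + S x"
        using insert.hyps eq by (simp add: S_def) (simp add: \<theta>'_def S_def)
      also have "\<dots> = 1 - (1 - b j x) * (1 - S x)" by (simp add: algebra_simps)
      also have "1 - S x = (\<Prod>i\<in>I. 1 - b i x)" by (simp add: S_def \<theta>(4))
      finally show ?thesis using insert.hyps by simp
    qed
    ultimately show ?case
      using \<theta> eq by (intro exI[of _ \<theta>']) auto
  qed
  then obtain \<theta> where "\<And>i. i \<in> I \<Longrightarrow> \<theta> i \<in> C1c UNIV" "\<And>i x. i \<in> I \<Longrightarrow> 0 \<le> \<theta> i x"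
    "\<And>i x. i \<in> I \<Longrightarrow> \<theta> i x \<le> b i x" "\<And>x. (\<Sum>i\<in>I. \<theta> i x) = 1 - (\<Prod>i\<in>I. 1 - b i x)"
    by blast
  then show ?thesis by (rule that)
qed

section \<open>Convolution and approximation in \<open>L\<^sup>2\<close>\<close>

lemma integrable_scaleR_bounded:
  fixes f :: "'a \<Rightarrow> real" and g :: "'a \<Rightarrow> 'b::{banach, second_countable_topology}"
  assumes f: "integrable M f" and [measurable]: "g \<in> borel_measurable M" and B: "\<And>x. norm (g x) \<le> B"
  shows "integrable M (\<lambda>x. f x *\<^sub>R g x)"
proof (rule Bochner_Integration.integrable_bound)
  show "integrable M (\<lambda>x. B * f x)" using f by simp
  have [measurable]: "f \<in> borel_measurable M" using f by auto
  show "(\<lambda>x. f x *\<^sub>R g x) \<in> borel_measurable M" by simp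
  have "0 \<le> B" using B[of undefined] norm_ge_zero order_trans by blast
  then show "AE x in M. norm (f x *\<^sub>R g x) \<le> norm (B * f x)"
    using B by (auto intro!: AE_I2 mult_mono simp: abs_mult mult.commute[of B])
qed

lemma norm_LINT_le:
  fixes f :: "'a \<Rightarrow> 'b::{banach, second_countable_topology}"
  assumes "integrable M f" "integrable M g" "\<And>x. norm (f x) \<le> g x"
  shows "norm (LINT x|M. f x) \<le> (LINT x|M. g x)"
proof -
  have "norm (LINT x|M. f x) \<le> (LINT x|M. norm (f x))" by (rule integral_norm_bound)
  also have "\<dots> \<le> (LINT x|M. g x)" using assms by (intro integral_mono) auto
  finally show ?thesis .
qed

lemma integrable_convolution:
  fixes f :: "'a::euclidean_space \<Rightarrow> real" and g :: "'a \<Rightarrow> 'b::{banach, second_countable_topology}"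
  assumes f: "integrable lborel f" and g: "continuous_on UNIV g" "compact K" "\<And>x. x \<notin> K \<Longrightarrow> g x = 0"
  shows "integrable lborel (\<lambda>y. f y *\<^sub>R g (x - y))"
proof -
  obtain B where B: "\<And>x. norm (g x) \<le> B"
    using bounded_continuous_compact_support[OF g] by metis
  have [measurable]: "g \<in> borel_measurable borel" by (rule borel_measurable_continuous_onI[OF g(1)])
  show ?thesis by (rule integrable_scaleR_bounded[OF f _ B]) simp
qed

text \<open>Uniform continuity of g makes its translates uniformly close; integration against f
  costs only the factor I, the L1 norm of f.\<close>

lemma continuous_convolution:
  fixes f :: "'a::euclidean_space \<Rightarrow> real" and g :: "'a \<Rightarrow> 'b::{banach, second_countable_topology}"
  assumes f: "integrable lborel f" and g: "continuous_on UNIV g" "compact K" "\<And>x. x \<notin> K \<Longrightarrow> g x = 0"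
  shows "continuous_on S (\<lambda>x. LBINT y. f y *\<^sub>R g (x - y))"
proof -
  let ?F = "\<lambda>x. LBINT y. f y *\<^sub>R g (x - y)"
  define I where "I = (LBINT y. \<bar>f y\<bar>)"
  note int = integrable_convolution[OF f g]
  have I: "I \<ge> 0" unfolding I_def by (rule integral_nonneg_AE) auto
  have q: "I / (I + 1) < 1" using I by simp
  have "\<exists>d>0. \<forall>x'. dist x' x < d \<longrightarrow> dist (?F x') (?F x) < e" if "e > 0" for x e
  proof -
    \<comment> \<open>I may be 0, hence I + 1 in the denominator; the factor I / (I + 1) that
      remains at the end is below 1.\<close>
    have "e / (I + 1) > 0" using that I by (intro divide_pos_pos) linarith+
    then obtain d where d: "d > 0" "\<And>x y. dist x y < d \<Longrightarrow> norm (g x - g y) < e / (I + 1)"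
      using uniformly_continuous_compact_support[OF g] by metis
    have "dist (?F x') (?F x) < e" if x': "dist x' x < d" for x'
    proof -
      have "dist (?F x') (?F x) = norm (LBINT y. f y *\<^sub>R (g (x' - y) - g (x - y)))"
        using int by (simp add: dist_norm scaleR_diff_right)
      also have "\<dots> \<le> (LBINT y. e / (I + 1) * \<bar>f y\<bar>)"
      proof (rule norm_LINT_le)
        show "integrable lborel (\<lambda>y. f y *\<^sub>R (g (x' - y) - g (x - y)))"
          using int by (simp add: scaleR_diff_right)
        show "integrable lborel (\<lambda>y. e / (I + 1) * \<bar>f y\<bar>)" using f by simp
        fix y
        have "norm (g (x' - y) - g (x - y)) \<le> e / (I + 1)"
          using d(2)[of "x' - y" "x - y"] x' by (simp add: dist_norm)
        then show "norm (f y *\<^sub>R (g (x' - y) - g (x - y))) \<le> e / (I + 1) * \<bar>f y\<bar>"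
          by (simp add: mult.commute[of "\<bar>f y\<bar>"] mult_right_mono del: times_divide_eq_left)
      qed
      also have "\<dots> = e * (I / (I + 1))" by (simp add: I_def)
      also have "\<dots> < e * 1" using q \<open>e > 0\<close> by (intro mult_strict_left_mono)
      finally show ?thesis by simp
    qed
    with d(1) show ?thesis by blast
  qed
  then have "continuous_on UNIV ?F" unfolding continuous_on_iff by blast
  then show ?thesis by (rule continuous_on_subset) simp
qed

text \<open>By the mean value theorem and the uniform continuity of the gradient, the first-order
  remainder of \<eta> is o(|v|) uniformly in the base point, and this survives integration against
  f.\<close>

lemma convolution_has_derivative:
  fixes f \<eta> :: "'a::euclidean_space \<Rightarrow> real"
  assumes f: "integrable lborel f" and \<eta>: "\<eta> \<in> C1c UNIV"
  shows "((\<lambda>x. LBINT y. f y * \<eta> (x - y)) has_derivative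
    (\<lambda>v. (LBINT y. f y *\<^sub>R classical_grad \<eta> (x - y)) \<bullet> v)) (at x)"
proof -
  let ?F = "\<lambda>x. LBINT y. f y * \<eta> (x - y)"
  define I where "I = (LBINT y. \<bar>f y\<bar>)"
  let ?G = "LBINT y. f y *\<^sub>R classical_grad \<eta> (x - y)"
  have I: "I \<ge> 0" unfolding I_def by (rule integral_nonneg_AE) auto
  have q: "I / (I + 1) < 1" using I by simp
  obtain K where K: "compact K" "\<And>x. x \<notin> K \<Longrightarrow> \<eta> x = 0" "\<And>x. x \<notin> K \<Longrightarrow> classical_grad \<eta> x = 0"
    using classical_grad_support[OF \<eta>] by metis
  note int = integrable_convolution[OF f C1c_continuous[OF \<eta>] K(1) K(2), simplified]
  note intG = integrable_convolution[OF f continuous_classical_grad[OF \<eta>] K(1) K(3)]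
  show ?thesis unfolding has_derivative_at_alt
  proof (intro conjI allI impI)
    show "bounded_linear ((\<bullet>) ?G)" by (rule bounded_linear_inner_right)
    fix e :: real assume e: "e > 0"
    have "e / (I + 1) > 0" using e I by (intro divide_pos_pos) linarith+
    then obtain d where d: "d > 0"
      "\<And>x y. dist x y < d \<Longrightarrow> norm (classical_grad \<eta> x - classical_grad \<eta> y) < e / (I + 1)"
      using uniformly_continuous_compact_support[OF continuous_classical_grad[OF \<eta>] K(1) K(3)] by metis
    have "norm (?F x' - ?F x - ?G \<bullet> (x' - x)) \<le> e * norm (x' - x)" if x': "norm (x' - x) < d" for x'
    proof -
      let ?R = "\<lambda>y. f y * (\<eta> (x' - y) - \<eta> (x - y) - classical_grad \<eta> (x - y) \<bullet> (x' - x))"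
      have intI: "integrable lborel (\<lambda>y. (f y *\<^sub>R classical_grad \<eta> (x - y)) \<bullet> (x' - x))"
        by (rule integrable_inner_left) (rule intG)
      then have int3: "integrable lborel (\<lambda>y. f y * (classical_grad \<eta> (x - y) \<bullet> (x' - x)))" by simp
      have intR: "integrable lborel ?R" using int int3 by (simp add: right_diff_distrib)
      have "?G \<bullet> (x' - x) = (LBINT y. (f y *\<^sub>R classical_grad \<eta> (x - y)) \<bullet> (x' - x))"
        by (rule integral_inner_left[symmetric]) (rule intG)
      then have "?F x' - ?F x - ?G \<bullet> (x' - x) = (LBINT y. ?R y)"
        using int int3 by (simp add: right_diff_distrib)
      also have "norm \<dots> \<le> (LBINT y. e / (I + 1) * norm (x' - x) * \<bar>f y\<bar>)"
      proof (rule norm_LINT_le[OF intR])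
        show "integrable lborel (\<lambda>y. e / (I + 1) * norm (x' - x) * \<bar>f y\<bar>)" using f by simp
        fix y
        obtain z where z: "0 < z" "z < 1"
          "\<eta> (x - y + (x' - x)) - \<eta> (x - y) = classical_grad \<eta> (x - y + z *\<^sub>R (x' - x)) \<bullet> (x' - x)"
          using C1c_mean_value[OF \<eta>] by metis
        have "dist (x - y + z *\<^sub>R (x' - x)) (x - y) < d"
          using x' z mult_left_le_one_le[of "norm (x' - x)" z] by (simp add: dist_norm)
        then have "norm (classical_grad \<eta> (x - y + z *\<^sub>R (x' - x)) - classical_grad \<eta> (x - y)) \<le> e / (I + 1)"
          using d(2) less_imp_le by blast
        then have "\<bar>(classical_grad \<eta> (x - y + z *\<^sub>R (x' - x)) - classical_grad \<eta> (x - y)) \<bullet> (x' - x)\<bar>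
            \<le> e / (I + 1) * norm (x' - x)"
          using Cauchy_Schwarz_ineq2 order_trans mult_right_mono norm_ge_zero by metis
        moreover have "\<eta> (x' - y) - \<eta> (x - y) - classical_grad \<eta> (x - y) \<bullet> (x' - x)
            = (classical_grad \<eta> (x - y + z *\<^sub>R (x' - x)) - classical_grad \<eta> (x - y)) \<bullet> (x' - x)"
          using z(3) by (simp add: inner_diff_left)
        ultimately show "norm (?R y) \<le> e / (I + 1) * norm (x' - x) * \<bar>f y\<bar>"
          by (simp add: abs_mult mult.commute[of "\<bar>f y\<bar>"] mult_right_mono del: times_divide_eq_left)
      qed
      also have "\<dots> = e * norm (x' - x) * (I / (I + 1))" by (simp add: I_def)
      also have "\<dots> \<le> e * norm (x' - x) * 1" using q e by (intro mult_left_mono) auto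
      finally show ?thesis by simp
    qed
    with d(1) show "\<exists>d>0. \<forall>y. norm (y - x) < d \<longrightarrow> norm (?F y - ?F x - ?G \<bullet> (y - x)) \<le> e * norm (y - x)"
      by blast
  qed
qed

text \<open>The support is controlled through a set K chosen by the caller rather than as the sum of
  two supports, so that a kernel centred away from 0 can place it inside U.\<close>

lemma C1c_convolution:
  fixes f \<eta> :: "'a::euclidean_space \<Rightarrow> real"
  assumes f: "integrable lborel f" and \<eta>: "\<eta> \<in> C1c UNIV"
    and K: "compact K" "K \<subseteq> U" "\<And>x y. f y * \<eta> (x - y) \<noteq> 0 \<Longrightarrow> x \<in> K"
  shows "(\<lambda>x. LBINT y. f y * \<eta> (x - y)) \<in> C1c U"
    "classical_grad (\<lambda>x. LBINT y. f y * \<eta> (x - y)) x = (LBINT y. f y *\<^sub>R classical_grad \<eta> (x - y))"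
proof -
  obtain L where L: "compact L" "\<And>x. x \<notin> L \<Longrightarrow> \<eta> x = 0" "\<And>x. x \<notin> L \<Longrightarrow> classical_grad \<eta> x = 0"
    using classical_grad_support[OF \<eta>] by metis
  note D = convolution_has_derivative[OF f \<eta>]
  show C: "(\<lambda>x. LBINT y. f y * \<eta> (x - y)) \<in> C1c U"
  proof (rule C1cI[OF D _ K(1,2)])
    show "continuous_on UNIV (\<lambda>x. (LBINT y. f y *\<^sub>R classical_grad \<eta> (x - y)) \<bullet> b)" for b
      by (intro continuous_intros continuous_convolution[OF f continuous_classical_grad[OF \<eta>] L(1,3)])
    show "(LBINT y. f y * \<eta> (x - y)) = 0" if "x \<notin> K" for x
    proof -
      have "(\<lambda>y. f y * \<eta> (x - y)) = (\<lambda>y. 0)" using K(3) that by blast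
      then show ?thesis by (metis integral_zero)
    qed
  qed
  show "classical_grad (\<lambda>x. LBINT y. f y * \<eta> (x - y)) x = (LBINT y. f y *\<^sub>R classical_grad \<eta> (x - y))"
    by (rule classical_grad_eqI[OF C D])
qed

section \<open>Density of continuous functions of compact support in L2\<close>

lemma square_add_le: "(a + b)\<^sup>2 \<le> 2 * a\<^sup>2 + 2 * (b::real)\<^sup>2"
  using zero_le_power2[of "a - b"] by (simp add: power2_eq_square algebra_simps)

text \<open>Range and domain are truncated together: at each x the error is zero from some n on, and
  its square never exceeds that of h.\<close>

lemma L2_approx_truncated:
  fixes h :: "'a::euclidean_space \<Rightarrow> real"
  assumes [measurable]: "h \<in> borel_measurable borel" and h2: "integrable lborel (\<lambda>x. (h x)\<^sup>2)"
  shows "(\<lambda>n. LBINT x. (h x - indicator (cball 0 (real n)) x * max (- real n) (min (real n) (h x)))\<^sup>2) \<longlonglongrightarrow> 0"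
proof -
  let ?h = "\<lambda>n x. indicator (cball 0 (real n)) x * max (- real n) (min (real n) (h x))"
  have [measurable]: "cball (0::'a) r \<in> sets borel" for r by simp
  have "(\<lambda>n. LBINT x. (h x - ?h n x)\<^sup>2) \<longlonglongrightarrow> (LINT x|(lborel::'a measure). 0)"
  proof (rule integral_dominated_convergence[OF _ _ h2])
    show "AE x in lborel. (\<lambda>n. (h x - ?h n x)\<^sup>2) \<longlonglongrightarrow> 0"
    proof (rule AE_I2)
      fix x
      obtain N :: nat where N: "real N > max (norm x) \<bar>h x\<bar>" using reals_Archimedean2 by blast
      have "\<forall>\<^sub>F n in sequentially. (h x - ?h n x)\<^sup>2 = 0"
        using eventually_ge_at_top[of N]
      proof eventually_elim
        case (elim n)
        then have "real n \<ge> real N" by simp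
        with N have "norm x \<le> real n" "- real n \<le> h x" "h x \<le> real n" by linarith+
        then show ?case by simp
      qed
      then show "(\<lambda>n. (h x - ?h n x)\<^sup>2) \<longlonglongrightarrow> 0" by (rule tendsto_eventually)
    qed
    show "AE x in lborel. norm ((h x - ?h n x)\<^sup>2) \<le> (h x)\<^sup>2" for n
      by (rule AE_I2) (auto simp: indicator_def max_def min_def abs_le_square_iff[symmetric])
  qed measurable
  then show ?thesis by simp
qed

text \<open>Measurability supplies continuous functions that converge to h off a null set. Clipping
  them to the range of h and cutting them off in space leaves the limit unchanged and provides a
  common majorant.\<close>

lemma L2_approx_continuous_bounded:
  fixes h :: "'a::euclidean_space \<Rightarrow> real"
  assumes [measurable]: "h \<in> borel_measurable borel"
    and h: "\<And>x. \<bar>h x\<bar> \<le> real n" "\<And>x. norm x > real n \<Longrightarrow> h x = 0" and e: "e > 0"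
  obtains k where "continuous_on UNIV k" "\<And>x. norm x > real n + 1 \<Longrightarrow> k x = 0"
    "integrable lborel (\<lambda>x. (h x - k x)\<^sup>2)" "(LBINT x. (h x - k x)\<^sup>2) < e"
proof -
  have "h measurable_on UNIV"
    by (subst measurable_on_iff_borel_measurable) (auto simp: lebesgue_on_UNIV_eq intro: measurable_completion)
  then obtain N g where N: "negligible N" and g: "\<And>m. continuous_on UNIV (g m)"
    "\<And>x. x \<notin> N \<Longrightarrow> (\<lambda>m. g m x) \<longlonglongrightarrow> h x"
    unfolding measurable_on_def by auto
  \<comment> \<open>This is 1 on the ball of radius n, where h may be nonzero, and 0 beyond radius n
    + 1.\<close>
  define cut :: "'a \<Rightarrow> real" where "cut x = max 0 (min 1 (real n + 1 - norm x))" for x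
  define k where "k m x = cut x * max (- real n) (min (real n) (g m x))" for m x
  have ck: "continuous_on UNIV (k m)" for m
    unfolding k_def cut_def by (intro continuous_intros g)
  have [measurable]: "k m \<in> borel_measurable borel" for m
    by (rule borel_measurable_continuous_onI[OF ck])
  have bk: "\<bar>k m x\<bar> \<le> real n" for m x
  proof -
    have "\<bar>k m x\<bar> \<le> 1 * real n" unfolding k_def abs_mult by (intro mult_mono) (auto simp: cut_def)
    then show ?thesis by simp
  qed
  have zk: "k m x = 0" if "norm x > real n + 1" for m x using that by (simp add: k_def cut_def)
  let ?w = "\<lambda>x::'a. (2 * real n)\<^sup>2 * indicator (cball 0 (real n + 1)) x"
  have w: "integrable lborel ?w"
    using emeasure_compact_finite[of "cball (0::'a) (real n + 1)"]
    by (intro integrable_mult_right integrable_real_indicator) auto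
  have "N \<in> null_sets lebesgue" using N by (simp add: negligible_iff_null_sets)
  then have "AE x in lebesgue. x \<notin> N" by (rule AE_not_in)
  then have "AE x in lborel. x \<notin> N" by (simp add: AE_completion_iff)
  then have lim: "AE x in lborel. (\<lambda>m. (h x - k m x)\<^sup>2) \<longlonglongrightarrow> 0"
  proof eventually_elim
    case (elim x)
    have "(\<lambda>m. k m x) \<longlonglongrightarrow> cut x * max (- real n) (min (real n) (h x))"
      unfolding k_def by (intro tendsto_intros g elim)
    moreover have "cut x * max (- real n) (min (real n) (h x)) = h x"
    proof (cases "norm x > real n")
      case True then show ?thesis using h(2)[of x] by simp
    next
      case False
      then have "cut x = 1" by (simp add: cut_def)
      moreover have "- real n \<le> h x" "h x \<le> real n" using h(1)[of x] by linarith+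
      ultimately show ?thesis by simp
    qed
    ultimately have "(\<lambda>m. k m x) \<longlonglongrightarrow> h x" by simp
    then have "(\<lambda>m. (h x - k m x)\<^sup>2) \<longlonglongrightarrow> (h x - h x)\<^sup>2" by (intro tendsto_intros)
    then show ?case by simp
  qed
  have bound: "AE x in lborel. norm ((h x - k m x)\<^sup>2) \<le> ?w x" for m
  proof (rule AE_I2)
    fix x
    show "norm ((h x - k m x)\<^sup>2) \<le> ?w x"
    proof (cases "norm x > real n + 1")
      case True then show ?thesis using h(2)[of x] zk[of x m] by simp
    next
      case False
      have "\<bar>h x - k m x\<bar> \<le> \<bar>2 * real n\<bar>" using h(1)[of x] bk[of m x] by simp
      then have "(h x - k m x)\<^sup>2 \<le> (2 * real n)\<^sup>2" by (rule abs_le_square_iff[THEN iffD1])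
      then show ?thesis using False by simp
    qed
  qed
  have int: "integrable lborel (\<lambda>x. (h x - k m x)\<^sup>2)" for m
    by (rule integrable_dominated_convergence2[OF _ _ w lim bound]) measurable
  have "(\<lambda>m. LBINT x. (h x - k m x)\<^sup>2) \<longlonglongrightarrow> (LINT x|(lborel::'a measure). 0)"
    by (rule integral_dominated_convergence[OF _ _ w lim bound]) measurable
  then have "\<forall>\<^sub>F m in sequentially. (LBINT x. (h x - k m x)\<^sup>2) < e"
    using e by (intro order_tendstoD(2)) auto
  then obtain m where "(LBINT x. (h x - k m x)\<^sup>2) < e"
    by (auto simp: eventually_sequentially)
  then show ?thesis using that[of "k m"] ck zk int by blast
qed

lemma L2_approx_continuous:
  fixes h :: "'a::euclidean_space \<Rightarrow> real"
  assumes [measurable]: "h \<in> borel_measurable borel" and h2: "integrable lborel (\<lambda>x. (h x)\<^sup>2)" and e: "e > 0"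
  obtains k K where "continuous_on UNIV k" "compact K" "\<And>x. x \<notin> K \<Longrightarrow> k x = 0"
    "integrable lborel (\<lambda>x. (h x - k x)\<^sup>2)" "(LBINT x. (h x - k x)\<^sup>2) < e"
proof -
  define hn where "hn n x = indicator (cball 0 (real n)) x * max (- real n) (min (real n) (h x))" for n x
  have [measurable]: "cball (0::'a) r \<in> sets borel" for r by simp
  have hnm [measurable]: "hn n \<in> borel_measurable borel" for n unfolding hn_def by measurable
  have "\<forall>\<^sub>F n in sequentially. (LBINT x. (h x - hn n x)\<^sup>2) < e / 4"
    using e unfolding hn_def by (intro order_tendstoD(2)[OF L2_approx_truncated[OF assms(1,2)]]) auto
  then obtain n where n: "(LBINT x. (h x - hn n x)\<^sup>2) < e / 4"
    by (auto simp: eventually_sequentially)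
  have bn: "\<bar>hn n x\<bar> \<le> real n" and zn: "norm x > real n \<Longrightarrow> hn n x = 0" for x
    by (auto simp: hn_def indicator_def)
  \<comment> \<open>Two squared errors below e / 4 each: \<open>square_add_le\<close> doubles their
    sum, which stays below e.\<close>
  have e4: "e / 4 > 0" using e by simp
  obtain k where k: "continuous_on UNIV k" "\<And>x. norm x > real n + 1 \<Longrightarrow> k x = 0"
    "integrable lborel (\<lambda>x. (hn n x - k x)\<^sup>2)" "(LBINT x. (hn n x - k x)\<^sup>2) < e / 4"
    by (rule L2_approx_continuous_bounded[OF hnm bn _ e4]) (erule zn, rule that)
  have [measurable]: "k \<in> borel_measurable borel" by (rule borel_measurable_continuous_onI[OF k(1)])
  have i1: "integrable lborel (\<lambda>x. (h x - hn n x)\<^sup>2)"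
    by (rule Bochner_Integration.integrable_bound[OF h2])
      (auto simp: hn_def indicator_def max_def min_def abs_le_square_iff[symmetric] intro!: AE_I2)
  have le: "(h x - k x)\<^sup>2 \<le> 2 * (h x - hn n x)\<^sup>2 + 2 * (hn n x - k x)\<^sup>2" for x
    using square_add_le[of "h x - hn n x" "hn n x - k x"] by simp
  have i3: "integrable lborel (\<lambda>x. 2 * (h x - hn n x)\<^sup>2 + 2 * (hn n x - k x)\<^sup>2)"
    using i1 k(3) by simp
  have i4: "integrable lborel (\<lambda>x. (h x - k x)\<^sup>2)"
    by (rule Bochner_Integration.integrable_bound[OF i3]) (auto simp: le intro!: AE_I2)
  have "(LBINT x. (h x - k x)\<^sup>2) \<le> (LBINT x. 2 * (h x - hn n x)\<^sup>2 + 2 * (hn n x - k x)\<^sup>2)"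
    by (rule integral_mono[OF i4 i3 le])
  also have "\<dots> < e" using i1 k(3) n k(4) by simp
  finally show ?thesis
    using k i4 by (intro that[of k "cball 0 (real n + 1)"]) auto
qed

text \<open>Fubini, since the kernel has integral 1 in x for every y. Applied to the square of a
  small remainder, it shows that averaging does not enlarge the L2 error.\<close>

lemma integral_mollification:
  fixes w \<eta> :: "'a::euclidean_space \<Rightarrow> real"
  assumes w: "integrable lborel w" and \<eta>: "\<eta> \<in> C1c UNIV" "\<And>x. \<eta> x \<ge> 0" "(LBINT x. \<eta> x) = 1"
  shows "integrable lborel (\<lambda>x. LBINT y. w y * \<eta> (x - y))"
    "(LBINT x. LBINT y. w y * \<eta> (x - y)) = (LBINT y. w y)"
proof -
  have [measurable]: "w \<in> borel_measurable borel" using w by simp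
  have [measurable]: "\<eta> \<in> borel_measurable borel"
    by (rule C1c_borel[OF \<eta>(1)])
  have int\<eta>: "integrable lborel \<eta>"
    using \<eta>(3) not_integrable_integral_eq by fastforce
  have inner: "(LBINT x. \<eta> (x - y)) = 1" "integrable lborel (\<lambda>x. \<eta> (x - y))" for y
    using lborel_integral_translation[of \<eta> "- y"] lborel_integrable_translation[OF int\<eta>, of "- y"] \<eta>(3) by auto
  have I: "integrable (lborel \<Otimes>\<^sub>M lborel) (case_prod (\<lambda>y x. w y * \<eta> (x - y)))"
  proof (rule lborel_pair.Fubini_integrable)
    show "case_prod (\<lambda>y x. w y * \<eta> (x - y)) \<in> borel_measurable (lborel \<Otimes>\<^sub>M lborel)" by measurable
    have "(LBINT x. norm (case (y, x) of (y, x) \<Rightarrow> w y * \<eta> (x - y))) = \<bar>w y\<bar>" for y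
      using \<eta>(2) inner by (simp add: abs_mult)
    then show "integrable lborel (\<lambda>y. LBINT x. norm (case (y, x) of (y, x) \<Rightarrow> w y * \<eta> (x - y)))"
      using w by simp
    show "AE y in lborel. integrable lborel (\<lambda>x. case (y, x) of (y, x) \<Rightarrow> w y * \<eta> (x - y))"
      using inner by simp
  qed
  show "integrable lborel (\<lambda>x. LBINT y. w y * \<eta> (x - y))"
    by (rule lborel_pair.integrable_snd[OF I])
  show "(LBINT x. LBINT y. w y * \<eta> (x - y)) = (LBINT y. w y)"
    using lborel_pair.Fubini_integral[OF I] inner by simp
qed

lemma square_integrable_mult:
  fixes f g :: "'a \<Rightarrow> real"
  assumes [measurable]: "f \<in> borel_measurable M" "g \<in> borel_measurable M"
    and "integrable M (\<lambda>x. (f x)\<^sup>2)" "integrable M (\<lambda>x. (g x)\<^sup>2)"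
  shows "integrable M (\<lambda>x. f x * g x)"
proof (rule Bochner_Integration.integrable_bound)
  show "integrable M (\<lambda>x. (f x)\<^sup>2 + (g x)\<^sup>2)" using assms by simp
  have "\<bar>f x * g x\<bar> \<le> (f x)\<^sup>2 + (g x)\<^sup>2" for x
    using sum_squares_bound[of "\<bar>f x\<bar>" "\<bar>g x\<bar>"] zero_le_power2[of "f x"] zero_le_power2[of "g x"]
    unfolding abs_mult power2_abs by linarith
  then show "AE x in M. norm (f x * g x) \<le> norm ((f x)\<^sup>2 + (g x)\<^sup>2)" by simp
qed simp

text \<open>h is split into a continuous compactly supported k, whose oscillation on the scale
  \<tau> is small, and a remainder r small in L2, which is paired with u by a weighted Young
  inequality. The kernel may be any density supported in the ball of radius \<tau>, not necessarily
  centred at 0, so small translations are covered as well.\<close>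

lemma mollification_weak_limit:
  fixes u h :: "'a::euclidean_space \<Rightarrow> real"
  assumes u: "integrable lborel u" "integrable lborel (\<lambda>x. (u x)\<^sup>2)"
    and h: "integrable lborel h" "integrable lborel (\<lambda>x. (h x)\<^sup>2)" and e: "e > 0"
  shows "\<exists>\<tau>>0. \<forall>\<eta>\<in>C1c UNIV. (\<forall>x. \<eta> x \<ge> 0) \<longrightarrow> (LBINT x. \<eta> x) = 1 \<longrightarrow> (\<forall>x. x \<notin> ball 0 \<tau> \<longrightarrow> \<eta> x = 0) \<longrightarrow>
      \<bar>(LBINT x. u x * (LBINT y. h y * \<eta> (x - y))) - (LBINT x. u x * h x)\<bar> \<le> e"
proof -
  have [measurable]: "u \<in> borel_measurable borel" "h \<in> borel_measurable borel"
    using u(1) h(1) by simp_all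
  define U where "U = (LBINT x. (u x)\<^sup>2)"
  define U1 where "U1 = (LBINT x. \<bar>u x\<bar>)"
  have U: "U \<ge> 0" unfolding U_def by (rule integral_nonneg_AE) auto
  have U1: "U1 \<ge> 0" unfolding U1_def by (rule integral_nonneg_AE) auto
  \<comment> \<open>\<open>s\<close> and \<open>e1\<close> make the terms s U and e1 U1 at most e /
    3; adding 1 to U and U1 allows u = 0.\<close>
  define s where "s = e / (3 * (U + 1))"
  define e1 where "e1 = e / (3 * (U1 + 1))"
  have s: "s > 0" and e1: "e1 > 0" using e U U1 by (simp_all add: s_def e1_def)
  have "e1 * U1 = e / 3 * (U1 / (U1 + 1))" by (simp add: e1_def)
  also have "\<dots> \<le> e / 3 * 1" using e U1 by (intro mult_left_mono) auto
  finally have eU1: "e1 * U1 \<le> e / 3" by simp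
  have "s * U = e / 3 * (U / (U + 1))" by (simp add: s_def)
  also have "\<dots> \<le> e / 3 * 1" using e U by (intro mult_left_mono) auto
  finally have sU: "s * U \<le> e / 3" by simp
  \<comment> \<open>The squared L2 error of k ends up divided by s, hence the tolerance s e /
    3.\<close>
  have hm: "h \<in> borel_measurable borel" and se: "s * e / 3 > 0" using s e by simp_all
  obtain k K where k: "continuous_on UNIV k" "compact K"
    "\<And>x. x \<notin> K \<Longrightarrow> k x = 0" and r2: "integrable lborel (\<lambda>x. (h x - k x)\<^sup>2)" "(LBINT x. (h x - k x)\<^sup>2) < s * e / 3"
    by (rule L2_approx_continuous[OF hm h(2) se]) (rule that)
  have [measurable]: "k \<in> borel_measurable borel" by (rule borel_measurable_continuous_onI[OF k(1)])
  obtain \<tau> where \<tau>: "\<tau> > 0" "\<And>x y. dist x y < \<tau> \<Longrightarrow> norm (k x - k y) < e1"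
    using uniformly_continuous_compact_support[OF k e1] by metis
  show ?thesis
  proof (intro exI[of _ \<tau>] conjI ballI impI)
    fix \<eta> :: "'a \<Rightarrow> real"
    assume "\<eta> \<in> C1c UNIV" "\<forall>x. \<eta> x \<ge> 0" "(LBINT x. \<eta> x) = 1" "\<forall>x. x \<notin> ball 0 \<tau> \<longrightarrow> \<eta> x = 0"
    then have \<eta>: "\<eta> \<in> C1c UNIV" "\<And>x. \<eta> x \<ge> 0" "(LBINT x. \<eta> x) = 1" "\<And>x. x \<notin> ball 0 \<tau> \<Longrightarrow> \<eta> x = 0"
      by blast+
    obtain L where L: "compact L" "\<And>x. x \<notin> L \<Longrightarrow> \<eta> x = 0" using \<eta>(1) by (metis C1c_support)
    note c\<eta> = C1c_continuous[OF \<eta>(1)]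
    have [measurable]: "\<eta> \<in> borel_measurable borel"
      by (rule borel_measurable_continuous_onI[OF c\<eta>])
    have int\<eta>: "integrable lborel \<eta>" by (rule integrable_continuous_compact_support[OF c\<eta> L])
    have k1: "(LBINT y. \<eta> (x - y)) = 1" for x
      using lborel_integral_reflect[of \<eta> x] \<eta>(3) by simp
    have k1i: "integrable lborel (\<lambda>y. \<eta> (x - y))" for x
      using k1[of x] not_integrable_integral_eq by fastforce
    define r where "r x = h x - k x" for x
    have [measurable]: "r \<in> borel_measurable borel" unfolding r_def by measurable
    note r2 = r2[folded r_def]
    define F where "F x = (LBINT y. h y * \<eta> (x - y))" for x
    define P where "P x = (LBINT y. (r y)\<^sup>2 * \<eta> (x - y))" for x
    have intF: "integrable lborel (\<lambda>y. h y * \<eta> (x - y))" for x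
      using integrable_convolution[OF h(1) c\<eta> L] by simp
    have intP: "integrable lborel (\<lambda>y. (r y)\<^sup>2 * \<eta> (x - y))" for x
      using integrable_convolution[OF r2(1) c\<eta> L] by simp
    have P: "integrable lborel P" "(LBINT x. P x) = (LBINT x. (r x)\<^sup>2)"
      using integral_mollification[OF r2(1) \<eta>(1-3)] unfolding P_def by auto
    have "continuous_on UNIV F" unfolding F_def using continuous_convolution[OF h(1) c\<eta> L] by simp
    then have [measurable]: "F \<in> borel_measurable borel" by (rule borel_measurable_continuous_onI)
    \<comment> \<open>An integrable majorant of the pointwise error, obtained by averaging the
      estimate below over y. As P and the square of r have equal integrals, the last term
      contributes the integral of that square divided by s.\<close>
    define W where "W x = e1 * \<bar>u x\<bar> + s * (u x)\<^sup>2 + (P x + (r x)\<^sup>2) / (2 * s)" for x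
    have intW: "integrable lborel W" unfolding W_def using u P r2 by simp
    have bound: "\<bar>u x * F x - u x * h x\<bar> \<le> W x" for x
    proof -
      have "u x * F x - u x * h x = (LBINT y. u x * (h y * \<eta> (x - y))) - (LBINT y. u x * h x * \<eta> (x - y))"
        using k1 by (simp add: F_def)
      also have "\<dots> = (LBINT y. u x * (h y - h x) * \<eta> (x - y))"
        using Bochner_Integration.integral_diff[OF integrable_mult_right[OF intF[of x], of "u x"] integrable_mult_right[OF k1i[of x], of "u x * h x"]]
        by (simp add: algebra_simps)
      finally have eq: "u x * F x - u x * h x = (LBINT y. u x * (h y - h x) * \<eta> (x - y))" .
      have i1: "integrable lborel (\<lambda>y. u x * (h y - h x) * \<eta> (x - y))"
        using Bochner_Integration.integrable_diff[OF integrable_mult_right[OF intF[of x], of "u x"] integrable_mult_right[OF k1i[of x], of "u x * h x"]]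
        by (simp add: algebra_simps)
      have i2: "integrable lborel (\<lambda>y. (e1 * \<bar>u x\<bar> + s * (u x)\<^sup>2 + (r x)\<^sup>2 / (2 * s)) * \<eta> (x - y) + (r y)\<^sup>2 * \<eta> (x - y) / (2 * s))"
        using k1i[of x] intP[of x] by (intro Bochner_Integration.integrable_add integrable_mult_right integrable_divide)
      have "norm (LBINT y. u x * (h y - h x) * \<eta> (x - y)) \<le>
          (LBINT y. (e1 * \<bar>u x\<bar> + s * (u x)\<^sup>2 + (r x)\<^sup>2 / (2 * s)) * \<eta> (x - y) + (r y)\<^sup>2 * \<eta> (x - y) / (2 * s))"
      proof (rule norm_LINT_le[OF i1 i2])
        fix y
        show "norm (u x * (h y - h x) * \<eta> (x - y)) \<le>
          (e1 * \<bar>u x\<bar> + s * (u x)\<^sup>2 + (r x)\<^sup>2 / (2 * s)) * \<eta> (x - y) + (r y)\<^sup>2 * \<eta> (x - y) / (2 * s)"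
        proof (cases "\<eta> (x - y) = 0")
          case False
          then have "dist y x < \<tau>" using \<eta>(4)[of "x - y"] by (auto simp: dist_norm norm_minus_commute)
          then have kk: "\<bar>k y - k x\<bar> \<le> e1" using \<tau>(2)[of y x] by simp
          \<comment> \<open>Weighted Young inequality, used once for r at y and once for r at x; the
            two halves s / 2 add up to s.\<close>
          have am: "\<bar>u x\<bar> * \<bar>a\<bar> \<le> s / 2 * (u x)\<^sup>2 + a\<^sup>2 / (2 * s)" for a
          proof -
            have "0 \<le> (s * \<bar>u x\<bar> - \<bar>a\<bar>)\<^sup>2 / (2 * s)" using s by simp
            also have "\<dots> = s / 2 * (u x)\<^sup>2 + a\<^sup>2 / (2 * s) - \<bar>u x\<bar> * \<bar>a\<bar>"
              using s by (simp add: power2_eq_square field_simps)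
            finally show ?thesis by simp
          qed
          have "\<bar>u x * (h y - h x)\<bar> \<le> \<bar>u x\<bar> * (\<bar>k y - k x\<bar> + \<bar>r y\<bar> + \<bar>r x\<bar>)"
            unfolding abs_mult by (intro mult_left_mono) (auto simp: r_def)
          also have "\<dots> = \<bar>u x\<bar> * \<bar>k y - k x\<bar> + \<bar>u x\<bar> * \<bar>r y\<bar> + \<bar>u x\<bar> * \<bar>r x\<bar>" by (simp add: algebra_simps)
          also have "\<dots> \<le> \<bar>u x\<bar> * e1 + (s / 2 * (u x)\<^sup>2 + (r y)\<^sup>2 / (2 * s)) + (s / 2 * (u x)\<^sup>2 + (r x)\<^sup>2 / (2 * s))"
            using kk by (intro add_mono am mult_left_mono) auto
          also have "\<dots> = e1 * \<bar>u x\<bar> + s * (u x)\<^sup>2 + (r x)\<^sup>2 / (2 * s) + (r y)\<^sup>2 / (2 * s)" by simp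
          finally have "\<bar>u x * (h y - h x)\<bar> * \<eta> (x - y) \<le> (e1 * \<bar>u x\<bar> + s * (u x)\<^sup>2 + (r x)\<^sup>2 / (2 * s) + (r y)\<^sup>2 / (2 * s)) * \<eta> (x - y)"
            using \<eta>(2) by (rule mult_right_mono)
          then show ?thesis using \<eta>(2)[of "x - y"] by (simp add: abs_mult distrib_right)
        qed simp
      qed
      also have "\<dots> = (e1 * \<bar>u x\<bar> + s * (u x)\<^sup>2 + (r x)\<^sup>2 / (2 * s)) * 1 + P x / (2 * s)"
        using k1i[of x] intP[of x] k1[of x] unfolding P_def
        by (subst Bochner_Integration.integral_add) (auto intro!: integrable_mult_right integrable_divide)
      also have "\<dots> = W x" by (simp add: W_def add_divide_distrib)
      finally show ?thesis unfolding eq by simp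
    qed
    have iuh: "integrable lborel (\<lambda>x. u x * h x)"
      by (rule square_integrable_mult[OF _ _ u(2) h(2)]) simp_all
    have id: "integrable lborel (\<lambda>x. u x * F x - u x * h x)"
      by (rule Bochner_Integration.integrable_bound[OF intW]) (auto intro!: AE_I2 order_trans[OF bound])
    have iuF: "integrable lborel (\<lambda>x. u x * F x)"
      using Bochner_Integration.integrable_add[OF id iuh] by simp
    have "\<bar>(LBINT x. u x * F x) - (LBINT x. u x * h x)\<bar> = norm (LBINT x. u x * F x - u x * h x)"
      using iuF iuh by simp
    also have "\<dots> \<le> (LBINT x. W x)"
      by (rule norm_LINT_le[OF id intW]) (use bound in simp)
    also have "\<dots> = e1 * U1 + s * U + (LBINT x. (r x)\<^sup>2) / s"
      unfolding W_def using u P r2 by (simp add: U_def U1_def field_simps)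
    also have "\<dots> \<le> e / 3 + e / 3 + e / 3"
      using r2(2) s by (intro add_mono eU1 sU) (simp add: divide_simps mult.commute)
    finally show "\<bar>(LBINT x. u x * (LBINT y. h y * \<eta> (x - y))) - (LBINT x. u x * h x)\<bar> \<le> e"
      by (simp add: F_def)
  qed (rule \<tau>(1))
qed

text \<open>For x in a compact K and a narrow kernel, the mollification of g at x is the pairing of
  g with a test function in U, hence zero. Its weak limit, paired with g restricted to K, is the
  integral of the square of g over K.\<close>

lemma AE_zero_if_orthogonal_C1c:
  fixes g :: "'a::euclidean_space \<Rightarrow> real"
  assumes g: "integrable lborel g" "integrable lborel (\<lambda>x. (g x)\<^sup>2)" and "open U"
    and orth: "\<And>\<phi>. \<phi> \<in> C1c U \<Longrightarrow> (LBINT x. g x * \<phi> x) = 0"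
  shows "AE x in lborel. x \<in> U \<longrightarrow> g x = 0"
proof -
  have [measurable]: "g \<in> borel_measurable borel" using g(1) by simp
  have cpt: "AE x in lborel. x \<in> K \<longrightarrow> g x = 0" if K: "compact K" "K \<subseteq> U" for K
  proof -
    define u where "u x = indicator K x * g x" for x
    have [measurable]: "K \<in> sets borel" using K by (simp add: borel_compact)
    have u: "integrable lborel u" "integrable lborel (\<lambda>x. (u x)\<^sup>2)" "integrable lborel (\<lambda>x. u x * g x)"
      unfolding u_def
      by (rule Bochner_Integration.integrable_bound[OF g(1)] Bochner_Integration.integrable_bound[OF g(2)];
        auto simp: indicator_def power2_eq_square intro!: AE_I2; fail)+
    obtain \<delta> where \<delta>: "\<delta> > 0" "(\<Union>x\<in>K. cball x \<delta>) \<subseteq> U"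
      using compact_subset_open_imp_cball_epsilon_subset[OF K(1) \<open>open U\<close> K(2)] .
    have "\<bar>LBINT x. u x * g x\<bar> \<le> e" if e: "e > 0" for e
    proof -
      obtain \<tau> where \<tau>: "\<tau> > 0"
        "\<forall>\<eta>\<in>C1c UNIV. (\<forall>x. \<eta> x \<ge> 0) \<longrightarrow> (LBINT x. \<eta> x) = 1 \<longrightarrow> (\<forall>x. x \<notin> ball 0 \<tau> \<longrightarrow> \<eta> x = 0) \<longrightarrow>
          \<bar>(LBINT x. u x * (LBINT y. g y * \<eta> (x - y))) - (LBINT x. u x * g x)\<bar> \<le> e"
        using mollification_weak_limit[OF u(1,2) g e] by (elim exE conjE)
      \<comment> \<open>The radius \<tau> serves the weak limit; \<delta> keeps the reflected kernel
        at points of K supported in U.\<close>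
      have "min \<tau> \<delta> > 0" using \<tau>(1) \<delta>(1) by simp
      from C1c_mollifier[OF this, of 0] obtain \<eta> :: "'a \<Rightarrow> real" where \<eta>: "\<eta> \<in> C1c UNIV" "\<And>x. \<eta> x \<ge> 0"
        "(LBINT x. \<eta> x) = 1" "\<And>x. x \<notin> ball 0 (min \<tau> \<delta>) \<Longrightarrow> \<eta> x = 0" by metis
      have "u x * (LBINT y. g y * \<eta> (x - y)) = 0" for x
      proof (cases "x \<in> K")
        case True
        have r: "(\<lambda>y. \<eta> (x - y)) \<in> C1c UNIV" by (rule C1c_reflect(1)[OF \<eta>(1)])
        have z: "\<eta> (x - y) = 0" if "y \<notin> cball x \<delta>" for y
          using that by (intro \<eta>(4)) (auto simp: dist_norm norm_minus_commute)
        have "(\<lambda>y. \<eta> (x - y)) \<in> C1c U"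
          by (rule C1cI[OF C1c_has_derivative[OF r] C1c_continuous_derivative[OF r] compact_cball _ z])
            (use True \<delta>(2) in auto)
        then show ?thesis using orth by simp
      qed (simp add: u_def)
      then have "(LBINT x. u x * (LBINT y. g y * \<eta> (x - y))) = 0" by (simp only: integral_zero)
      moreover have "\<eta> x = 0" if "x \<notin> ball 0 \<tau>" for x using that by (intro \<eta>(4)) auto
      ultimately show ?thesis using \<tau>(2)[rule_format, OF \<eta>(1-3)] by simp
    qed
    then have "(LBINT x. u x * g x) = 0"
      by (metis abs_le_zero_iff dense_ge)
    moreover have "AE x in lborel. 0 \<le> u x * g x" by (auto simp: u_def indicator_def)
    ultimately have "AE x in lborel. u x * g x = 0"
      using integral_nonneg_eq_0_iff_AE[OF u(3)] by simp
    then show ?thesis by eventually_elim (auto simp: u_def indicator_def split: if_splits)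
  qed
  obtain C :: "nat \<Rightarrow> 'a set" where C: "\<And>n. compact (C n)" "\<And>n. C n \<subseteq> U" "\<Union>(range C) = U"
    using open_Union_compact_subsets[OF \<open>open U\<close>] by metis
  have "AE x in lborel. \<forall>n::nat. x \<in> C n \<longrightarrow> g x = 0"
    unfolding AE_all_countable using cpt C by blast
  then show ?thesis by eventually_elim (use C(3) in blast)
qed

text \<open>A shift by e v leaves the projection \<pi> along v unchanged and raises the height over
  it by e. The inequality between \<gamma> and the height, which by continuity holds weakly on the
  closure, thereby becomes strict.\<close>

lemma lipschitz_boundary_inward_translation:
  fixes U :: "'a::euclidean_space set"
  assumes "open U" and lip: "lipschitz_boundary U" and x: "x \<in> closure U"
  obtains r v e0 where "r > 0" "e0 > 0"
    "\<And>y e. y \<in> closure U \<inter> cball x r \<Longrightarrow> 0 < e \<Longrightarrow> e < e0 \<Longrightarrow> y + e *\<^sub>R v \<in> U"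
proof (cases "x \<in> U")
  case True
  then obtain r where "r > 0" "cball x r \<subseteq> U" using \<open>open U\<close> open_contains_cball by metis
  then show ?thesis by (intro that[of r 1 0]) auto
next
  case False
  then have "x \<in> frontier U" using x \<open>open U\<close> by (simp add: frontier_def interior_open)
  then obtain r v \<gamma> L where r: "r > 0" and v: "norm v = 1" and L: "L-lipschitz_on {z. z \<bullet> v = 0} \<gamma>"
    and graph: "U \<inter> ball x r = {y \<in> ball x r. \<gamma> (y - (y \<bullet> v) *\<^sub>R v) < y \<bullet> v}"
    using lip unfolding lipschitz_boundary_def by blast
  define \<pi> where "\<pi> y = y - (y \<bullet> v) *\<^sub>R v" for y
  have vv: "v \<bullet> v = 1" using v by (simp add: norm_eq_1)
  have c\<gamma>: "continuous_on {z. z \<bullet> v = 0} \<gamma>" using L by (rule lipschitz_on_continuous_on)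
  have "continuous_on UNIV \<pi>" unfolding \<pi>_def by (intro continuous_intros)
  moreover have "\<pi> ` UNIV \<subseteq> {z. z \<bullet> v = 0}" by (auto simp: \<pi>_def inner_diff_left vv)
  ultimately have c: "continuous_on UNIV (\<lambda>y. \<gamma> (\<pi> y))" by (rule continuous_on_compose2[OF c\<gamma>])
  have le: "\<gamma> (\<pi> y) \<le> y \<bullet> v" if y: "y \<in> closure U" "y \<in> ball x r" for y
  proof -
    have "y \<in> closure (U \<inter> ball x r)"
      using y open_Int_closure_subset[of "ball x r" U] by (auto simp: Int_commute)
    moreover have "closed {y. \<gamma> (\<pi> y) \<le> y \<bullet> v}"
      by (intro closed_Collect_le c continuous_intros)
    moreover have "U \<inter> ball x r \<subseteq> {y. \<gamma> (\<pi> y) \<le> y \<bullet> v}"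
      unfolding graph by (auto simp: \<pi>_def)
    ultimately show ?thesis using closure_minimal by blast
  qed
  show ?thesis
  \<comment> \<open>Half of r is reserved for y and half for the shift, so that the shifted point
    remains where the graph describes U.\<close>
  proof (rule that[of "r / 2" "r / 2" v])
    fix y e assume y: "y \<in> closure U \<inter> cball x (r / 2)" and e: "0 < e" "e < r / 2"
    have "dist x (y + e *\<^sub>R v) \<le> dist x y + norm (e *\<^sub>R v)"
      by (metis dist_triangle dist_add_cancel add.right_neutral dist_0_norm dist_commute)
    then have b: "y + e *\<^sub>R v \<in> ball x r" using y e v by simp
    have "\<pi> (y + e *\<^sub>R v) = \<pi> y" by (simp add: \<pi>_def inner_add_left vv algebra_simps)
    moreover have "\<gamma> (\<pi> y) \<le> y \<bullet> v" using y r by (intro le) auto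
    ultimately have "\<gamma> (\<pi> (y + e *\<^sub>R v)) < (y + e *\<^sub>R v) \<bullet> v" using e by (simp add: inner_add_left vv)
    then show "y + e *\<^sub>R v \<in> U" using b graph unfolding \<pi>_def by blast
  qed (use r in auto)
qed

section \<open>Inward mollification near a Lipschitz boundary\<close>

lemma finite_positive_lower_bound:
  fixes f :: "'i \<Rightarrow> real"
  assumes "finite I" "\<And>i. i \<in> I \<Longrightarrow> f i > 0"
  obtains e where "e > 0" "\<And>i. i \<in> I \<Longrightarrow> e < f i"
proof -
  \<comment> \<open>The inserted 1 covers an empty I, and halving the minimum makes the inequality
    strict.\<close>
  define e where "e = Min (insert 1 (f ` I)) / 2"
  have "Min (insert 1 (f ` I)) > 0" using assms by (subst Min_gr_iff) auto
  moreover have "Min (insert 1 (f ` I)) \<le> f i" if "i \<in> I" for i using assms that by (intro Min_le) auto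
  ultimately show ?thesis by (intro that[of e]) (force simp: e_def)+
qed

lemma classical_grad_sum:
  fixes f :: "'i \<Rightarrow> 'a::euclidean_space \<Rightarrow> real"
  assumes "\<And>i. i \<in> I \<Longrightarrow> f i \<in> C1c U"
  shows "classical_grad (\<lambda>x. \<Sum>i\<in>I. f i x) x = (\<Sum>i\<in>I. classical_grad (f i) x)"
proof (rule classical_grad_eqI)
  show "(\<lambda>x. \<Sum>i\<in>I. f i x) \<in> C1c U" by (rule C1c_sum) (rule assms)
  have "((\<lambda>x. \<Sum>i\<in>I. f i x) has_derivative (\<lambda>v. \<Sum>i\<in>I. classical_grad (f i) x \<bullet> v)) (at x)"
    by (rule has_derivative_sum) (rule C1c_has_derivative_grad[OF assms])
  then show "((\<lambda>x. \<Sum>i\<in>I. f i x) has_derivative (\<bullet>) (\<Sum>i\<in>I. classical_grad (f i) x)) (at x)"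
    by (rule has_derivative_eq_rhs) (simp add: fun_eq_iff inner_sum_left)
qed

lemma classical_div_components:
  fixes F :: "'a \<Rightarrow> 'a::euclidean_space \<Rightarrow> real"
  assumes F: "\<And>b. b \<in> Basis \<Longrightarrow> F b \<in> C1c U"
  shows "(\<lambda>x. \<Sum>b\<in>Basis. F b x *\<^sub>R b) \<in> C1c U" (is "?q \<in> _")
    "classical_div (\<lambda>x. \<Sum>b\<in>Basis. F b x *\<^sub>R b) x = (\<Sum>b\<in>Basis. classical_grad (F b) x \<bullet> b)"
proof -
  show q: "?q \<in> C1c U"
    by (intro C1c_sum C1c_bounded_linear[OF bounded_linear_scaleR_left] F)
  have "(?q has_derivative (\<lambda>v. \<Sum>b\<in>Basis. (classical_grad (F b) x \<bullet> v) *\<^sub>R b)) (at x)"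
    by (intro has_derivative_sum has_derivative_scaleR_left C1c_has_derivative_grad[OF F])
  then have "frechet_derivative ?q (at x) = (\<lambda>v. \<Sum>b\<in>Basis. (classical_grad (F b) x \<bullet> v) *\<^sub>R b)"
    by (rule C1c_eq_frechet_derivative[OF q])
  then show "classical_div ?q x = (\<Sum>b\<in>Basis. classical_grad (F b) x \<bullet> b)"
    by (simp add: classical_div_def)
qed

lemma square_integrable_add:
  fixes f g :: "'a \<Rightarrow> real"
  assumes [measurable]: "f \<in> borel_measurable M" "g \<in> borel_measurable M"
    and "integrable M (\<lambda>x. (f x)\<^sup>2)" "integrable M (\<lambda>x. (g x)\<^sup>2)"
  shows "integrable M (\<lambda>x. (f x + g x)\<^sup>2)"
proof (rule Bochner_Integration.integrable_bound)
  show "integrable M (\<lambda>x. 2 * (f x)\<^sup>2 + 2 * (g x)\<^sup>2)" using assms by simp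
  show "AE x in M. norm ((f x + g x)\<^sup>2) \<le> norm (2 * (f x)\<^sup>2 + 2 * (g x)\<^sup>2)"
    using square_add_le by (intro AE_I2) (simp add: abs_of_nonneg)
qed simp

lemma integrable_bounded_inner:
  fixes p G :: "'a \<Rightarrow> 'b::euclidean_space"
  assumes [measurable]: "p \<in> borel_measurable M" and p: "\<And>x. norm (p x) \<le> 1" and G: "integrable M G"
  shows "integrable M (\<lambda>x. p x \<bullet> G x)"
proof (rule Bochner_Integration.integrable_bound[OF G])
  have [measurable]: "G \<in> borel_measurable M" using G by simp
  show "(\<lambda>x. p x \<bullet> G x) \<in> borel_measurable M" by measurable
  have "\<bar>p x \<bullet> G x\<bar> \<le> norm (G x)" for x
    using Cauchy_Schwarz_ineq2[of "p x" "G x"] mult_right_mono[OF p[of x], of "norm (G x)"] by simp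
  then show "AE x in M. norm (p x \<bullet> G x) \<le> norm (G x)" by simp
qed

text \<open>The half balls already cover the closure, since plateau functions subordinate to the
  full balls equal 1 only on the half balls.\<close>

lemma finite_inward_cover:
  fixes U :: "'a::euclidean_space set"
  assumes "open U" "bounded U" "lipschitz_boundary U"
  obtains I :: "'a set" and r e0 v where "finite I" "\<And>i. i \<in> I \<Longrightarrow> r i > 0" "\<And>i. i \<in> I \<Longrightarrow> e0 i > 0"
    "closure U \<subseteq> (\<Union>i\<in>I. ball i (r i / 2))"
    "\<And>i y e. i \<in> I \<Longrightarrow> y \<in> closure U \<inter> cball i (r i) \<Longrightarrow> 0 < e \<Longrightarrow> e < e0 i \<Longrightarrow> y + e *\<^sub>R v i \<in> U"
proof -
  \<comment> \<open>Radius, shift bound and direction are packed into one triple so that a single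
    choice function yields all three.\<close>
  have "\<forall>x\<in>closure U. \<exists>t. fst t > 0 \<and> fst (snd t) > 0 \<and>
      (\<forall>y e. y \<in> closure U \<inter> cball x (fst t) \<longrightarrow> 0 < e \<longrightarrow> e < fst (snd t) \<longrightarrow> y + e *\<^sub>R snd (snd t) \<in> U)"
  proof
    fix x assume "x \<in> closure U"
    from lipschitz_boundary_inward_translation[OF assms(1,3) this] obtain r v e0 where "r > 0" "e0 > 0"
      "\<And>y e. y \<in> closure U \<inter> cball x r \<Longrightarrow> 0 < e \<Longrightarrow> e < e0 \<Longrightarrow> y + e *\<^sub>R v \<in> U" by metis
    then show "\<exists>t. fst t > 0 \<and> fst (snd t) > 0 \<and>
      (\<forall>y e. y \<in> closure U \<inter> cball x (fst t) \<longrightarrow> 0 < e \<longrightarrow> e < fst (snd t) \<longrightarrow> y + e *\<^sub>R snd (snd t) \<in> U)"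
      by (intro exI[of _ "(r, e0, v)"]) simp
  qed
  from bchoice[OF this] obtain t where t: "\<And>x. x \<in> closure U \<Longrightarrow> fst (t x) > 0 \<and> fst (snd (t x)) > 0 \<and>
      (\<forall>y e. y \<in> closure U \<inter> cball x (fst (t x)) \<longrightarrow> 0 < e \<longrightarrow> e < fst (snd (t x)) \<longrightarrow> y + e *\<^sub>R snd (snd (t x)) \<in> U)"
    by blast
  have "compact (closure U)" using \<open>bounded U\<close> by (simp add: compact_closure)
  then obtain I where I: "I \<subseteq> closure U" "finite I" "closure U \<subseteq> (\<Union>i\<in>I. ball i (fst (t i) / 2))"
  proof (rule compactE_image[where C = "closure U" and f = "\<lambda>i. ball i (fst (t i) / 2)"])
    show "closure U \<subseteq> (\<Union>i\<in>closure U. ball i (fst (t i) / 2))" using t by force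
  qed auto
  show ?thesis
  proof (rule that[of I "\<lambda>i. fst (t i)" "\<lambda>i. fst (snd (t i))" "\<lambda>i. snd (snd (t i))"])
    fix i assume "i \<in> I"
    then have "i \<in> closure U" using I by blast
    note t = t[OF this]
    show "fst (t i) > 0" "fst (snd (t i)) > 0" using t by auto
    show "y + e *\<^sub>R snd (snd (t i)) \<in> U"
      if "y \<in> closure U \<inter> cball i (fst (t i))" "0 < e" "e < fst (snd (t i))" for y e using t that by blast
  qed (use I in auto)
qed

text \<open>With plateau functions for b, the product in \<open>C1c_subordinate_partition\<close>
  has a zero factor on the half balls.\<close>

lemma finite_C1c_partition:
  fixes r :: "'a::euclidean_space \<Rightarrow> real"
  assumes I: "finite I" "\<And>i. i \<in> I \<Longrightarrow> r i > 0"
  obtains \<theta> :: "'a \<Rightarrow> 'a \<Rightarrow> real" where "\<And>i. i \<in> I \<Longrightarrow> \<theta> i \<in> C1c UNIV" "\<And>i x. i \<in> I \<Longrightarrow> 0 \<le> \<theta> i x"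
    "\<And>i x. i \<in> I \<Longrightarrow> x \<notin> ball i (r i) \<Longrightarrow> \<theta> i x = 0" "\<And>x. (\<Sum>i\<in>I. \<theta> i x) \<le> 1"
    "\<And>x. x \<in> (\<Union>i\<in>I. ball i (r i / 2)) \<Longrightarrow> (\<Sum>i\<in>I. \<theta> i x) = 1"
proof -
  have "\<forall>i\<in>I. \<exists>b. b \<in> C1c UNIV \<and> (\<forall>x. 0 \<le> b x \<and> b x \<le> (1::real)) \<and> (\<forall>x. x \<notin> ball i (r i) \<longrightarrow> b x = 0)
     \<and> (\<forall>x. x \<in> ball i (r i / 2) \<longrightarrow> b x = 1)"
  proof
    fix i assume "i \<in> I"
    then have "r i > 0" by (rule I(2))
    from C1c_plateau[OF this, of i] show "\<exists>b. b \<in> C1c UNIV \<and> (\<forall>x. 0 \<le> b x \<and> b x \<le> (1::real)) \<and>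
      (\<forall>x. x \<notin> ball i (r i) \<longrightarrow> b x = 0) \<and> (\<forall>x. x \<in> ball i (r i / 2) \<longrightarrow> b x = 1)"
      by metis
  qed
  from bchoice[OF this] obtain b where b: "\<And>i. i \<in> I \<Longrightarrow> b i \<in> C1c UNIV" "\<And>i x. i \<in> I \<Longrightarrow> 0 \<le> b i x"
    "\<And>i x. i \<in> I \<Longrightarrow> b i x \<le> (1::real)" "\<And>i x. i \<in> I \<Longrightarrow> x \<notin> ball i (r i) \<Longrightarrow> b i x = 0"
    "\<And>i x. i \<in> I \<Longrightarrow> x \<in> ball i (r i / 2) \<Longrightarrow> b i x = 1" by blast
  obtain \<theta> where \<theta>: "\<And>i. i \<in> I \<Longrightarrow> \<theta> i \<in> C1c UNIV" "\<And>i x. i \<in> I \<Longrightarrow> 0 \<le> \<theta> i x"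
    "\<And>i x. i \<in> I \<Longrightarrow> \<theta> i x \<le> b i x" "\<And>x. (\<Sum>i\<in>I. \<theta> i x) = 1 - (\<Prod>i\<in>I. 1 - b i x)"
    by (rule C1c_subordinate_partition[where b = b, OF I(1) b(1-3)]) (assumption | rule that)+
  show ?thesis
  proof (rule that[of \<theta>])
    show "\<theta> i x = 0" if "i \<in> I" "x \<notin> ball i (r i)" for i x
      using \<theta>(2,3)[of i x] b(4)[of i x] that by simp
    show "(\<Sum>i\<in>I. \<theta> i x) \<le> 1" for x using b(3) by (auto simp: \<theta>(4) intro!: prod_nonneg)
    show "(\<Sum>i\<in>I. \<theta> i x) = 1" if "x \<in> (\<Union>i\<in>I. ball i (r i / 2))" for x
    proof -
      from that obtain i where "i \<in> I" "b i x = 1" using b(5) by blast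
      then have "(\<Prod>i\<in>I. 1 - b i x) = 0" using I(1) by auto
      then show ?thesis by (simp add: \<theta>(4))
    qed
  qed (use \<theta> in auto)
qed

lemma integrable_mult_C1c:
  fixes f \<theta> :: "'a::euclidean_space \<Rightarrow> real"
  assumes "integrable lborel f" "\<theta> \<in> C1c U"
  shows "integrable lborel (\<lambda>x. f x * \<theta> x)"
proof -
  obtain K where K: "compact K" "\<And>x. x \<notin> K \<Longrightarrow> \<theta> x = 0" using assms(2) by (metis C1c_support)
  obtain B where B: "\<And>x. norm (\<theta> x) \<le> B"
    using bounded_continuous_compact_support[OF C1c_continuous[OF assms(2)] K] by metis
  have "\<theta> \<in> borel_measurable lborel"
    using C1c_borel[OF assms(2)] by simp
  from integrable_scaleR_bounded[OF assms(1) this B] show ?thesis by simp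
qed

text \<open>The left side is the divergence of the mollification of \<theta> p, the right side the
  mollification of its divergence. They agree because y \<mapsto> \<theta> y * \<eta> (x - y) is a
  test function for the weak divergence of p; the minus sign from the reflected kernel moves the
  derivative to the other side.\<close>

lemma weak_div_convolution:
  fixes p :: "'a::euclidean_space \<Rightarrow> 'a" and g \<theta> \<eta> :: "'a \<Rightarrow> real"
  assumes [measurable]: "p \<in> borel_measurable borel" and p: "\<And>x. norm (p x) \<le> 1" and g: "integrable lborel g"
    and wdiv: "\<And>\<phi>. \<phi> \<in> C1c UNIV \<Longrightarrow> (LBINT x. p x \<bullet> classical_grad \<phi> x) = - (LBINT x. g x * \<phi> x)"
    and \<theta>: "\<theta> \<in> C1c UNIV" and \<eta>: "\<eta> \<in> C1c UNIV"
  shows "(\<Sum>b\<in>Basis. (LBINT y. (\<theta> y * (p y \<bullet> b)) *\<^sub>R classical_grad \<eta> (x - y)) \<bullet> b)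
    = (LBINT y. (\<theta> y * g y + classical_grad \<theta> y \<bullet> p y) * \<eta> (x - y))"
proof -
  let ?\<eta> = "\<lambda>y. \<eta> (x - y)"
  obtain K where K: "compact K" "\<And>x. x \<notin> K \<Longrightarrow> \<theta> x = 0" "\<And>x. x \<notin> K \<Longrightarrow> classical_grad \<theta> x = 0"
    using classical_grad_support[OF \<theta>] by metis
  have \<eta>': "?\<eta> \<in> C1c UNIV" and grad\<eta>': "\<And>y. classical_grad ?\<eta> y = - classical_grad \<eta> (x - y)"
    using C1c_reflect[OF \<eta>] by auto
  have c\<eta>: "continuous_on UNIV (\<lambda>y. classical_grad \<eta> (x - y))"
    using continuous_on_minus[OF continuous_classical_grad[OF \<eta>', of UNIV]] by (simp add: grad\<eta>')
  note cont = C1c_continuous[OF \<theta>] C1c_continuous[OF \<eta>'] c\<eta> continuous_classical_grad[OF \<theta>]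
  have i1: "integrable lborel (\<lambda>y. \<theta> y *\<^sub>R classical_grad \<eta> (x - y))"
    by (rule integrable_continuous_compact_support[OF _ K(1)]) (use K in \<open>auto intro!: continuous_intros cont\<close>)
  have i2: "integrable lborel (\<lambda>y. \<eta> (x - y) *\<^sub>R classical_grad \<theta> y)"
    by (rule integrable_continuous_compact_support[OF _ K(1)]) (use K in \<open>auto intro!: continuous_intros cont\<close>)
  have j1: "integrable lborel (\<lambda>y. p y \<bullet> (\<theta> y *\<^sub>R classical_grad \<eta> (x - y)))"
    by (rule integrable_bounded_inner[OF _ p i1]) simp
  have j2: "integrable lborel (\<lambda>y. p y \<bullet> (\<eta> (x - y) *\<^sub>R classical_grad \<theta> y))"
    by (rule integrable_bounded_inner[OF _ p i2]) simp
  have "(\<lambda>y. \<theta> y * \<eta> (x - y)) \<in> C1c UNIV" using C1c_scaleR[OF \<theta> \<eta>'] by simp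
  note test = wdiv[OF this] and ig = integrable_mult_C1c[OF g this]
  have "(LBINT y. p y \<bullet> classical_grad (\<lambda>y. \<theta> y * \<eta> (x - y)) y) =
      (LBINT y. p y \<bullet> (\<eta> (x - y) *\<^sub>R classical_grad \<theta> y) - p y \<bullet> (\<theta> y *\<^sub>R classical_grad \<eta> (x - y)))"
    by (simp add: classical_grad_mult[OF \<theta> \<eta>'] grad\<eta>' inner_add_right inner_diff_right)
  also have "\<dots> = (LBINT y. p y \<bullet> (\<eta> (x - y) *\<^sub>R classical_grad \<theta> y)) - (LBINT y. p y \<bullet> (\<theta> y *\<^sub>R classical_grad \<eta> (x - y)))"
    by (rule Bochner_Integration.integral_diff[OF j2 j1])
  finally have "(LBINT y. p y \<bullet> (\<theta> y *\<^sub>R classical_grad \<eta> (x - y)))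
      = (LBINT y. p y \<bullet> (\<eta> (x - y) *\<^sub>R classical_grad \<theta> y)) + (LBINT y. g y * (\<theta> y * \<eta> (x - y)))"
    using test by simp
  also have "\<dots> = (LBINT y. p y \<bullet> (\<eta> (x - y) *\<^sub>R classical_grad \<theta> y) + g y * (\<theta> y * \<eta> (x - y)))"
    by (rule Bochner_Integration.integral_add[symmetric, OF j2 ig])
  also have "\<dots> = (LBINT y. (\<theta> y * g y + classical_grad \<theta> y \<bullet> p y) * \<eta> (x - y))"
    by (simp add: algebra_simps inner_commute)
  finally have main: "(LBINT y. p y \<bullet> (\<theta> y *\<^sub>R classical_grad \<eta> (x - y))) = \<dots>" .
  have pb: "\<bar>p y \<bullet> b\<bar> \<le> 1" if "b \<in> Basis" for y b
    using Basis_le_norm[OF that, of "p y"] p[of y] by simp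
  have ib: "integrable lborel (\<lambda>y. (\<theta> y * (p y \<bullet> b)) *\<^sub>R classical_grad \<eta> (x - y))" if "b \<in> Basis" for b
  proof (rule Bochner_Integration.integrable_bound[OF i1])
    have [measurable]: "\<theta> \<in> borel_measurable borel" "(\<lambda>y. classical_grad \<eta> (x - y)) \<in> borel_measurable borel"
      by (rule borel_measurable_continuous_onI, rule cont)+
    show "(\<lambda>y. (\<theta> y * (p y \<bullet> b)) *\<^sub>R classical_grad \<eta> (x - y)) \<in> borel_measurable lborel" by measurable
    show "AE y in lborel. norm ((\<theta> y * (p y \<bullet> b)) *\<^sub>R classical_grad \<eta> (x - y)) \<le> norm (\<theta> y *\<^sub>R classical_grad \<eta> (x - y))"
      using pb[OF that] by (auto simp: abs_mult mult_left_le intro!: mult_right_mono)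
  qed
  have "(\<Sum>b\<in>Basis. (LBINT y. (\<theta> y * (p y \<bullet> b)) *\<^sub>R classical_grad \<eta> (x - y)) \<bullet> b)
    = (\<Sum>b\<in>Basis. LBINT y. ((\<theta> y * (p y \<bullet> b)) *\<^sub>R classical_grad \<eta> (x - y)) \<bullet> b)"
    by (intro sum.cong refl integral_inner_left[symmetric] impI ib)
  also have "\<dots> = (LBINT y. (\<Sum>b\<in>Basis. ((\<theta> y * (p y \<bullet> b)) *\<^sub>R classical_grad \<eta> (x - y)) \<bullet> b))"
    by (intro Bochner_Integration.integral_sum[symmetric] integrable_inner_left impI ib)
  also have "(\<lambda>y. (\<Sum>b\<in>Basis. ((\<theta> y * (p y \<bullet> b)) *\<^sub>R classical_grad \<eta> (x - y)) \<bullet> b))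
    = (\<lambda>y. p y \<bullet> (\<theta> y *\<^sub>R classical_grad \<eta> (x - y)))"
    by (subst euclidean_inner[of "p _"]) (simp add: sum_distrib_left algebra_simps)
  finally show ?thesis using main by simp
qed

text \<open>With differently centred kernels the summands average over different places, so that the
  partition of unity cannot be summed under one integral. Each average of \<theta> i is compared
  with its value at x instead, at the cost of c per summand.\<close>

lemma norm_convolution_sum_le:
  fixes p :: "'a::euclidean_space \<Rightarrow> 'a" and \<theta> \<eta> :: "'i \<Rightarrow> 'a \<Rightarrow> real"
  assumes [measurable]: "p \<in> borel_measurable borel" and p: "\<And>x. norm (p x) \<le> 1"
    and \<theta>: "\<And>i. i \<in> I \<Longrightarrow> \<theta> i \<in> C1c UNIV" "\<And>i x. i \<in> I \<Longrightarrow> 0 \<le> \<theta> i x"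
    and \<eta>: "\<And>i. i \<in> I \<Longrightarrow> \<eta> i \<in> C1c UNIV" "\<And>i x. i \<in> I \<Longrightarrow> \<eta> i x \<ge> 0" "\<And>i. i \<in> I \<Longrightarrow> (LBINT x. \<eta> i x) = 1"
    and close: "\<And>i y. i \<in> I \<Longrightarrow> \<eta> i (x - y) \<noteq> 0 \<Longrightarrow> \<theta> i y \<le> \<theta> i x + c"
  shows "norm (\<Sum>b\<in>Basis. (\<Sum>i\<in>I. LBINT y. (\<theta> i y * (p y \<bullet> b)) * \<eta> i (x - y)) *\<^sub>R b) \<le> (\<Sum>i\<in>I. \<theta> i x + c)"
proof -
  \<comment> \<open>The vector-valued convolution behind the scalar components: bounding it as a
    vector gives the Euclidean bound, which separate bounds on the components would not.\<close>
  define V where "V i = (LBINT y. (\<theta> i y * \<eta> i (x - y)) *\<^sub>R p y)" for i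
  have V: "(\<forall>b. V i \<bullet> b = (LBINT y. (\<theta> i y * (p y \<bullet> b)) * \<eta> i (x - y))) \<and> norm (V i) \<le> \<theta> i x + c" if i: "i \<in> I" for i
  proof -
    have \<eta>': "(\<lambda>y. \<eta> i (x - y)) \<in> C1c UNIV" using C1c_reflect[OF \<eta>(1)[OF i]] by auto
    obtain K where K: "compact K" "\<And>y. y \<notin> K \<Longrightarrow> \<eta> i (x - y) = 0" using \<eta>' by (metis C1c_support)
    note c\<eta> = C1c_continuous[OF \<eta>'] and c\<theta> = C1c_continuous[OF \<theta>(1)[OF i]]
    have [measurable]: "\<theta> i \<in> borel_measurable borel" "(\<lambda>y. \<eta> i (x - y)) \<in> borel_measurable borel"
      by (rule borel_measurable_continuous_onI, rule c\<eta> c\<theta>)+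
    have [measurable]: "\<eta> i \<in> borel_measurable borel"
      by (rule C1c_borel[OF \<eta>(1)[OF i]])
    have k1: "(LBINT y. \<eta> i (x - y)) = 1"
      using lborel_integral_reflect[of "\<eta> i" x] \<eta>(3)[OF i] by simp
    have ik: "integrable lborel (\<lambda>y. \<eta> i (x - y))" by (rule integrable_continuous_compact_support[OF c\<eta> K])
    have it: "integrable lborel (\<lambda>y. \<theta> i y * \<eta> i (x - y))"
      by (rule integrable_continuous_compact_support[OF _ K(1)]) (use K(2) in \<open>auto intro!: continuous_intros c\<eta> c\<theta>\<close>)
    have nb: "norm ((\<theta> i y * \<eta> i (x - y)) *\<^sub>R p y) \<le> \<theta> i y * \<eta> i (x - y)" for y
      using \<theta>(2)[OF i, of y] \<eta>(2)[OF i, of "x - y"] p[of y] by (simp add: mult_left_le)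
    have iv: "integrable lborel (\<lambda>y. (\<theta> i y * \<eta> i (x - y)) *\<^sub>R p y)"
    proof (rule Bochner_Integration.integrable_bound[OF it])
      show "AE y in lborel. norm ((\<theta> i y * \<eta> i (x - y)) *\<^sub>R p y) \<le> norm (\<theta> i y * \<eta> i (x - y))"
        unfolding real_norm_def by (intro AE_I2 order_trans[OF nb abs_ge_self])
    qed measurable
    have "norm (V i) \<le> (LBINT y. (\<theta> i x + c) * \<eta> i (x - y))" unfolding V_def
    proof (rule norm_LINT_le[OF iv])
      show "integrable lborel (\<lambda>y. (\<theta> i x + c) * \<eta> i (x - y))" using ik by simp
      fix y
      have "\<theta> i y * \<eta> i (x - y) \<le> (\<theta> i x + c) * \<eta> i (x - y)"
        using close[OF i, of y] \<eta>(2)[OF i, of "x - y"] by (cases "\<eta> i (x - y) = 0") (auto intro: mult_right_mono)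
      with nb show "norm ((\<theta> i y * \<eta> i (x - y)) *\<^sub>R p y) \<le> (\<theta> i x + c) * \<eta> i (x - y)" by (rule order_trans)
    qed
    moreover have "V i \<bullet> b = (LBINT y. (\<theta> i y * (p y \<bullet> b)) * \<eta> i (x - y))" for b
    proof -
      have "V i \<bullet> b = (LBINT y. ((\<theta> i y * \<eta> i (x - y)) *\<^sub>R p y) \<bullet> b)"
        unfolding V_def by (rule integral_inner_left[symmetric]) (rule iv)
      then show ?thesis by (simp add: mult_ac)
    qed
    ultimately show ?thesis using k1 by simp
  qed
  have "(\<Sum>b\<in>Basis. (\<Sum>i\<in>I. LBINT y. (\<theta> i y * (p y \<bullet> b)) * \<eta> i (x - y)) *\<^sub>R b)
      = (\<Sum>b\<in>Basis. ((\<Sum>i\<in>I. V i) \<bullet> b) *\<^sub>R b)"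
    using V by (simp add: inner_sum_left)
  also have "\<dots> = (\<Sum>i\<in>I. V i)" by (rule euclidean_representation)
  finally show ?thesis using V by (auto intro!: sum_norm_le)
qed

lemma square_integrable_mult_bounded:
  fixes f g :: "'a \<Rightarrow> real"
  assumes f: "f \<in> borel_measurable M" "integrable M (\<lambda>x. (f x)\<^sup>2)"
    and g: "g \<in> borel_measurable M" "\<And>x. \<bar>g x\<bar> \<le> B"
  shows "integrable M (\<lambda>x. (g x * f x)\<^sup>2)"
proof -
  have "(g x)\<^sup>2 \<le> B\<^sup>2" for x
    using g(2)[of x] by (intro abs_le_square_iff[THEN iffD1]) (simp add: order_trans)
  then have "integrable M (\<lambda>x. (f x)\<^sup>2 *\<^sub>R (g x)\<^sup>2)"
    using g(1) by (intro integrable_scaleR_bounded[OF f(2), where B = "B\<^sup>2"]) auto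
  then show ?thesis by (simp add: power_mult_distrib mult.commute)
qed

text \<open>The function is the divergence of \<theta> p; the two properties are what
  \<open>mollification_weak_limit\<close> asks of h.\<close>

lemma localized_divergence_integrable:
  fixes p :: "'a::euclidean_space \<Rightarrow> 'a" and g \<theta> :: "'a \<Rightarrow> real"
  assumes pm [measurable]: "p \<in> borel_measurable borel" and p: "\<And>x. norm (p x) \<le> 1"
    and g: "integrable lborel g" "integrable lborel (\<lambda>x. (g x)\<^sup>2)" and \<theta>: "\<theta> \<in> C1c UNIV"
  shows "integrable lborel (\<lambda>y. \<theta> y * g y + classical_grad \<theta> y \<bullet> p y)"
    "integrable lborel (\<lambda>y. (\<theta> y * g y + classical_grad \<theta> y \<bullet> p y)\<^sup>2)"
proof -
  have gm [measurable]: "g \<in> borel_measurable borel" using g by simp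
  obtain K where K: "compact K" "\<And>x. x \<notin> K \<Longrightarrow> \<theta> x = 0" "\<And>x. x \<notin> K \<Longrightarrow> classical_grad \<theta> x = 0"
    using classical_grad_support[OF \<theta>] by metis
  note c = C1c_continuous[OF \<theta>] continuous_classical_grad[OF \<theta>]
  have \<theta>m [measurable]: "\<theta> \<in> borel_measurable borel" and [measurable]: "classical_grad \<theta> \<in> borel_measurable borel"
    by (rule borel_measurable_continuous_onI, rule c)+
  obtain B where B: "\<And>x. norm (\<theta> x) \<le> B" using bounded_continuous_compact_support[OF c(1) K(1,2)] by metis
  have G: "integrable lborel (classical_grad \<theta>)" "integrable lborel (\<lambda>x. (norm (classical_grad \<theta> x))\<^sup>2)"
    by (rule integrable_continuous_compact_support[OF _ K(1)]; use K(3) in \<open>auto intro!: continuous_intros c\<close>)+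
  have "integrable lborel (\<lambda>y. g y * \<theta> y)" by (rule integrable_mult_C1c[OF g(1) \<theta>])
  moreover have "integrable lborel (\<lambda>y. p y \<bullet> classical_grad \<theta> y)"
    by (rule integrable_bounded_inner[OF _ p G(1)]) simp
  ultimately show "integrable lborel (\<lambda>y. \<theta> y * g y + classical_grad \<theta> y \<bullet> p y)"
    by (simp add: mult.commute inner_commute)
  have "integrable lborel (\<lambda>x. (\<theta> x * g x)\<^sup>2)"
    using B gm \<theta>m g(2) by (intro square_integrable_mult_bounded[where B = B]) auto
  moreover have "integrable lborel (\<lambda>x. (classical_grad \<theta> x \<bullet> p x)\<^sup>2)"
  proof (rule Bochner_Integration.integrable_bound[OF G(2)])
    have "\<bar>classical_grad \<theta> x \<bullet> p x\<bar> \<le> \<bar>norm (classical_grad \<theta> x)\<bar>" for x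
      using Cauchy_Schwarz_ineq2[of "classical_grad \<theta> x" "p x"] mult_left_mono[OF p[of x], of "norm (classical_grad \<theta> x)"] by simp
    then show "AE x in lborel. norm ((classical_grad \<theta> x \<bullet> p x)\<^sup>2) \<le> norm ((norm (classical_grad \<theta> x))\<^sup>2)"
      using abs_le_square_iff by (intro AE_I2) (simp only: real_norm_def abs_power2, blast)
  qed measurable
  ultimately show "integrable lborel (\<lambda>y. (\<theta> y * g y + classical_grad \<theta> y \<bullet> p y)\<^sup>2)"
    by (intro square_integrable_add) measurable
qed

lemma integrable_mult_convolution:
  fixes u h \<eta> :: "'a::euclidean_space \<Rightarrow> real"
  assumes u: "integrable lborel u" and h: "integrable lborel h" and \<eta>: "\<eta> \<in> C1c UNIV"
  shows "integrable lborel (\<lambda>x. u x * (LBINT y. h y * \<eta> (x - y)))"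
proof -
  obtain K where K: "compact K" "\<And>x. x \<notin> K \<Longrightarrow> \<eta> x = 0" using \<eta> by (metis C1c_support)
  obtain B where B: "\<And>x. norm (\<eta> x) \<le> B" using bounded_continuous_compact_support[OF C1c_continuous[OF \<eta>] K] by metis
  have "continuous_on UNIV (\<lambda>x. LBINT y. h y * \<eta> (x - y))"
    using continuous_convolution[OF h C1c_continuous[OF \<eta>] K] by simp
  then have m: "(\<lambda>x. LBINT y. h y * \<eta> (x - y)) \<in> borel_measurable lborel"
    using borel_measurable_continuous_onI by simp
  have "norm (LBINT y. h y * \<eta> (x - y)) \<le> (LBINT y. \<bar>h y\<bar> * B)" for x
  proof (rule norm_LINT_le)
    show "integrable lborel (\<lambda>y. h y * \<eta> (x - y))"
      using integrable_convolution[OF h C1c_continuous[OF \<eta>] K] by simp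
    show "norm (h y * \<eta> (x - y)) \<le> \<bar>h y\<bar> * B" for y
      using B[of "x - y"] by (simp add: abs_mult mult_left_mono)
  qed (use h in simp)
  from integrable_scaleR_bounded[OF u m this] show ?thesis by simp
qed

text \<open>On the open set U the \<theta> i add up to the constant 1, so their gradients cancel;
  outside U both p and g vanish.\<close>

lemma sum_localized_divergence:
  fixes p :: "'a::euclidean_space \<Rightarrow> 'a" and \<theta> :: "'i \<Rightarrow> 'a \<Rightarrow> real"
  assumes "open U" and \<theta>: "\<And>i. i \<in> I \<Longrightarrow> \<theta> i \<in> C1c UNIV" "\<And>x. x \<in> U \<Longrightarrow> (\<Sum>i\<in>I. \<theta> i x) = 1"
    and zero: "\<And>x. x \<notin> U \<Longrightarrow> p x = 0" "\<And>x. x \<notin> U \<Longrightarrow> g x = 0"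
  shows "(\<Sum>i\<in>I. \<theta> i x * g x + classical_grad (\<theta> i) x \<bullet> p x) = g x"
proof (cases "x \<in> U")
  case True
  have S: "(\<lambda>x. \<Sum>i\<in>I. \<theta> i x) \<in> C1c UNIV" by (rule C1c_sum) (rule \<theta>(1))
  have "((\<lambda>_. 1::real) has_derivative (\<bullet>) 0) (at x)" by (rule has_derivative_eq_rhs[OF has_derivative_const]) (simp add: fun_eq_iff)
  then have "((\<lambda>x. \<Sum>i\<in>I. \<theta> i x) has_derivative (\<bullet>) 0) (at x)"
    by (rule has_derivative_transform_within_open[OF _ \<open>open U\<close> True]) (simp add: \<theta>(2))
  then have "classical_grad (\<lambda>x. \<Sum>i\<in>I. \<theta> i x) x = 0"
    by (rule classical_grad_eqI[OF S])
  then have "(\<Sum>i\<in>I. classical_grad (\<theta> i) x) = 0" using classical_grad_sum[of I \<theta> UNIV x] \<theta>(1) by simp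
  then show ?thesis
    using \<theta>(2)[OF True] by (simp add: sum.distrib flip: sum_distrib_right inner_sum_left)
qed (simp add: zero)

text \<open>The hypothesis on the weak divergence admits test functions on the whole space, so p has
  no flux through the boundary. The parameters are chosen in the order \<tau> (analytic accuracy),
  \<epsilon> (length of the shift), \<delta> (width of the kernel): the shift must be fixed before
  it is known how narrow the kernel has to be to stay inside U.\<close>

lemma inward_mollification:
  fixes U :: "'a::euclidean_space set" and p :: "'a \<Rightarrow> 'a" and g u :: "'a \<Rightarrow> real"
  assumes U: "open U" "bounded U" "lipschitz_boundary U"
    and pm [measurable]: "p \<in> borel_measurable borel" and p: "\<And>x. norm (p x) \<le> 1" "\<And>x. x \<notin> U \<Longrightarrow> p x = 0"
    and g: "integrable lborel g" "integrable lborel (\<lambda>x. (g x)\<^sup>2)" "\<And>x. x \<notin> U \<Longrightarrow> g x = 0"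
    and u: "integrable lborel u" "integrable lborel (\<lambda>x. (u x)\<^sup>2)"
    and wdiv: "\<And>\<phi>. \<phi> \<in> C1c UNIV \<Longrightarrow> (LBINT x. p x \<bullet> classical_grad \<phi> x) = - (LBINT x. g x * \<phi> x)"
    and e: "e > 0"
  shows "\<exists>q\<in>C1c U. (\<forall>x. norm (q x) \<le> 1 + e) \<and>
    \<bar>(LBINT x. u x * classical_div q x) - (LBINT x. u x * g x)\<bar> \<le> e"
proof -
  have [measurable]: "u \<in> borel_measurable borel" "g \<in> borel_measurable borel" using u g by simp_all
  obtain I :: "'a set" and r e0 v where I: "finite I" and r: "\<And>i. i \<in> I \<Longrightarrow> r i > 0" and e0: "\<And>i. i \<in> I \<Longrightarrow> e0 i > 0"
    and cover: "closure U \<subseteq> (\<Union>i\<in>I. ball i (r i / 2))"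
    and inward: "\<And>i y e. i \<in> I \<Longrightarrow> y \<in> closure U \<inter> cball i (r i) \<Longrightarrow> 0 < e \<Longrightarrow> e < e0 i \<Longrightarrow> y + e *\<^sub>R v i \<in> U"
    using finite_inward_cover[OF U] by blast
  obtain \<theta> :: "'a \<Rightarrow> 'a \<Rightarrow> real" where \<theta>: "\<And>i. i \<in> I \<Longrightarrow> \<theta> i \<in> C1c UNIV" "\<And>i x. i \<in> I \<Longrightarrow> 0 \<le> \<theta> i x"
    "\<And>i x. i \<in> I \<Longrightarrow> x \<notin> ball i (r i) \<Longrightarrow> \<theta> i x = 0" "\<And>x. (\<Sum>i\<in>I. \<theta> i x) \<le> 1"
    "\<And>x. x \<in> (\<Union>i\<in>I. ball i (r i / 2)) \<Longrightarrow> (\<Sum>i\<in>I. \<theta> i x) = 1"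
    using finite_C1c_partition[where r = r, OF I r] by blast
  have \<theta>1: "(\<Sum>i\<in>I. \<theta> i x) = 1" if "x \<in> U" for x
    using that cover closure_subset[of U] by (intro \<theta>(5)) blast
  \<comment> \<open>The error e is shared among the pieces; the + 1 avoids dividing by zero when I
    is empty.\<close>
  define N where "N = real (card I) + 1"
  have N: "N > 0" and cardN: "real (card I) * (e / N) \<le> e"
    using e by (auto simp: N_def field_simps)
  have eN: "e / N > 0" using e N by simp
  define h where "h i y = \<theta> i y * g y + classical_grad (\<theta> i) y \<bullet> p y" for i y
  have h: "integrable lborel (h i)" "integrable lborel (\<lambda>x. (h i x)\<^sup>2)" if "i \<in> I" for i
    unfolding h_def by (rule localized_divergence_integrable[OF pm p(1) g(1,2) \<theta>(1)[OF that]])+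
  have sum_h: "(\<Sum>i\<in>I. h i x) = g x" for x
    unfolding h_def by (rule sum_localized_divergence[OF U(1) \<theta>(1) \<theta>1 p(2) g(3)])
  have "\<forall>i\<in>I. \<exists>\<tau>>0. \<forall>\<eta>\<in>C1c UNIV. (\<forall>x. \<eta> x \<ge> 0) \<longrightarrow> (LBINT x. \<eta> x) = 1 \<longrightarrow> (\<forall>x. x \<notin> ball 0 \<tau> \<longrightarrow> \<eta> x = 0) \<longrightarrow>
      \<bar>(LBINT x. u x * (LBINT y. h i y * \<eta> (x - y))) - (LBINT x. u x * h i x)\<bar> \<le> e / N"
    using mollification_weak_limit[OF u h eN] by blast
  from bchoice[OF this] obtain \<tau>' where \<tau>': "\<And>i. i \<in> I \<Longrightarrow> \<tau>' i > 0"
    "\<And>i \<eta>. i \<in> I \<Longrightarrow> \<eta> \<in> C1c UNIV \<Longrightarrow> (\<And>x. \<eta> x \<ge> 0) \<Longrightarrow> (LBINT x. \<eta> x) = 1 \<Longrightarrow> (\<And>x. x \<notin> ball 0 (\<tau>' i) \<Longrightarrow> \<eta> x = 0) \<Longrightarrow>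
      \<bar>(LBINT x. u x * (LBINT y. h i y * \<eta> (x - y))) - (LBINT x. u x * h i x)\<bar> \<le> e / N"
    by blast
  have "\<exists>d>0. \<forall>x y. dist x y < d \<longrightarrow> norm (\<theta> i x - \<theta> i y) < e / N" if i: "i \<in> I" for i
  proof -
    obtain K where K: "compact K" "\<And>x. x \<notin> K \<Longrightarrow> \<theta> i x = 0" using \<theta>(1)[OF i] by (metis C1c_support)
    show ?thesis using uniformly_continuous_compact_support[OF C1c_continuous[OF \<theta>(1)[OF i]] K eN] by metis
  qed
  then have "\<forall>i\<in>I. \<exists>d>0. \<forall>x y. dist x y < d \<longrightarrow> norm (\<theta> i x - \<theta> i y) < e / N" by blast
  from bchoice[OF this] obtain d where d: "\<And>i. i \<in> I \<Longrightarrow> d i > 0"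
    "\<And>i x y. i \<in> I \<Longrightarrow> dist x y < d i \<Longrightarrow> norm (\<theta> i x - \<theta> i y) < e / N" by blast
  \<comment> \<open>One scale for all pieces on which both the weak limits and the oscillations of
    the \<theta> i are within e / N.\<close>
  obtain \<tau> where \<tau>: "\<tau> > 0" "\<And>i. i \<in> I \<Longrightarrow> \<tau> < min (\<tau>' i) (d i)"
    using finite_positive_lower_bound[OF I, of "\<lambda>i. min (\<tau>' i) (d i)"] \<tau>'(1) d(1) by auto
  have nv: "norm (v i) + 1 > 0" for i using norm_ge_zero[of "v i"] by linarith
  \<comment> \<open>Below \<open>e0 i\<close> the shifted piece lands in U; the second bound makes
    the shift shorter than \<tau> / 2, and its + 1 allows v i = 0.\<close>
  obtain \<epsilon> where \<epsilon>: "\<epsilon> > 0" "\<And>i. i \<in> I \<Longrightarrow> \<epsilon> < min (e0 i) (\<tau> / (2 * (norm (v i) + 1)))"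
  proof (rule finite_positive_lower_bound[OF I, of "\<lambda>i. min (e0 i) (\<tau> / (2 * (norm (v i) + 1)))"])
    show "0 < min (e0 i) (\<tau> / (2 * (norm (v i) + 1)))" if "i \<in> I" for i
      using e0[OF that] \<tau>(1) nv[of i] by simp
  qed (rule that)
  have \<epsilon>v: "\<epsilon> * norm (v i) < \<tau> / 2" if "i \<in> I" for i
  proof -
    have "\<epsilon> * (norm (v i) + 1) < \<tau> / 2" using \<epsilon>(2)[OF that] nv[of i] by (simp add: field_simps)
    then show ?thesis using \<epsilon>(1) by (simp add: algebra_simps)
  qed
  \<comment> \<open>The closed piece after the shift: compact and contained in the open set U, hence
    at positive distance from the complement.\<close>
  define K where "K i = {a + b |a b. a \<in> closure U \<inter> cball i (r i) \<and> b \<in> {\<epsilon> *\<^sub>R v i}}" for i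
  have K: "compact (K i)" "K i \<subseteq> U" if "i \<in> I" for i
  proof -
    have "compact (closure U \<inter> cball i (r i))" using U(2) by (intro compact_Int_closed) (auto simp: compact_closure)
    then show "compact (K i)" unfolding K_def by (intro compact_sums) auto
    show "K i \<subseteq> U" using inward[OF that] \<epsilon>(1) \<epsilon>(2)[OF that] unfolding K_def by auto
  qed
  have "\<forall>i\<in>I. \<exists>\<delta>>0. (\<Union>x\<in>K i. cball x \<delta>) \<subseteq> U"
    using compact_subset_open_imp_cball_epsilon_subset[OF K(1) U(1) K(2)] by metis
  from bchoice[OF this] obtain \<delta>' where \<delta>': "\<And>i. i \<in> I \<Longrightarrow> \<delta>' i > 0" "\<And>i. i \<in> I \<Longrightarrow> (\<Union>x\<in>K i. cball x (\<delta>' i)) \<subseteq> U"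
    by blast
  \<comment> \<open>\<open>\<delta>' i\<close> keeps the thickened piece in U; \<tau> / 2 is the
    share of \<tau> left over by the shift.\<close>
  obtain \<delta> where \<delta>: "\<delta> > 0" "\<And>i. i \<in> I \<Longrightarrow> \<delta> < min (\<delta>' i) (\<tau> / 2)"
    using finite_positive_lower_bound[OF I, of "\<lambda>i. min (\<delta>' i) (\<tau> / 2)"] \<delta>'(1) \<tau>(1) by auto
  define L where "L i = {a + b |a b. a \<in> K i \<and> b \<in> cball 0 \<delta>}" for i
  have L: "compact (L i)" "L i \<subseteq> U" if i: "i \<in> I" for i
  proof -
    show "compact (L i)" unfolding L_def by (intro compact_sums K i) auto
    show "L i \<subseteq> U"
    proof
      fix x assume "x \<in> L i"
      then obtain a b where "x = a + b" "a \<in> K i" "b \<in> cball 0 \<delta>" unfolding L_def by blast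
      then have "x \<in> cball a (\<delta>' i)" "a \<in> K i" using \<delta>(2)[OF i] by (auto simp: dist_norm)
      then show "x \<in> U" using \<delta>'(2)[OF i] by blast
    qed
  qed
  \<comment> \<open>Centring the kernel at the shift vector lets one convolution both translate and
    mollify.\<close>
  have "\<exists>\<eta>::'a \<Rightarrow> real. \<eta> \<in> C1c UNIV \<and> (\<forall>x. \<eta> x \<ge> 0) \<and> (LBINT x. \<eta> x) = 1 \<and> (\<forall>x. x \<notin> ball (\<epsilon> *\<^sub>R v i) \<delta> \<longrightarrow> \<eta> x = 0)" for i
    using C1c_mollifier[OF \<delta>(1), of "\<epsilon> *\<^sub>R v i"] by metis
  then obtain \<eta> :: "'a \<Rightarrow> 'a \<Rightarrow> real" where \<eta>: "\<And>i. \<eta> i \<in> C1c UNIV" "\<And>i x. \<eta> i x \<ge> 0" "\<And>i. (LBINT x. \<eta> i x) = 1"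
    "\<And>i x. x \<notin> ball (\<epsilon> *\<^sub>R v i) \<delta> \<Longrightarrow> \<eta> i x = 0" by metis
  have small: "norm w < \<tau>" if i: "i \<in> I" and "\<eta> i w \<noteq> 0" for i w
  proof -
    have "dist (\<epsilon> *\<^sub>R v i) w < \<delta>" using \<eta>(4)[of w i] that by (metis mem_ball)
    then have "norm (w - \<epsilon> *\<^sub>R v i) < \<tau> / 2" using \<delta>(2)[OF i] by (simp add: dist_norm norm_minus_commute)
    moreover have "norm (\<epsilon> *\<^sub>R v i) < \<tau> / 2" using \<epsilon>v[OF i] \<epsilon>(1) by simp
    ultimately show ?thesis using norm_triangle_sub[of w "\<epsilon> *\<^sub>R v i"] by linarith
  qed
  \<comment> \<open>Components of the mollified field \<theta> i p; their sum over I is the field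
    q.\<close>
  define F where "F b i x = (LBINT y. (\<theta> i y * (p y \<bullet> b)) * \<eta> i (x - y))" for b i x
  define q where "q x = (\<Sum>b\<in>Basis. (\<Sum>i\<in>I. F b i x) *\<^sub>R b)" for x
  have F: "F b i \<in> C1c U" "classical_grad (F b i) x = (LBINT y. (\<theta> i y * (p y \<bullet> b)) *\<^sub>R classical_grad (\<eta> i) (x - y))"
    if i: "i \<in> I" for b i x
  proof -
    obtain C where C: "compact C" "\<And>x. x \<notin> C \<Longrightarrow> \<theta> i x = 0" using \<theta>(1)[OF i] by (metis C1c_support)
    have "integrable lborel (\<lambda>y. \<theta> i y *\<^sub>R b)"
      by (rule integrable_continuous_compact_support[OF _ C(1)])
        (use C(2) in \<open>auto intro!: continuous_intros C1c_continuous[OF \<theta>(1)[OF i]]\<close>)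
    from integrable_bounded_inner[OF _ p(1) this]
    have int: "integrable lborel (\<lambda>y. \<theta> i y * (p y \<bullet> b))" by (simp add: mult.commute)
    \<comment> \<open>A nonzero integrand forces y into the closed piece and x - y into the kernel's
      ball, so x is the shifted y plus a vector of length at most \<delta>.\<close>
    have sup: "x \<in> L i" if "\<theta> i y * (p y \<bullet> b) * \<eta> i (x - y) \<noteq> 0" for x y
    proof -
      have "y \<in> U" using that p(2)[of y] by (cases "y \<in> U") auto
      moreover have "y \<in> ball i (r i)" "x - y \<in> ball (\<epsilon> *\<^sub>R v i) \<delta>"
        using that \<theta>(3)[OF i, of y] \<eta>(4)[of "x - y" i] by auto
      ultimately have "y + \<epsilon> *\<^sub>R v i \<in> K i" "x - y - \<epsilon> *\<^sub>R v i \<in> cball 0 \<delta>"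
        using closure_subset[of U] by (auto simp: K_def dist_norm norm_minus_commute)
      then show ?thesis unfolding L_def
        by (intro CollectI exI[of _ "y + \<epsilon> *\<^sub>R v i"] exI[of _ "x - y - \<epsilon> *\<^sub>R v i"]) auto
    qed
    show "F b i \<in> C1c U" "classical_grad (F b i) x = (LBINT y. (\<theta> i y * (p y \<bullet> b)) *\<^sub>R classical_grad (\<eta> i) (x - y))"
      using C1c_convolution[OF int \<eta>(1) L[OF i] sup] unfolding F_def[abs_def] by auto
  qed
  have Fs: "(\<lambda>x. \<Sum>i\<in>I. F b i x) \<in> C1c U" for b by (rule C1c_sum) (rule F)
  have qC: "q \<in> C1c U" unfolding q_def[abs_def] by (rule classical_div_components(1)[OF Fs])
  have div_q: "classical_div q x = (\<Sum>i\<in>I. LBINT y. h i y * \<eta> i (x - y))" for x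
  proof -
    have "classical_div q x = (\<Sum>b\<in>Basis. classical_grad (\<lambda>x. \<Sum>i\<in>I. F b i x) x \<bullet> b)"
      unfolding q_def[abs_def] by (rule classical_div_components(2)[OF Fs])
    also have "\<dots> = (\<Sum>b\<in>Basis. \<Sum>i\<in>I. classical_grad (F b i) x \<bullet> b)"
      by (simp add: classical_grad_sum[OF F(1)] inner_sum_left)
    also have "\<dots> = (\<Sum>i\<in>I. \<Sum>b\<in>Basis. classical_grad (F b i) x \<bullet> b)" by (rule sum.swap)
    also have "\<dots> = (\<Sum>i\<in>I. LBINT y. h i y * \<eta> i (x - y))"
    proof (rule sum.cong[OF refl])
      fix i assume i: "i \<in> I"
      show "(\<Sum>b\<in>Basis. classical_grad (F b i) x \<bullet> b) = (LBINT y. h i y * \<eta> i (x - y))"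
        unfolding F(2)[OF i] h_def by (rule weak_div_convolution[OF pm p(1) g(1) wdiv \<theta>(1)[OF i] \<eta>(1)])
    qed
    finally show ?thesis .
  qed
  have "norm (q x) \<le> 1 + e" for x
  proof -
    have "norm (q x) \<le> (\<Sum>i\<in>I. \<theta> i x + e / N)" unfolding q_def F_def
    proof (rule norm_convolution_sum_le[OF pm p(1) \<theta>(1,2) \<eta>(1,2,3)])
      show "\<theta> i y \<le> \<theta> i x + e / N" if "i \<in> I" "\<eta> i (x - y) \<noteq> 0" for i y
      proof -
        have "dist y x < d i" using small[OF that] \<tau>(2)[OF that(1)] by (simp add: dist_norm norm_minus_commute)
        from d(2)[OF that(1) this] show ?thesis by simp
      qed
    qed
    also have "\<dots> \<le> 1 + e" using \<theta>(4)[of x] cardN by (simp add: sum.distrib)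
    finally show ?thesis .
  qed
  moreover have "\<bar>(LBINT x. u x * classical_div q x) - (LBINT x. u x * g x)\<bar> \<le> e"
  proof -
    have i1: "integrable lborel (\<lambda>x. u x * (LBINT y. h i y * \<eta> i (x - y)))" if "i \<in> I" for i
      by (rule integrable_mult_convolution[OF u(1) h(1)[OF that] \<eta>(1)])
    have i2: "integrable lborel (\<lambda>x. u x * h i x)" if "i \<in> I" for i
      using h[OF that] u by (intro square_integrable_mult) auto
    have "(LBINT x. u x * classical_div q x) = (\<Sum>i\<in>I. LBINT x. u x * (LBINT y. h i y * \<eta> i (x - y)))"
      unfolding div_q sum_distrib_left by (rule Bochner_Integration.integral_sum) (rule i1)
    moreover have "(LBINT x. u x * g x) = (\<Sum>i\<in>I. LBINT x. u x * h i x)"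
      unfolding sum_h[symmetric] sum_distrib_left by (rule Bochner_Integration.integral_sum) (rule i2)
    ultimately have "\<bar>(LBINT x. u x * classical_div q x) - (LBINT x. u x * g x)\<bar>
        = \<bar>\<Sum>i\<in>I. (LBINT x. u x * (LBINT y. h i y * \<eta> i (x - y))) - (LBINT x. u x * h i x)\<bar>"
      by (simp add: sum_subtractf)
    also have "\<dots> \<le> (\<Sum>i\<in>I. e / N)"
    proof (rule order_trans[OF sum_abs sum_mono])
      fix i assume i: "i \<in> I"
      have "\<eta> i w = 0" if "w \<notin> ball 0 (\<tau>' i)" for w
        using small[OF i, of w] \<tau>(2)[OF i] that by force
      from \<tau>'(2)[OF i \<eta>(1,2,3) this]
      show "\<bar>(LBINT x. u x * (LBINT y. h i y * \<eta> i (x - y))) - (LBINT x. u x * h i x)\<bar> \<le> e / N" .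
    qed
    also have "\<dots> \<le> e" using cardN by simp
    finally show ?thesis .
  qed
  ultimately show ?thesis using qC by blast
qed

section \<open>The Hilbert space \<open>L\<^sup>2(U)\<close>\<close>

abbreviation L2_sq :: "'a::euclidean_space set \<Rightarrow> ('a \<Rightarrow> 'b::euclidean_space) \<Rightarrow> real" where
  "L2_sq U f \<equiv> L2_inner U f f"

lemma L2_measurable: "f \<in> L2 U \<Longrightarrow> f \<in> borel_measurable (lebesgue_on U)"
  by (simp add: L2_def)

lemma L2_square_integrable: "f \<in> L2 U \<Longrightarrow> integrable (lebesgue_on U) (\<lambda>x. f x \<bullet> f x)"
  by (simp add: L2_def power2_norm_eq_inner)

lemma L2_I: "f \<in> borel_measurable (lebesgue_on U) \<Longrightarrow> integrable (lebesgue_on U) (\<lambda>x. f x \<bullet> f x) \<Longrightarrow> f \<in> L2 U"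
  by (simp add: L2_def power2_norm_eq_inner)

lemma abs_inner_le_sum_squares: "\<bar>a \<bullet> b\<bar> \<le> a \<bullet> a + b \<bullet> (b :: 'a::real_inner)"
proof -
  have "\<bar>a \<bullet> b\<bar> \<le> norm a * norm b" by (rule Cauchy_Schwarz_ineq2)
  also have "\<dots> \<le> (norm a)\<^sup>2 + (norm b)\<^sup>2"
  proof -
    have "2 * (norm a * norm b) \<le> (norm a)\<^sup>2 + (norm b)\<^sup>2"
      using sum_squares_bound[of "norm a" "norm b"] by (simp add: mult.assoc)
    moreover have "0 \<le> norm a * norm b" by simp
    ultimately show ?thesis by linarith
  qed
  finally show ?thesis by (simp add: power2_norm_eq_inner)
qed

lemma L2_inner_integrable:
  assumes "f \<in> L2 U" "g \<in> L2 U"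
  shows "integrable (lebesgue_on U) (\<lambda>x. f x \<bullet> g x)"
proof (rule Bochner_Integration.integrable_bound)
  show "integrable (lebesgue_on U) (\<lambda>x. f x \<bullet> f x + g x \<bullet> g x)"
    using assms[THEN L2_square_integrable] by simp
  show "(\<lambda>x. f x \<bullet> g x) \<in> borel_measurable (lebesgue_on U)"
    using assms[THEN L2_measurable] by measurable
  show "AE x in lebesgue_on U. norm (f x \<bullet> g x) \<le> norm (f x \<bullet> f x + g x \<bullet> g x)"
    unfolding real_norm_def by (intro AE_I2 order_trans[OF abs_inner_le_sum_squares abs_ge_self])
qed

lemma L2_scaleR: "f \<in> L2 U \<Longrightarrow> (\<lambda>x. c *\<^sub>R f x) \<in> L2 U"
  by (auto simp: L2_def power_mult_distrib intro: borel_measurable_scaleR)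

lemma L2_add:
  assumes "f \<in> L2 U" "g \<in> L2 U"
  shows "(\<lambda>x. f x + g x) \<in> L2 U"
proof (rule L2_I)
  show "(\<lambda>x. f x + g x) \<in> borel_measurable (lebesgue_on U)" using assms[THEN L2_measurable] by measurable
  have "integrable (lebesgue_on U) (\<lambda>x. f x \<bullet> f x + g x \<bullet> f x + (f x \<bullet> g x + g x \<bullet> g x))"
    using assms by (intro Bochner_Integration.integrable_add L2_inner_integrable)
  then show "integrable (lebesgue_on U) (\<lambda>x. (f x + g x) \<bullet> (f x + g x))"
    by (simp add: inner_add_left inner_add_right)
qed

lemma L2_diff: "f \<in> L2 U \<Longrightarrow> g \<in> L2 U \<Longrightarrow> (\<lambda>x. f x - g x) \<in> L2 U"
  using L2_add[of f U "\<lambda>x. (-1) *\<^sub>R g x"] L2_scaleR[of g U "-1"] by simp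

lemma L2_cmult: "f \<in> L2 U \<Longrightarrow> (\<lambda>x. c * f x :: real) \<in> L2 U"
  using L2_scaleR[of f U c] by simp

lemma L2_inner_commute: "L2_inner U f g = L2_inner U g f"
  by (simp add: L2_inner_def inner_commute)

lemma L2_inner_add_left:
  "f \<in> L2 U \<Longrightarrow> g \<in> L2 U \<Longrightarrow> h \<in> L2 U \<Longrightarrow> L2_inner U (\<lambda>x. f x + g x) h = L2_inner U f h + L2_inner U g h"
  by (simp add: L2_inner_def inner_add_left L2_inner_integrable)

lemma L2_inner_diff_left:
  "f \<in> L2 U \<Longrightarrow> g \<in> L2 U \<Longrightarrow> h \<in> L2 U \<Longrightarrow> L2_inner U (\<lambda>x. f x - g x) h = L2_inner U f h - L2_inner U g h"
  by (simp add: L2_inner_def inner_diff_left L2_inner_integrable)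

lemma L2_inner_scaleR_left: "L2_inner U (\<lambda>x. c *\<^sub>R f x) h = c * L2_inner U f h"
  by (simp add: L2_inner_def)

lemma L2_inner_add_right:
  "f \<in> L2 U \<Longrightarrow> g \<in> L2 U \<Longrightarrow> h \<in> L2 U \<Longrightarrow> L2_inner U h (\<lambda>x. f x + g x) = L2_inner U h f + L2_inner U h g"
  using L2_inner_add_left[of f U g h] by (simp add: L2_inner_def inner_commute)

lemma L2_inner_diff_right:
  "f \<in> L2 U \<Longrightarrow> g \<in> L2 U \<Longrightarrow> h \<in> L2 U \<Longrightarrow> L2_inner U h (\<lambda>x. f x - g x) = L2_inner U h f - L2_inner U h g"
  using L2_inner_diff_left[of f U g h] by (simp add: L2_inner_def inner_commute)

lemma L2_inner_scaleR_right: "L2_inner U h (\<lambda>x. c *\<^sub>R f x) = c * L2_inner U h f"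
  by (simp add: L2_inner_def)

lemma L2_inner_cong_AE:
  assumes "f \<in> borel_measurable (lebesgue_on U)" "f' \<in> borel_measurable (lebesgue_on U)"
    "g \<in> borel_measurable (lebesgue_on U)" "g' \<in> borel_measurable (lebesgue_on U)"
    and "AE x in lebesgue_on U. f x = f' x" "AE x in lebesgue_on U. g x = g' x"
  shows "L2_inner U f g = L2_inner U f' g'"
  unfolding L2_inner_def
proof (rule integral_cong_AE)
  show "AE x in lebesgue_on U. f x \<bullet> g x = f' x \<bullet> g' x" using assms(5,6) by eventually_elim simp
qed (use assms(1-4) in measurable)

lemma L2_inner_self_nonneg: "L2_sq U f \<ge> 0"
  unfolding L2_inner_def by (rule integral_nonneg_AE) simp

lemma L2_inner_self_eq_0:
  assumes "f \<in> L2 U" "L2_sq U f = 0"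
  shows "AE x in lebesgue_on U. f x = 0"
  using integral_nonneg_eq_0_iff_AE[OF L2_square_integrable[OF assms(1)]] assms(2) by (simp add: L2_inner_def)

lemma L2_norm_square: "(L2_norm U f)\<^sup>2 = L2_sq U f"
  by (simp add: L2_norm_def L2_inner_self_nonneg)

text \<open>Stated for the midpoint, which stays in a convex set: if the midpoint cannot do much
  better than f and g, then f and g must be close.\<close>

lemma L2_parallelogram:
  assumes "f \<in> L2 U" "g \<in> L2 U"
  shows "L2_sq U (\<lambda>x. (1/2) *\<^sub>R (f x + g x)) =
    (L2_sq U f + L2_sq U g) / 2 - L2_sq U (\<lambda>x. f x - g x) / 4"
  unfolding L2_inner_scaleR_left L2_inner_scaleR_right
  using assms by (simp add: L2_inner_add_left L2_inner_add_right L2_inner_diff_left L2_inner_diff_right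
      L2_add L2_diff L2_inner_commute[of U g f] field_simps)

lemma L2_inner_self_add_scaleR:
  assumes f: "f \<in> L2 U" and g: "g \<in> L2 U"
  shows "L2_sq U (\<lambda>x. f x + c *\<^sub>R g x) =
    L2_sq U f + 2 * c * L2_inner U f g + c\<^sup>2 * L2_sq U g"
proof -
  have cg: "(\<lambda>x. c *\<^sub>R g x) \<in> L2 U" by (rule L2_scaleR[OF g])
  show ?thesis
    unfolding L2_inner_add_left[OF f cg L2_add[OF f cg]] L2_inner_add_right[OF f cg f] L2_inner_add_right[OF f cg cg]
      L2_inner_scaleR_left L2_inner_scaleR_right L2_inner_add_right[OF f cg g] L2_inner_commute[of U g f]
    by (simp add: power2_eq_square algebra_simps)
qed

text \<open>Discriminant argument for the nonnegative quadratic t \<mapsto> |f - t g|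
  squared.\<close>

lemma L2_Cauchy_Schwarz:
  assumes f: "f \<in> L2 U" and g: "g \<in> L2 U"
  shows "(L2_inner U f g)\<^sup>2 \<le> L2_sq U f * L2_sq U g"
proof -
  define A B C where "A = L2_sq U f" and "B = L2_sq U g" and "C = L2_inner U f g"
  have quad: "0 \<le> A - 2 * t * C + t\<^sup>2 * B" for t
    using L2_inner_self_nonneg[of U "\<lambda>x. f x + (- t) *\<^sub>R g x"]
    unfolding L2_inner_self_add_scaleR[OF f g] by (simp add: A_def B_def C_def)
  have B: "B \<ge> 0" unfolding B_def by (rule L2_inner_self_nonneg)
  have "C\<^sup>2 \<le> A * B"
  proof (cases "B = 0")
    case True
    have "C = 0"
    proof (rule ccontr)
      assume "C \<noteq> 0"
      \<comment> \<open>For B = 0 the quadratic is affine in t, and this t gives it the value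
        -1.\<close>
      then show False using quad[of "(A + 1) / (2 * C)"] True by simp
    qed
    then show ?thesis using True by simp
  next
    case False
    \<comment> \<open>C / B is the minimizer of the quadratic.\<close>
    then show ?thesis using quad[of "C / B"] B by (simp add: power2_eq_square field_simps)
  qed
  then show ?thesis by (simp add: A_def B_def C_def)
qed

lemma L2_inner_tendsto:
  assumes fn: "\<And>n. f n \<in> L2 U" and f: "f' \<in> L2 U" and g: "g \<in> L2 U"
    and lim: "(\<lambda>n. L2_sq U (\<lambda>x. f n x - f' x)) \<longlonglongrightarrow> 0"
  shows "(\<lambda>n. L2_inner U (f n) g) \<longlonglongrightarrow> L2_inner U f' g"
proof -
  let ?D = "\<lambda>n. L2_sq U (\<lambda>x. f n x - f' x)"
  have "(\<lambda>n. L2_inner U (\<lambda>x. f n x - f' x) g) \<longlonglongrightarrow> 0"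
  proof (rule Lim_null_comparison)
    show "\<forall>\<^sub>F n in sequentially. norm (L2_inner U (\<lambda>x. f n x - f' x) g) \<le> sqrt (?D n * L2_sq U g)"
      using L2_Cauchy_Schwarz[OF L2_diff[OF fn f] g] by (intro always_eventually allI) (simp add: real_le_rsqrt)
    have "(\<lambda>n. sqrt (?D n * L2_sq U g)) \<longlonglongrightarrow> sqrt (0 * L2_sq U g)" by (intro tendsto_intros lim)
    then show "(\<lambda>n. sqrt (?D n * L2_sq U g)) \<longlonglongrightarrow> 0" by simp
  qed
  then have "(\<lambda>n. L2_inner U (f n) g - L2_inner U f' g) \<longlonglongrightarrow> 0"
    using fn f g by (simp add: L2_inner_diff_left)
  then show ?thesis by (rule LIM_zero_cancel)
qed

section \<open>Completeness of L2 on a bounded open set\<close>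

lemma finite_measure_lebesgue_on_bounded_open:
  "open U \<Longrightarrow> bounded U \<Longrightarrow> finite_measure (lebesgue_on U)"
  by (intro finite_measure_lebesgue_on lmeasurable_open)

text \<open>On a set of finite measure an L2 Cauchy sequence is Cauchy in L1 and has a subsequence
  converging almost everywhere; Fatou's lemma then gives L2 convergence of the whole sequence. The
  subsequence is part of the conclusion because pointwise bounds pass to the limit along it.\<close>

lemma L2_complete:
  fixes f :: "nat \<Rightarrow> 'a::euclidean_space \<Rightarrow> 'b::euclidean_space"
  assumes U: "open U" "bounded U" and f: "\<And>n. f n \<in> L2 U"
    and cauchy: "\<And>e. e > 0 \<Longrightarrow> \<exists>N. \<forall>m\<ge>N. \<forall>n\<ge>N. L2_sq U (\<lambda>x. f m x - f n x) < e"
  obtains f' r where "f' \<in> L2 U" "strict_mono r" "AE x in lebesgue_on U. (\<lambda>k. f (r k) x) \<longlonglongrightarrow> f' x"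
    "(\<lambda>n. L2_sq U (\<lambda>x. f n x - f' x)) \<longlonglongrightarrow> 0"
proof -
  define M where "M = lebesgue_on U"
  interpret finite_measure M unfolding M_def by (rule finite_measure_lebesgue_on_bounded_open[OF U])
  define \<mu> where "\<mu> = measure M (space M)"
  have \<mu>: "\<mu> \<ge> 0" by (simp add: \<mu>_def)
  have [measurable]: "f n \<in> borel_measurable M" for n using L2_measurable[OF f] by (simp add: M_def)
  \<comment> \<open>Integrated over a set of measure \<mu>, this bounds the L1 norm by the squared
    L2 norm without square roots; s is free to be tuned.\<close>
  have young: "norm t \<le> s / 2 + (t \<bullet> t) / (2 * s)" if "s > 0" for t :: 'b and s :: real
  proof -
    have "0 \<le> (s - norm t)\<^sup>2 / (2 * s)" using that by simp
    also have "\<dots> = s / 2 + (norm t)\<^sup>2 / (2 * s) - norm t" using that by (simp add: power2_eq_square field_simps)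
    finally show ?thesis by (simp add: power2_norm_eq_inner)
  qed
  have L2int: "integrable M (\<lambda>x. h x \<bullet> h x)" if "h \<in> L2 U" for h :: "'a \<Rightarrow> 'b"
    using L2_square_integrable[OF that] by (simp add: M_def)
  have L1: "integrable M (\<lambda>x. norm (h x)) \<and> (LINT x|M. norm (h x)) \<le> s / 2 * \<mu> + L2_sq U h / (2 * s)"
    if h: "h \<in> L2 U" and s: "s > 0" for h :: "'a \<Rightarrow> 'b" and s
  proof
    have [measurable]: "h \<in> borel_measurable M" using L2_measurable[OF h] by (simp add: M_def)
    have i: "integrable M (\<lambda>x. s / 2 + (h x \<bullet> h x) / (2 * s))" using L2int[OF h] by simp
    show j: "integrable M (\<lambda>x. norm (h x))"
    proof (rule Bochner_Integration.integrable_bound[OF i])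
      show "AE x in M. norm (norm (h x)) \<le> norm (s / 2 + (h x \<bullet> h x) / (2 * s))"
        unfolding real_norm_def abs_norm_cancel by (intro AE_I2 order_trans[OF young[OF s] abs_ge_self])
    qed measurable
    have "(LINT x|M. norm (h x)) \<le> (LINT x|M. s / 2 + (h x \<bullet> h x) / (2 * s))"
      by (rule integral_mono[OF j i young[OF s]])
    also have "\<dots> = s / 2 * \<mu> + L2_sq U h / (2 * s)"
    proof -
      have "(LINT x|M. s / 2 + (h x \<bullet> h x) / (2 * s)) = (LINT x|M. s / 2) + (LINT x|M. (h x \<bullet> h x) / (2 * s))"
        using L2int[OF h] by (intro Bochner_Integration.integral_add) auto
      also have "(LINT x|M. s / 2) = s / 2 * \<mu>" by (simp add: \<mu>_def)
      finally show ?thesis by (simp add: L2_inner_def M_def)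
    qed
    finally show "(LINT x|M. norm (h x)) \<le> s / 2 * \<mu> + L2_sq U h / (2 * s)" .
  qed
  have "\<exists>N. \<forall>i\<ge>N. \<forall>j\<ge>N. LINT x|M. norm (f i x - f j x) < e" if e: "e > 0" for e
  proof -
    \<comment> \<open>The constant term s \<mu> / 2 is then at most e / 2, and squared L2 distances
      below e s contribute less than another e / 2.\<close>
    define s where "s = e / (\<mu> + 1)"
    have s: "s > 0" using e \<mu> by (simp add: s_def)
    obtain N where N: "\<And>m n. m \<ge> N \<Longrightarrow> n \<ge> N \<Longrightarrow> L2_sq U (\<lambda>x. f m x - f n x) < e * s"
      using cauchy[of "e * s"] e s by auto
    have "LINT x|M. norm (f i x - f j x) < e" if "i \<ge> N" "j \<ge> N" for i j
    proof -
      have "(LINT x|M. norm (f i x - f j x)) \<le> s / 2 * \<mu> + L2_sq U (\<lambda>x. f i x - f j x) / (2 * s)"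
        using L1[OF L2_diff[OF f f] s] by blast
      also have "\<dots> < s / 2 * \<mu> + e * s / (2 * s)"
        using N[OF that] s by (intro add_strict_left_mono divide_strict_right_mono) auto
      also have "\<dots> = e / 2 * (\<mu> / (\<mu> + 1)) + e / 2"
      proof -
        have "e * s / (2 * s) = e / 2" using s by simp
        then show ?thesis by (simp add: s_def mult.commute)
      qed
      also have "\<dots> \<le> e / 2 * 1 + e / 2" using e \<mu> by (intro add_right_mono mult_left_mono) auto
      finally show ?thesis by simp
    qed
    then show ?thesis by blast
  qed
  moreover have "integrable M (f n)" for n
    using L1[OF f, of 1] by (simp add: integrable_norm_iff)
  ultimately obtain r where r: "strict_mono r" "AE x in M. Cauchy (\<lambda>i. f (r i) x)"
    using cauchy_L1_AE_cauchy_subseq[of M f] by metis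
  define f' where "f' x = lim (\<lambda>i. f (r i) x)" for x
  have f'm [measurable]: "f' \<in> borel_measurable M" unfolding f'_def by (rule borel_measurable_lim_metric) simp
  have conv: "AE x in M. (\<lambda>k. f (r k) x) \<longlonglongrightarrow> f' x"
    using r(2) by eventually_elim (simp add: f'_def Cauchy_convergent_iff convergent_LIMSEQ_iff)
  \<comment> \<open>Fatou along the subsequence, which is eventually beyond N because
    \<open>r k\<close> is at least k. The same bound yields integrability and the estimate.\<close>
  have close: "integrable M (\<lambda>x. (f n x - f' x) \<bullet> (f n x - f' x)) \<and> L2_sq U (\<lambda>x. f n x - f' x) \<le> e"
    if N: "\<And>m. m \<ge> N \<Longrightarrow> L2_sq U (\<lambda>x. f n x - f m x) < e" for n N e
  proof -
    have e: "e \<ge> 0" using N[of N] L2_inner_self_nonneg[of U "\<lambda>x. f n x - f N x"] by simp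
    have "(\<integral>\<^sup>+x. ennreal ((f n x - f' x) \<bullet> (f n x - f' x)) \<partial>M)
        = (\<integral>\<^sup>+x. liminf (\<lambda>k. ennreal ((f n x - f (r k) x) \<bullet> (f n x - f (r k) x))) \<partial>M)"
    proof (rule nn_integral_cong_AE)
      show "AE x in M. ennreal ((f n x - f' x) \<bullet> (f n x - f' x)) = liminf (\<lambda>k. ennreal ((f n x - f (r k) x) \<bullet> (f n x - f (r k) x)))"
        using conv
      proof eventually_elim
        case (elim x)
        have "(\<lambda>k. ennreal ((f n x - f (r k) x) \<bullet> (f n x - f (r k) x))) \<longlonglongrightarrow> ennreal ((f n x - f' x) \<bullet> (f n x - f' x))"
          by (intro tendsto_ennrealI tendsto_intros elim)
        from lim_imp_Liminf[OF sequentially_bot this] show ?case by (rule sym)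
      qed
    qed
    also have "\<dots> \<le> liminf (\<lambda>k. \<integral>\<^sup>+x. ennreal ((f n x - f (r k) x) \<bullet> (f n x - f (r k) x)) \<partial>M)"
      by (rule nn_integral_liminf) measurable
    also have "\<dots> \<le> ennreal e"
    proof (rule Liminf_le[OF sequentially_bot])
      show "\<forall>\<^sub>F k in sequentially. (\<integral>\<^sup>+x. ennreal ((f n x - f (r k) x) \<bullet> (f n x - f (r k) x)) \<partial>M) \<le> ennreal e"
        using eventually_ge_at_top[of N]
      proof eventually_elim
        case (elim k)
        then have "r k \<ge> N" using seq_suble[OF r(1), of k] by simp
        from N[OF this] show ?case
          using nn_integral_eq_integral[OF L2int[OF L2_diff[OF f f]], of n "r k"]
          by (simp add: L2_inner_def M_def ennreal_leI)
      qed
    qed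
    finally have le: "(\<integral>\<^sup>+x. ennreal ((f n x - f' x) \<bullet> (f n x - f' x)) \<partial>M) \<le> ennreal e" .
    have int: "integrable M (\<lambda>x. (f n x - f' x) \<bullet> (f n x - f' x))"
    proof (rule integrableI_bounded)
      show "(\<integral>\<^sup>+x. ennreal (norm ((f n x - f' x) \<bullet> (f n x - f' x))) \<partial>M) < \<infinity>"
        using le by (simp add: le_less_trans[OF _ ennreal_less_top])
    qed measurable
    moreover have "L2_sq U (\<lambda>x. f n x - f' x) \<le> e"
      using le nn_integral_eq_integral[OF int] e by (simp add: L2_inner_def M_def ennreal_le_iff)
    ultimately show ?thesis by blast
  qed
  obtain N where N: "\<And>m n. m \<ge> N \<Longrightarrow> n \<ge> N \<Longrightarrow> L2_sq U (\<lambda>x. f m x - f n x) < 1"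
    using cauchy[of 1] by auto
  have "integrable M (\<lambda>x. (f N x - f' x) \<bullet> (f N x - f' x))"
    using close[of N N 1] N[of N] by simp
  then have "(\<lambda>x. f N x - f' x) \<in> L2 U"
    using f'm by (intro L2_I) (auto simp: M_def intro!: borel_measurable_diff L2_measurable[OF f])
  from L2_diff[OF f[of N] this] have f': "f' \<in> L2 U" by simp
  have lim0: "(\<lambda>n. L2_sq U (\<lambda>x. f n x - f' x)) \<longlonglongrightarrow> 0"
  proof (rule LIMSEQ_I)
    fix e :: real assume e: "e > 0"
    then obtain N where N: "\<And>m n. m \<ge> N \<Longrightarrow> n \<ge> N \<Longrightarrow> L2_sq U (\<lambda>x. f m x - f n x) < e / 2"
      using cauchy[of "e / 2"] by auto
    have "norm (L2_sq U (\<lambda>x. f n x - f' x) - 0) < e" if "n \<ge> N" for n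
      using close[of N n "e / 2"] N[OF that] e L2_inner_self_nonneg[of U "\<lambda>x. f n x - f' x"] by simp
    then show "\<exists>N. \<forall>n\<ge>N. norm (L2_sq U (\<lambda>x. f n x - f' x) - 0) < e" by blast
  qed
  show ?thesis by (rule that[OF f' r(1) conv[unfolded M_def] lim0])
qed

section \<open>Weak derivatives\<close>

text \<open>Passage from the integrals in the definitions to \<open>lborel\<close>, on which
  translation, convolution and Fubini operate.\<close>

lemma LINT_lebesgue_on_eq_lborel:
  fixes F :: "'a::euclidean_space \<Rightarrow> 'b::{banach, second_countable_topology}"
  assumes "open U" and F: "F \<in> borel_measurable borel" "\<And>x. x \<notin> U \<Longrightarrow> F x = 0"
  shows "(LINT x|lebesgue_on U. F x) = (LBINT x. F x)" "integrable (lebesgue_on U) F = integrable lborel F"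
proof -
  have s: "U \<inter> space lebesgue \<in> sets lebesgue" using \<open>open U\<close> by simp
  have e: "(\<lambda>x. indicator U x *\<^sub>R F x) = F" using F(2) by (auto simp: indicator_def fun_eq_iff)
  show "(LINT x|lebesgue_on U. F x) = (LBINT x. F x)"
    using F(1) by (simp add: integral_restrict_space[OF s] e integral_completion)
  show "integrable (lebesgue_on U) F = integrable lborel F"
    using F(1) by (simp add: integrable_restrict_space[OF s] e integrable_completion)
qed

text \<open>Convolutions are formed from Borel functions on the whole space, whereas elements of
  \<open>L2\<close> are only Lebesgue measurable on U. Changing them on a null set and extending by
  zero reconciles the two.\<close>

lemma borel_representative_real:
  fixes f :: "'a::euclidean_space \<Rightarrow> real"
  assumes "open U" and f: "f \<in> borel_measurable (lebesgue_on U)"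
  shows "\<exists>f'\<in>borel_measurable borel. (\<forall>x. x \<notin> U \<longrightarrow> f' x = 0) \<and> (AE x in lebesgue_on U. f x = f' x)"
proof -
  have s: "U \<inter> space lebesgue \<in> sets lebesgue" and s': "U \<in> sets lebesgue" using \<open>open U\<close> by simp_all
  have "(\<lambda>x. indicator U x *\<^sub>R f x) \<in> borel_measurable lebesgue"
    using f by (simp add: borel_measurable_restrict_space_iff[OF s])
  from completion_ex_borel_measurable_real[OF this] obtain h where h: "h \<in> borel_measurable lborel"
    "AE x in lborel. indicator U x *\<^sub>R f x = h x" by blast
  have "AE x in lebesgue. indicator U x *\<^sub>R f x = h x" using h(2) by (rule AE_completion)
  then have "AE x in lebesgue_on U. f x = indicator U x * h x"
    unfolding AE_restrict_space_iff[OF s] by eventually_elim (auto simp: indicator_def)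
  moreover have "(\<lambda>x. indicator U x * h x) \<in> borel_measurable borel" using h(1) \<open>open U\<close> by simp
  ultimately show ?thesis by (intro bexI[of _ "\<lambda>x. indicator U x * h x"]) auto
qed

lemma borel_representative:
  fixes f :: "'a::euclidean_space \<Rightarrow> 'b::euclidean_space"
  assumes "open U" and f: "f \<in> borel_measurable (lebesgue_on U)"
  obtains f' where "f' \<in> borel_measurable borel" "\<And>x. x \<notin> U \<Longrightarrow> f' x = 0" "AE x in lebesgue_on U. f x = f' x"
proof -
  have "\<exists>f'\<in>borel_measurable borel. (\<forall>x. x \<notin> U \<longrightarrow> f' x = 0) \<and> (AE x in lebesgue_on U. f x \<bullet> b = f' x)" for b
    using f by (intro borel_representative_real[OF \<open>open U\<close>]) simp
  then obtain c where c: "\<And>b. c b \<in> borel_measurable borel" "\<And>b x. x \<notin> U \<Longrightarrow> c b x = 0"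
    "\<And>b. AE x in lebesgue_on U. f x \<bullet> b = c b x" by metis
  have "AE x in lebesgue_on U. \<forall>b\<in>Basis. f x \<bullet> b = c b x"
    using c(3) by (intro AE_finite_allI) auto
  then have "AE x in lebesgue_on U. f x = (\<Sum>b\<in>Basis. c b x *\<^sub>R b)"
  proof eventually_elim
    case (elim x)
    then show ?case by (metis (no_types, lifting) euclidean_representation sum.cong)
  qed
  moreover have "(\<lambda>x. \<Sum>b\<in>Basis. c b x *\<^sub>R b) \<in> borel_measurable borel" using c(1) by measurable
  ultimately show ?thesis using c(2) by (intro that) auto
qed

lemma lebesgue_on_measurable_of_borel:
  "f \<in> borel_measurable borel \<Longrightarrow> f \<in> borel_measurable (lebesgue_on U)"
  by (intro measurable_restrict_space1 measurable_completion) simp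

lemma L2_bounded:
  fixes f :: "'a::euclidean_space \<Rightarrow> 'b::euclidean_space"
  assumes U: "open U" "bounded U" and f: "f \<in> borel_measurable (lebesgue_on U)" "AE x in lebesgue_on U. norm (f x) \<le> B"
  shows "f \<in> L2 U"
proof -
  interpret finite_measure "lebesgue_on U" by (rule finite_measure_lebesgue_on_bounded_open[OF U])
  have "AE x in lebesgue_on U. norm (f x \<bullet> f x) \<le> B\<^sup>2"
    using f(2) by eventually_elim (simp add: power_mono flip: power2_norm_eq_inner)
  then show ?thesis using f(1) by (intro L2_I integrable_const_bound) auto
qed

lemma L2_continuous_compact_support:
  fixes f :: "'a::euclidean_space \<Rightarrow> 'b::euclidean_space"
  assumes U: "open U" "bounded U" and f: "continuous_on UNIV f" "compact K" "\<And>x. x \<notin> K \<Longrightarrow> f x = 0"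
  shows "f \<in> L2 U"
proof -
  obtain B where "\<And>x. norm (f x) \<le> B" using bounded_continuous_compact_support[OF f] by metis
  then show ?thesis
    by (intro L2_bounded[OF U, of _ B] lebesgue_on_measurable_of_borel borel_measurable_continuous_onI[OF f(1)]) auto
qed

lemma C1c_L2:
  assumes U: "open U" "bounded U" and f: "f \<in> C1c V"
  shows "f \<in> L2 U"
  using C1c_support[OF f] L2_continuous_compact_support[OF U C1c_continuous[OF f]] by metis

lemma classical_grad_L2:
  assumes U: "open U" "bounded U" and f: "f \<in> C1c V"
  shows "classical_grad f \<in> L2 U"
  using classical_grad_support[OF f] L2_continuous_compact_support[OF U continuous_classical_grad[OF f]] by metis

lemma classical_div_L2:
  assumes U: "open U" "bounded U" and f: "f \<in> C1c V"
  shows "classical_div f \<in> L2 U"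
  using classical_div_support[OF f] L2_continuous_compact_support[OF U continuous_classical_div[OF f]] by metis

lemma L2_inner_eq_lborel:
  fixes f :: "'a::euclidean_space \<Rightarrow> 'b::euclidean_space"
  assumes "open U" and f: "f \<in> borel_measurable (lebesgue_on U)" "f' \<in> borel_measurable borel" "\<And>x. x \<notin> U \<Longrightarrow> f' x = 0"
      "AE x in lebesgue_on U. f x = f' x"
    and g: "g \<in> borel_measurable (lebesgue_on U)" "g' \<in> borel_measurable borel" "AE x in lebesgue_on U. g x = g' x"
  shows "L2_inner U f g = (LBINT x. f' x \<bullet> g' x)"
proof -
  have "L2_inner U f g = L2_inner U f' g'"
    by (rule L2_inner_cong_AE[OF f(1) lebesgue_on_measurable_of_borel[OF f(2)] g(1) lebesgue_on_measurable_of_borel[OF g(2)] f(4) g(3)])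
  also have "\<dots> = (LBINT x. f' x \<bullet> g' x)"
    unfolding L2_inner_def using f(2,3) g(2) by (intro LINT_lebesgue_on_eq_lborel(1)[OF \<open>open U\<close>]) auto
  finally show ?thesis .
qed

text \<open>On a bounded set L2 is contained in L1, and the mollification estimates use both
  integrability properties.\<close>

lemma L2_borel_representative:
  fixes f :: "'a::euclidean_space \<Rightarrow> real"
  assumes U: "open U" "bounded U" and f: "f \<in> L2 U"
  obtains f' where "f' \<in> borel_measurable borel" "\<And>x. x \<notin> U \<Longrightarrow> f' x = 0" "AE x in lebesgue_on U. f x = f' x"
    "integrable lborel f'" "integrable lborel (\<lambda>x. (f' x)\<^sup>2)"
proof -
  interpret finite_measure "lebesgue_on U" by (rule finite_measure_lebesgue_on_bounded_open[OF U])
  obtain f' where f': "f' \<in> borel_measurable borel" "\<And>x. x \<notin> U \<Longrightarrow> f' x = 0" "AE x in lebesgue_on U. f x = f' x"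
    using borel_representative[OF U(1) L2_measurable[OF f]] by metis
  note m = lebesgue_on_measurable_of_borel[OF f'(1), of U]
  have "integrable (lebesgue_on U) (\<lambda>x. (f x)\<^sup>2)" using f by (simp add: L2_def)
  moreover have "integrable (lebesgue_on U) (\<lambda>x. (f x)\<^sup>2) = integrable (lebesgue_on U) (\<lambda>x. (f' x)\<^sup>2)"
  proof (rule integrable_cong_AE)
    show "AE x in lebesgue_on U. (f x)\<^sup>2 = (f' x)\<^sup>2" using f'(3) by eventually_elim simp
  qed (use L2_measurable[OF f] m in measurable)
  ultimately have sq: "integrable (lebesgue_on U) (\<lambda>x. (f' x)\<^sup>2)" by simp
  have "integrable (lebesgue_on U) f'" using square_integrable_imp_integrable[OF m sq] .
  then have i1: "integrable lborel f'" using LINT_lebesgue_on_eq_lborel(2)[OF U(1) f'(1,2)] by simp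
  have i2: "integrable lborel (\<lambda>x. (f' x)\<^sup>2)"
    using sq LINT_lebesgue_on_eq_lborel(2)[OF U(1), of "\<lambda>x. (f' x)\<^sup>2"] f'(1,2) by simp
  show ?thesis by (rule that[OF f' i1 i2])
qed

lemma L2_orthogonal_C1c_real:
  fixes g :: "'a::euclidean_space \<Rightarrow> real"
  assumes U: "open U" "bounded U" and g: "g \<in> L2 U"
    and orth: "\<And>\<phi>. \<phi> \<in> C1c U \<Longrightarrow> L2_inner U g \<phi> = 0"
  shows "AE x in lebesgue_on U. g x = 0"
proof -
  obtain g' where g': "g' \<in> borel_measurable borel" "\<And>x. x \<notin> U \<Longrightarrow> g' x = 0" "AE x in lebesgue_on U. g x = g' x"
    "integrable lborel g'" "integrable lborel (\<lambda>x. (g' x)\<^sup>2)"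
    by (rule L2_borel_representative[OF U g]) (rule that)
  have "AE x in lborel. x \<in> U \<longrightarrow> g' x = 0"
  proof (rule AE_zero_if_orthogonal_C1c[OF g'(4,5) U(1)])
    fix \<phi> :: "'a \<Rightarrow> real" assume \<phi>: "\<phi> \<in> C1c U"
    have m: "\<phi> \<in> borel_measurable borel" by (rule C1c_borel[OF \<phi>])
    have "L2_inner U g \<phi> = (LBINT x. g' x \<bullet> \<phi> x)"
      by (rule L2_inner_eq_lborel[OF U(1) L2_measurable[OF g] g'(1-3) lebesgue_on_measurable_of_borel[OF m] m]) simp_all
    then show "(LBINT x. g' x * \<phi> x) = 0" using orth[OF \<phi>] by simp
  qed
  then have "AE x in lebesgue. x \<in> U \<longrightarrow> g' x = 0" by (rule AE_completion)
  then have "AE x in lebesgue_on U. g' x = 0" using U(1) by (subst AE_restrict_space_iff) auto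
  with g'(3) show ?thesis by eventually_elim simp
qed

lemma L2_orthogonal_C1c:
  fixes G :: "'a::euclidean_space \<Rightarrow> 'b::euclidean_space"
  assumes U: "open U" "bounded U" and G: "G \<in> L2 U"
    and orth: "\<And>\<psi>. \<psi> \<in> C1c U \<Longrightarrow> L2_inner U G \<psi> = 0"
  shows "AE x in lebesgue_on U. G x = 0"
proof -
  have "AE x in lebesgue_on U. G x \<bullet> b = 0" if b: "b \<in> Basis" for b
  proof (rule L2_orthogonal_C1c_real[OF U])
    have m: "(\<lambda>x. G x \<bullet> b) \<in> borel_measurable (lebesgue_on U)" using L2_measurable[OF G] by simp
    have "integrable (lebesgue_on U) (\<lambda>x. (G x \<bullet> b) \<bullet> (G x \<bullet> b))"
    proof (rule Bochner_Integration.integrable_bound[OF L2_square_integrable[OF G]])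
      have "\<bar>G x \<bullet> b\<bar> \<le> \<bar>norm (G x)\<bar>" for x using Basis_le_norm[OF b, of "G x"] by simp
      then have "(G x \<bullet> b)\<^sup>2 \<le> (norm (G x))\<^sup>2" for x by (rule abs_le_square_iff[THEN iffD1])
      then show "AE x in lebesgue_on U. norm ((G x \<bullet> b) \<bullet> (G x \<bullet> b)) \<le> norm (G x \<bullet> G x)"
        by (simp add: power2_eq_square flip: power2_norm_eq_inner)
    qed (use m in measurable)
    with m show "(\<lambda>x. G x \<bullet> b) \<in> L2 U" by (rule L2_I)
    fix \<phi> :: "'a \<Rightarrow> real" assume "\<phi> \<in> C1c U"
    then have "(\<lambda>x. \<phi> x *\<^sub>R b) \<in> C1c U" by (rule C1c_bounded_linear[OF bounded_linear_scaleR_left])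
    from orth[OF this] show "L2_inner U (\<lambda>x. G x \<bullet> b) \<phi> = 0" by (simp add: L2_inner_def mult.commute)
  qed
  then have "AE x in lebesgue_on U. \<forall>b\<in>Basis. G x \<bullet> b = 0" by (intro AE_finite_allI) auto
  then show ?thesis by eventually_elim (rule euclidean_eqI, simp)
qed

lemma L2_eq_if_C1c_pairings_eq:
  fixes f g :: "'a::euclidean_space \<Rightarrow> 'b::euclidean_space"
  assumes U: "open U" "bounded U" and L2: "f \<in> L2 U" "g \<in> L2 U"
    and eq: "\<And>\<psi>. \<psi> \<in> C1c U \<Longrightarrow> L2_inner U f \<psi> = L2_inner U g \<psi>"
  shows "AE x in lebesgue_on U. f x = g x"
proof -
  have "AE x in lebesgue_on U. f x - g x = 0"
  proof (rule L2_orthogonal_C1c[OF U L2_diff[OF L2]])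
    fix \<psi> :: "'a \<Rightarrow> 'b" assume \<psi>: "\<psi> \<in> C1c U"
    then show "L2_inner U (\<lambda>x. f x - g x) \<psi> = 0"
      using L2_inner_diff_left[OF L2 C1c_L2[OF U \<psi>]] eq by simp
  qed
  then show ?thesis by simp
qed

lemma has_weak_div_unique:
  assumes U: "open U" "bounded U" and "has_weak_div U p g" "has_weak_div U p g'"
  shows "AE x in lebesgue_on U. g x = g' x"
  using assms(3,4) by (intro L2_eq_if_C1c_pairings_eq[OF U]) (auto simp: has_weak_div_def)

lemma has_weak_grad_unique:
  assumes U: "open U" "bounded U" and "has_weak_grad U \<phi> G" "has_weak_grad U \<phi> G'"
  shows "AE x in lebesgue_on U. G x = G' x"
  using assms(3,4) by (intro L2_eq_if_C1c_pairings_eq[OF U]) (auto simp: has_weak_grad_def)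

lemma has_weak_div_weak_div: "has_weak_div U p g \<Longrightarrow> has_weak_div U p (weak_div U p)"
  unfolding weak_div_def by (rule someI[of "has_weak_div U p"])

lemma has_weak_grad_weak_grad: "has_weak_grad U \<phi> G \<Longrightarrow> has_weak_grad U \<phi> (weak_grad U \<phi>)"
  unfolding weak_grad_def by (rule someI[of "has_weak_grad U \<phi>"])

text \<open>Only one factor has to be supported in U, for then both products vanish outside U. This
  covers functions that do not vanish on the boundary, paired with compactly supported
  fields.\<close>

lemma L2_integral_by_parts:
  fixes f :: "'a::euclidean_space \<Rightarrow> real" and g :: "'a \<Rightarrow> 'a"
  assumes "open U" and f: "f \<in> C1c V" and g: "g \<in> C1c W" and sub: "V \<subseteq> U \<or> W \<subseteq> U"
  shows "L2_inner U f (classical_div g) = - L2_inner U (classical_grad f) g"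
proof -
  have [measurable]: "f \<in> borel_measurable borel" "g \<in> borel_measurable borel"
    "classical_div g \<in> borel_measurable borel" "classical_grad f \<in> borel_measurable borel"
    by (rule borel_measurable_continuous_onI,
        rule C1c_continuous[OF f] C1c_continuous[OF g] continuous_classical_div[OF g] continuous_classical_grad[OF f])+
  obtain K where K: "K \<subseteq> V" "\<And>x. x \<notin> K \<Longrightarrow> f x = 0" "\<And>x. x \<notin> K \<Longrightarrow> classical_grad f x = 0"
    using classical_grad_support[OF f] by metis
  obtain L where L: "L \<subseteq> W" "\<And>x. x \<notin> L \<Longrightarrow> g x = 0" "\<And>x. x \<notin> L \<Longrightarrow> classical_div g x = 0"
    using classical_div_support[OF g] by metis
  have z: "f x * classical_div g x = 0 \<and> classical_grad f x \<bullet> g x = 0" if "x \<notin> U" for x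
  proof -
    have "x \<notin> K \<or> x \<notin> L" using sub that K(1) L(1) by blast
    then show ?thesis using K(2,3)[of x] L(2,3)[of x] by (elim disjE) simp_all
  qed
  have "L2_inner U f (classical_div g) = (LBINT x. f x * classical_div g x)"
    unfolding L2_inner_def inner_real_def using z by (intro LINT_lebesgue_on_eq_lborel(1)[OF \<open>open U\<close>]) auto
  moreover have "L2_inner U (classical_grad f) g = (LBINT x. classical_grad f x \<bullet> g x)"
    unfolding L2_inner_def using z by (intro LINT_lebesgue_on_eq_lborel(1)[OF \<open>open U\<close>]) auto
  ultimately show ?thesis using integral_by_parts_C1c[OF f g] by simp
qed

text \<open>As f may be nonzero on the boundary, such functions are \<open>H1\<close> test functions
  that detect the normal trace.\<close>

lemma has_weak_grad_classical:
  assumes U: "open U" "bounded U" and f: "f \<in> C1c UNIV"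
  shows "has_weak_grad U f (classical_grad f)"
  unfolding has_weak_grad_def
  using classical_grad_L2[OF U f] L2_integral_by_parts[OF U(1) f] by blast

lemma has_weak_div_classical:
  fixes p :: "'a::euclidean_space \<Rightarrow> 'a"
  assumes U: "open U" "bounded U" and p: "p \<in> C1c U"
  shows "has_weak_div U p (classical_div p)"
  unfolding has_weak_div_def
proof (intro conjI ballI)
  show "classical_div p \<in> L2 U" by (rule classical_div_L2[OF U p])
  fix \<phi> :: "'a \<Rightarrow> real" assume "\<phi> \<in> C1c U"
  then show "L2_inner U p (classical_grad \<phi>) = - L2_inner U (classical_div p) \<phi>"
    using L2_integral_by_parts[OF U(1) _ p, of \<phi> U] by (simp add: L2_inner_commute)
qed

section \<open>The unit ball of \<open>H\<^sub>0(div)\<close>\<close>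

lemma H1_L2: "\<phi> \<in> H1 U \<Longrightarrow> \<phi> \<in> L2 U"
  by (simp add: H1_def)

lemma H1_weak_grad: "\<phi> \<in> H1 U \<Longrightarrow> has_weak_grad U \<phi> (weak_grad U \<phi>)"
  by (auto simp: H1_def intro: has_weak_grad_weak_grad)

lemma H1_weak_grad_L2: "\<phi> \<in> H1 U \<Longrightarrow> weak_grad U \<phi> \<in> L2 U"
  using H1_weak_grad unfolding has_weak_grad_def by blast

text \<open>\<open>weak_div\<close> is an unspecified representative, so membership is checked with
  any concrete weak divergence g and transferred by uniqueness up to null sets.\<close>

lemma ball_H0divI:
  assumes U: "open U" "bounded U" and p: "p \<in> L2 U" "AE x in lebesgue_on U. norm (p x) \<le> 1"
    and g: "has_weak_div U p g" "\<And>\<phi>. \<phi> \<in> H1 U \<Longrightarrow> L2_inner U p (weak_grad U \<phi>) + L2_inner U g \<phi> = 0"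
  shows "p \<in> ball_H0div U" "AE x in lebesgue_on U. weak_div U p x = g x"
proof -
  have w: "has_weak_div U p (weak_div U p)" by (rule has_weak_div_weak_div[OF g(1)])
  show ae: "AE x in lebesgue_on U. weak_div U p x = g x" by (rule has_weak_div_unique[OF U w g(1)])
  have m: "weak_div U p \<in> borel_measurable (lebesgue_on U)" "g \<in> borel_measurable (lebesgue_on U)"
    using w g(1) by (auto simp: has_weak_div_def intro: L2_measurable)
  have "normal_trace U p \<phi> = 0" if "\<phi> \<in> H1 U" for \<phi>
    unfolding normal_trace_def
    using L2_inner_cong_AE[OF m L2_measurable[OF H1_L2[OF that]] L2_measurable[OF H1_L2[OF that]] ae] g(2)[OF that] by simp
  then show "p \<in> ball_H0div U"
    using p g(1) unfolding ball_H0div_def H0div_def Hdiv_def by blast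
qed

lemma ball_H0divD:
  assumes "p \<in> ball_H0div U"
  shows "p \<in> L2 U" "AE x in lebesgue_on U. norm (p x) \<le> 1" "has_weak_div U p (weak_div U p)" "weak_div U p \<in> L2 U"
    "\<And>\<phi>. \<phi> \<in> H1 U \<Longrightarrow> L2_inner U p (weak_grad U \<phi>) + L2_inner U (weak_div U p) \<phi> = 0"
proof -
  show "p \<in> L2 U" "AE x in lebesgue_on U. norm (p x) \<le> 1" and w: "has_weak_div U p (weak_div U p)"
    using assms by (auto simp: ball_H0div_def H0div_def Hdiv_def intro: has_weak_div_weak_div)
  then show "weak_div U p \<in> L2 U" by (simp add: has_weak_div_def)
  show "L2_inner U p (weak_grad U \<phi>) + L2_inner U (weak_div U p) \<phi> = 0" if "\<phi> \<in> H1 U" for \<phi>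
    using assms that by (simp add: ball_H0div_def H0div_def normal_trace_def)
qed

text \<open>Every competitor in the supremum \<open>TV\<close> belongs to the dual constraint set.
  Its normal trace vanishes because the weak gradient is by definition tested against exactly such
  fields.\<close>

lemma C1c_in_ball_H0div:
  assumes U: "open U" "bounded U" and p: "p \<in> C1c U" "AE x in lebesgue_on U. norm (p x) \<le> 1"
  shows "p \<in> ball_H0div U" "AE x in lebesgue_on U. weak_div U p x = classical_div p x"
proof -
  have "L2_inner U p (weak_grad U \<phi>) + L2_inner U (classical_div p) \<phi> = 0" if "\<phi> \<in> H1 U" for \<phi>
    using H1_weak_grad[OF that] p(1) by (simp add: has_weak_grad_def L2_inner_commute)
  note I = ball_H0divI[OF U C1c_L2[OF U p(1)] p(2) has_weak_div_classical[OF U p(1)] this]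
  show "p \<in> ball_H0div U" "AE x in lebesgue_on U. weak_div U p x = classical_div p x" by (rule I; assumption)+
qed

text \<open>The divergence and trace conditions are linear and the norm bound is convex. The formula
  for the divergence holds only almost everywhere, as each field has its own chosen
  representative.\<close>

lemma ball_H0div_convex:
  assumes U: "open U" "bounded U" and p: "p \<in> ball_H0div U" and q: "q \<in> ball_H0div U" and t: "0 \<le> t" "t \<le> 1"
  shows "(\<lambda>x. (1 - t) *\<^sub>R p x + t *\<^sub>R q x) \<in> ball_H0div U"
    "AE x in lebesgue_on U. weak_div U (\<lambda>x. (1 - t) *\<^sub>R p x + t *\<^sub>R q x) x = (1 - t) *\<^sub>R weak_div U p x + t *\<^sub>R weak_div U q x"
proof -
  note p = ball_H0divD[OF p] and q = ball_H0divD[OF q]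
  let ?m = "\<lambda>x. (1 - t) *\<^sub>R p x + t *\<^sub>R q x" and ?g = "\<lambda>x. (1 - t) *\<^sub>R weak_div U p x + t *\<^sub>R weak_div U q x"
  have m: "?m \<in> L2 U" and g: "?g \<in> L2 U" 
    by (rule L2_add[OF L2_scaleR[OF p(1)] L2_scaleR[OF q(1)]], rule L2_add[OF L2_scaleR[OF p(4)] L2_scaleR[OF q(4)]])
  have im: "L2_inner U ?m h = (1 - t) * L2_inner U p h + t * L2_inner U q h" if "h \<in> L2 U" for h
    using that p(1) q(1) by (simp add: L2_inner_add_left L2_scaleR L2_inner_scaleR_left)
  have ig: "L2_inner U ?g h = (1 - t) * L2_inner U (weak_div U p) h + t * L2_inner U (weak_div U q) h" if "h \<in> L2 U" for h
    unfolding L2_inner_add_left[OF L2_scaleR[OF p(4)] L2_scaleR[OF q(4)] that] L2_inner_scaleR_left ..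
  have n: "AE x in lebesgue_on U. norm (?m x) \<le> 1"
    using p(2) q(2)
  proof eventually_elim
    case (elim x)
    have "norm (?m x) \<le> (1 - t) * norm (p x) + t * norm (q x)" using norm_triangle_ineq[of "(1 - t) *\<^sub>R p x" "t *\<^sub>R q x"] t by simp
    also have "\<dots> \<le> (1 - t) * 1 + t * 1" using elim t by (intro add_mono mult_left_mono) auto
    finally show ?case by simp
  qed
  have d: "has_weak_div U ?m ?g" unfolding has_weak_div_def
  proof (intro conjI ballI g)
    fix \<phi> :: "'a \<Rightarrow> real" assume \<phi>: "\<phi> \<in> C1c U"
    show "L2_inner U ?m (classical_grad \<phi>) = - L2_inner U ?g \<phi>"
      unfolding im[OF classical_grad_L2[OF U \<phi>]] ig[OF C1c_L2[OF U \<phi>]]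
      using p(3) q(3) \<phi> by (simp add: has_weak_div_def)
  qed
  have tr: "L2_inner U ?m (weak_grad U \<phi>) + L2_inner U ?g \<phi> = 0" if "\<phi> \<in> H1 U" for \<phi>
  proof -
    have "L2_inner U ?m (weak_grad U \<phi>) + L2_inner U ?g \<phi> =
      (1 - t) * (L2_inner U p (weak_grad U \<phi>) + L2_inner U (weak_div U p) \<phi>) +
      t * (L2_inner U q (weak_grad U \<phi>) + L2_inner U (weak_div U q) \<phi>)"
      unfolding im[OF H1_weak_grad_L2[OF that]] ig[OF H1_L2[OF that]] by (simp add: algebra_simps)
    then show ?thesis using p(5)[OF that] q(5)[OF that] by simp
  qed
  show "?m \<in> ball_H0div U" "AE x in lebesgue_on U. weak_div U ?m x = ?g x"
    by (rule ball_H0divI[OF U m n d tr]; assumption)+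
qed

section \<open>Total variation against divergences of the unit ball\<close>

lemma classical_div_scaleR_const:
  assumes q: "q \<in> C1c U"
  shows "classical_div (\<lambda>x. c *\<^sub>R q x) x = c * classical_div q x"
proof -
  have C: "(\<lambda>x. c *\<^sub>R q x) \<in> C1c U" by (rule C1c_bounded_linear[OF bounded_linear_scaleR_right q])
  have "((\<lambda>x. c *\<^sub>R q x) has_derivative (\<lambda>v. c *\<^sub>R frechet_derivative q (at x) v)) (at x)"
    by (rule has_derivative_scaleR_right[OF C1c_has_derivative[OF q]])
  from C1c_eq_frechet_derivative[OF C this] show ?thesis
    by (simp add: classical_div_def sum_distrib_left)
qed

lemma L2_inner_div_le_TV:
  assumes "q \<in> C1c U" "AE x in lebesgue_on U. norm (q x) \<le> 1"
  shows "ereal (L2_inner U u (classical_div q)) \<le> TV U u"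
  unfolding TV_def L2_inner_def inner_real_def by (rule SUP_upper) (use assms in simp)

lemma TV_nonneg: "0 \<le> TV U u"
proof -
  have "classical_div (\<lambda>x. 0) x = 0" for x :: 'a by (simp add: classical_div_def frechet_derivative_const)
  then show ?thesis using L2_inner_div_le_TV[OF C1c_zero, of U u] by (simp add: L2_inner_def zero_ereal_def)
qed

text \<open>The only place where the boundary regularity enters.\<close>

lemma L2_inner_weak_div_le_TV:
  fixes U :: "'a::euclidean_space set"
  assumes U: "open U" "bounded U" "lipschitz_boundary U" and p: "p \<in> ball_H0div U" and u: "u \<in> L2 U"
  shows "ereal (L2_inner U u (weak_div U p)) \<le> TV U u"
proof (cases "TV U u")
  case (real T)
  note p = ball_H0divD[OF p]
  have T: "T \<ge> 0" using TV_nonneg[of U u] real by simp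
  obtain u' where u': "u' \<in> borel_measurable borel" "\<And>x. x \<notin> U \<Longrightarrow> u' x = 0" "AE x in lebesgue_on U. u x = u' x"
    "integrable lborel u'" "integrable lborel (\<lambda>x. (u' x)\<^sup>2)"
    by (rule L2_borel_representative[OF U(1,2) u]) (rule that)
  obtain g where g: "g \<in> borel_measurable borel" "\<And>x. x \<notin> U \<Longrightarrow> g x = 0" "AE x in lebesgue_on U. weak_div U p x = g x"
    "integrable lborel g" "integrable lborel (\<lambda>x. (g x)\<^sup>2)"
    by (rule L2_borel_representative[OF U(1,2) p(4)]) (rule that)
  obtain p0 where p0: "p0 \<in> borel_measurable borel" "\<And>x. x \<notin> U \<Longrightarrow> p0 x = 0" "AE x in lebesgue_on U. p x = p0 x"
    using borel_representative[OF U(1) L2_measurable[OF p(1)]] by metis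
  \<comment> \<open>The mollification needs the bound 1 everywhere, not just almost everywhere;
    offending values are replaced by 0.\<close>
  define p' where "p' x = (if norm (p0 x) \<le> 1 then p0 x else 0)" for x
  have p': "p' \<in> borel_measurable borel" "\<And>x. norm (p' x) \<le> 1" "\<And>x. x \<notin> U \<Longrightarrow> p' x = 0"
    using p0 unfolding p'_def by (auto intro!: measurable_If)
  have p'e: "AE x in lebesgue_on U. p x = p' x" using p0(3) p(2) by eventually_elim (simp add: p'_def)
  have um: "L2_inner U u h = (LBINT x. u' x * h' x)"
    if "h \<in> borel_measurable (lebesgue_on U)" "h' \<in> borel_measurable borel" "AE x in lebesgue_on U. h x = h' x" for h h'
    using L2_inner_eq_lborel[OF U(1) L2_measurable[OF u] u'(1-3) that] by simp
  \<comment> \<open>Here the vanishing normal trace is used: \<phi> restricted to U lies in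
    \<open>H1\<close>, so no boundary term remains and the extension by zero has divergence g on the
    whole space.\<close>
  have wdiv: "(LBINT x. p' x \<bullet> classical_grad \<phi> x) = - (LBINT x. g x * \<phi> x)" if \<phi>: "\<phi> \<in> C1c UNIV" for \<phi>
  proof -
    have wg: "has_weak_grad U \<phi> (classical_grad \<phi>)" by (rule has_weak_grad_classical[OF U(1,2) \<phi>])
    have H1: "\<phi> \<in> H1 U" using wg C1c_L2[OF U(1,2) \<phi>] by (auto simp: H1_def)
    have gm: "classical_grad \<phi> \<in> borel_measurable borel" "\<phi> \<in> borel_measurable borel"
      by (rule borel_measurable_continuous_onI, rule continuous_classical_grad[OF \<phi>] C1c_continuous[OF \<phi>])+
    note gm' = lebesgue_on_measurable_of_borel[OF gm(1)] lebesgue_on_measurable_of_borel[OF gm(2)]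
    have "L2_inner U p (weak_grad U \<phi>) = (LBINT x. p' x \<bullet> classical_grad \<phi> x)"
      by (rule L2_inner_eq_lborel[OF U(1) L2_measurable[OF p(1)] p'(1,3) p'e L2_measurable[OF H1_weak_grad_L2[OF H1]] gm(1)])
        (use has_weak_grad_unique[OF U(1,2) H1_weak_grad[OF H1] wg] in simp_all)
    moreover have "L2_inner U (weak_div U p) \<phi> = (LBINT x. g x \<bullet> \<phi> x)"
      by (rule L2_inner_eq_lborel[OF U(1) L2_measurable[OF p(4)] g(1-3) gm'(2) gm(2)]) simp_all
    ultimately show ?thesis using p(5)[OF H1] by simp
  qed
  have approx: "L2_inner U u (weak_div U p) \<le> (1 + e) * T + e" if e: "e > 0" for e
  proof -
    obtain q where q: "q \<in> C1c U" "\<And>x. norm (q x) \<le> 1 + e"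
      and le: "\<bar>(LBINT x. u' x * classical_div q x) - (LBINT x. u' x * g x)\<bar> \<le> e"
      using inward_mollification[OF U p' g(4,5,2) u'(4,5) wdiv e] by blast
    have dm: "classical_div q \<in> borel_measurable borel"
      by (rule borel_measurable_continuous_onI[OF continuous_classical_div[OF q(1)]])
    \<comment> \<open>Rescaling makes q admissible for \<open>TV\<close>, at the price of the factor
      1 + e on T.\<close>
    have C: "(\<lambda>x. (1 / (1 + e)) *\<^sub>R q x) \<in> C1c U"
      by (rule C1c_bounded_linear[OF bounded_linear_scaleR_right q(1)])
    have "norm ((1 / (1 + e)) *\<^sub>R q x) \<le> 1" for x using q(2)[of x] e by simp
    then have "ereal (L2_inner U u (classical_div (\<lambda>x. (1 / (1 + e)) *\<^sub>R q x))) \<le> ereal T"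
      using L2_inner_div_le_TV[OF C, of u] real by simp
    moreover have "classical_div (\<lambda>x. (1 / (1 + e)) *\<^sub>R q x) = (\<lambda>x. (1 / (1 + e)) *\<^sub>R classical_div q x)"
      using classical_div_scaleR_const[OF q(1)] by (intro ext) simp
    ultimately have "1 / (1 + e) * L2_inner U u (classical_div q) \<le> T"
      by (simp only: L2_inner_scaleR_right ereal_less_eq)
    then have "L2_inner U u (classical_div q) \<le> (1 + e) * T" using e by (simp add: field_simps)
    moreover have "L2_inner U u (classical_div q) = (LBINT x. u' x * classical_div q x)"
      by (rule um[OF lebesgue_on_measurable_of_borel[OF dm] dm]) simp
    moreover have "L2_inner U u (weak_div U p) = (LBINT x. u' x * g x)"
      by (rule um[OF L2_measurable[OF p(4)] g(1,3)])
    ultimately show ?thesis using le by linarith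
  qed
  have "L2_inner U u (weak_div U p) \<le> T"
  proof (rule field_le_epsilon)
    fix e :: real assume e: "e > 0"
    \<comment> \<open>Chosen so that the excess x (T + 1) of the bound in \<open>approx\<close> over
      T is exactly e.\<close>
    define x where "x = e / (T + 1)"
    have "x > 0" using e T by (simp add: x_def)
    moreover have "x * (T + 1) = e" using T by (simp add: x_def)
    ultimately show "L2_inner U u (weak_div U p) \<le> T + e" using approx[of x] by (simp add: algebra_simps)
  qed
  then show ?thesis using real by simp
next
  case MInf
  then show ?thesis using TV_nonneg[of U u] by simp
qed simp

text \<open>The weak divergence and the trace condition both read <p, h> + <div p, k> = 0 with h and
  k fixed, which passes to L2 limits of fields and divergences; the norm bound passes along an
  almost everywhere convergent subsequence. The limit g is kept apart from
  \<open>weak_div U q\<close>, with which it agrees only almost everywhere.\<close>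

lemma ball_H0div_closed:
  assumes U: "open U" "bounded U" and p: "\<And>n. p n \<in> ball_H0div U"
    and cp: "\<And>e. e > 0 \<Longrightarrow> \<exists>N. \<forall>m\<ge>N. \<forall>n\<ge>N. L2_sq U (\<lambda>x. p m x - p n x) < e"
    and cw: "\<And>e. e > 0 \<Longrightarrow> \<exists>N. \<forall>m\<ge>N. \<forall>n\<ge>N. L2_sq U (\<lambda>x. weak_div U (p m) x - weak_div U (p n) x) < e"
  obtains q g where "q \<in> ball_H0div U" "g \<in> L2 U" "AE x in lebesgue_on U. weak_div U q x = g x"
    "(\<lambda>n. L2_sq U (\<lambda>x. weak_div U (p n) x - g x)) \<longlonglongrightarrow> 0"
proof -
  note pD = ball_H0divD[OF p]
  obtain q r where q: "q \<in> L2 U" "AE x in lebesgue_on U. (\<lambda>k. p (r k) x) \<longlonglongrightarrow> q x"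
    "(\<lambda>n. L2_sq U (\<lambda>x. p n x - q x)) \<longlonglongrightarrow> 0"
    by (rule L2_complete[OF U pD(1) cp]) (assumption, rule that)
  obtain g where g: "g \<in> L2 U"
    "(\<lambda>n. L2_sq U (\<lambda>x. weak_div U (p n) x - g x)) \<longlonglongrightarrow> 0"
    by (rule L2_complete[OF U pD(4) cw]) (assumption, rule that)
  have "AE x in lebesgue_on U. \<forall>k. norm (p (r k) x) \<le> 1" unfolding AE_all_countable using pD(2) by blast
  with q(2) have n: "AE x in lebesgue_on U. norm (q x) \<le> 1"
  proof eventually_elim
    case (elim x)
    then show ?case using LIMSEQ_le_const2[OF tendsto_norm[OF elim(1)]] by blast
  qed
  have lim: "(\<lambda>n. L2_inner U (p n) h + L2_inner U (weak_div U (p n)) k) \<longlonglongrightarrow> L2_inner U q h + L2_inner U g k"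
    if "h \<in> L2 U" "k \<in> L2 U" for h k
    by (intro tendsto_add L2_inner_tendsto pD q g that)
  have zero: "L2_inner U q h + L2_inner U g k = 0"
    if "h \<in> L2 U" "k \<in> L2 U" "\<And>n. L2_inner U (p n) h + L2_inner U (weak_div U (p n)) k = 0" for h k
    using lim[OF that(1,2)] unfolding that(3) by (simp add: LIMSEQ_const_iff)
  have d: "has_weak_div U q g"
    unfolding has_weak_div_def
  proof (intro conjI ballI g)
    fix \<phi> :: "'a \<Rightarrow> real" assume \<phi>: "\<phi> \<in> C1c U"
    have "L2_inner U (p n) (classical_grad \<phi>) + L2_inner U (weak_div U (p n)) \<phi> = 0" for n
      using pD(3)[of n] \<phi> by (simp add: has_weak_div_def)
    from zero[OF classical_grad_L2[OF U \<phi>] C1c_L2[OF U \<phi>] this]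
    show "L2_inner U q (classical_grad \<phi>) = - L2_inner U g \<phi>" by simp
  qed
  have tr: "L2_inner U q (weak_grad U \<phi>) + L2_inner U g \<phi> = 0" if "\<phi> \<in> H1 U" for \<phi>
    by (rule zero[OF H1_weak_grad_L2[OF that] H1_L2[OF that] pD(5)[OF that]])
  show ?thesis
    by (rule that[OF ball_H0divI(1)[OF U q(1) n d tr] g(1) ball_H0divI(2)[OF U q(1) n d tr] g(2)])
qed

text \<open>Among the almost minimizers, fields of almost least norm form a Cauchy sequence; this replaces
  weak compactness of the unit ball.\<close>

lemma exists_best_approximation:
  assumes U: "open U" "bounded U" and f: "f \<in> L2 U"
  defines "J \<equiv> \<lambda>p. L2_sq U (\<lambda>x. weak_div U p x - f x)"
  shows "\<exists>q\<in>ball_H0div U. \<forall>p\<in>ball_H0div U. J q \<le> J p"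
proof -
  let ?D = "ball_H0div U"
  \<comment> \<open>J does not change when a divergence-free field is added to p, so almost
    minimality of J controls only the divergences; Q is the secondary objective that controls the
    fields.\<close>
  define Q where "Q p = L2_sq U p" for p :: "'a \<Rightarrow> 'a"
  define m where "m = Inf (J ` ?D)"
  have J0: "J p \<ge> 0" for p unfolding J_def by (rule L2_inner_self_nonneg)
  have Q0: "Q p \<ge> 0" for p unfolding Q_def by (rule L2_inner_self_nonneg)
  have ne: "?D \<noteq> {}" using C1c_in_ball_H0div(1)[OF U C1c_zero] by auto
  have m: "m \<le> J p" if "p \<in> ?D" for p
    unfolding m_def using that J0 by (intro cInf_lower bdd_belowI[of _ 0]) auto
  interpret finite_measure "lebesgue_on U" by (rule finite_measure_lebesgue_on_bounded_open[OF U])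
  define \<mu> where "\<mu> = measure (lebesgue_on U) (space (lebesgue_on U))"
  have Q\<mu>: "Q p \<le> \<mu>" if "p \<in> ?D" for p
  proof -
    note p = ball_H0divD[OF that]
    have "Q p \<le> (LINT x|lebesgue_on U. 1)" unfolding Q_def L2_inner_def
    proof (rule integral_mono_AE[OF L2_square_integrable[OF p(1)]])
      show "AE x in lebesgue_on U. p x \<bullet> p x \<le> 1"
        using p(2) by eventually_elim (simp add: power_le_one flip: power2_norm_eq_inner)
    qed simp
    then show ?thesis by (simp add: \<mu>_def)
  qed
  \<comment> \<open>Written with 1 - 1/2 to match \<open>ball_H0div_convex\<close> at t =
    1/2.\<close>
  define mid where "mid p p' = (\<lambda>x. (1 - 1/2) *\<^sub>R p x + (1/2) *\<^sub>R p' x)" for p p' :: "'a \<Rightarrow> 'a"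
  have mid: "mid p p' \<in> ?D"
    "Q (mid p p') = (Q p + Q p') / 2 - L2_sq U (\<lambda>x. p x - p' x) / 4"
    "J (mid p p') = (J p + J p') / 2 - L2_sq U (\<lambda>x. weak_div U p x - weak_div U p' x) / 4"
    if "p \<in> ?D" "p' \<in> ?D" for p p'
  proof -
    note P = ball_H0divD[OF that(1)] and P' = ball_H0divD[OF that(2)]
    note c = ball_H0div_convex[OF U that, of "1/2", folded mid_def]
    show d: "mid p p' \<in> ?D" using c(1) by simp
    have "mid p p' = (\<lambda>x. (1/2) *\<^sub>R (p x + p' x))" by (simp add: mid_def scaleR_add_right fun_eq_iff)
    then show "Q (mid p p') = (Q p + Q p') / 2 - L2_sq U (\<lambda>x. p x - p' x) / 4"
      unfolding Q_def using L2_parallelogram[OF P(1) P'(1)] by simp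
    have m1: "(\<lambda>x. weak_div U (mid p p') x - f x) \<in> borel_measurable (lebesgue_on U)"
      by (rule L2_measurable[OF L2_diff[OF ball_H0divD(4)[OF d] f]])
    let ?h = "\<lambda>x. (1/2) *\<^sub>R ((weak_div U p x - f x) + (weak_div U p' x - f x))"
    have m2: "?h \<in> borel_measurable (lebesgue_on U)"
      by (rule L2_measurable[OF L2_scaleR[OF L2_add[OF L2_diff[OF P(4) f] L2_diff[OF P'(4) f]]]])
    have "AE x in lebesgue_on U. weak_div U (mid p p') x = (1 - 1/2) *\<^sub>R weak_div U p x + (1/2) *\<^sub>R weak_div U p' x"
      using c(2) by (simp add: mid_def)
    then have "AE x in lebesgue_on U. weak_div U (mid p p') x - f x = ?h x" by eventually_elim (simp add: field_simps)
    from L2_inner_cong_AE[OF m1 m2 m1 m2 this this]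
    have "J (mid p p') = L2_sq U ?h" unfolding J_def .
    also have "\<dots> = (J p + J p') / 2 - L2_sq U (\<lambda>x. (weak_div U p x - f x) - (weak_div U p' x - f x)) / 4"
      unfolding J_def by (rule L2_parallelogram[OF L2_diff[OF P(4) f] L2_diff[OF P'(4) f]])
    finally show "J (mid p p') = (J p + J p') / 2 - L2_sq U (\<lambda>x. weak_div U p x - weak_div U p' x) / 4"
      by simp
  qed
  \<comment> \<open>Decreasing sets of almost minimizers of J. The infima \<open>s n\<close> of Q
    over them increase and are bounded by \<mu>, hence form a Cauchy sequence.\<close>
  define C where "C n = {p \<in> ?D. J p \<le> m + inverse (real (Suc n))}" for n
  define s where "s n = Inf (Q ` C n)" for n
  have Cne: "C n \<noteq> {}" for n
  proof -
    have "Inf (J ` ?D) < m + inverse (real (Suc n))" by (simp add: m_def)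
    from cInf_lessD[OF _ this] ne show ?thesis unfolding C_def by (auto intro: less_imp_le)
  qed
  have sl: "s n \<le> Q p" if "p \<in> C n" for n p
    unfolding s_def using that Q0 by (intro cInf_lower bdd_belowI[of _ 0]) auto
  have Cmono: "C k \<subseteq> C n" if "n \<le> k" for n k
  proof -
    have "inverse (real (Suc k)) \<le> inverse (real (Suc n))" using that by (intro le_imp_inverse_le) auto
    then show ?thesis unfolding C_def by (intro subsetI, unfold mem_Collect_eq) linarith
  qed
  have "incseq s" unfolding incseq_def s_def
    using Cmono Cne Q0 by (intro allI impI cInf_superset_mono image_mono) (auto intro!: bdd_belowI[of _ 0])
  moreover have "s n \<le> \<mu>" for n
  proof -
    obtain p where "p \<in> C n" using Cne by blast
    then show ?thesis using sl[of p n] Q\<mu>[of p] by (auto simp: C_def)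
  qed
  ultimately have "convergent s" unfolding convergent_def by (metis incseq_convergent)
  then have sC: "Cauchy s" by (rule convergent_Cauchy)
  have "\<exists>p. p \<in> C n \<and> Q p < s n + inverse (real (Suc n))" for n
  proof -
    have "Inf (Q ` C n) < s n + inverse (real (Suc n))" by (simp add: s_def)
    from cInf_lessD[OF _ this] Cne[of n] show ?thesis by auto
  qed
  then obtain p where p: "\<And>n. p n \<in> C n" "\<And>n. Q (p n) < s n + inverse (real (Suc n))" by metis
  have pD: "p n \<in> ?D" and pJ: "J (p n) \<le> m + inverse (real (Suc n))" for n using p(1)[of n] by (auto simp: C_def)
  have cp: "L2_sq U (\<lambda>x. p a x - p b x) < 2 * \<bar>s a - s b\<bar> + 4 * inverse (real (Suc n))"
    and cw: "L2_sq U (\<lambda>x. weak_div U (p a) x - weak_div U (p b) x)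
      \<le> 4 * inverse (real (Suc n))" if ab: "a \<ge> n" "b \<ge> n" for a b n
  proof -
    have i: "inverse (real (Suc a)) \<le> inverse (real (Suc n))" "inverse (real (Suc b)) \<le> inverse (real (Suc n))"
      using ab by (auto intro!: le_imp_inverse_le)
    show "L2_sq U (\<lambda>x. weak_div U (p a) x - weak_div U (p b) x)
      \<le> 4 * inverse (real (Suc n))"
      using m[OF mid(1)[OF pD pD], of a b] mid(3)[OF pD pD, of a b] pJ[of a] pJ[of b] i by argo
    \<comment> \<open>The larger of the two sets contains both fields and therefore their midpoint,
      on which Q is at least \<open>s ?c\<close>; the parallelogram law turns this into a bound on
      their distance.\<close>
    let ?c = "min a b"
    have inC: "p a \<in> C ?c" "p b \<in> C ?c" using p(1)[of a] p(1)[of b] Cmono[of ?c a] Cmono[of ?c b] by auto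
    have "J (mid (p a) (p b)) \<le> (J (p a) + J (p b)) / 2"
      using mid(3)[OF pD pD, of a b] L2_inner_self_nonneg[of U "\<lambda>x. weak_div U (p a) x - weak_div U (p b) x"] by argo
    then have "J (mid (p a) (p b)) \<le> m + inverse (real (Suc ?c))"
      using inC unfolding C_def by auto
    then have "mid (p a) (p b) \<in> C ?c" using mid(1)[OF pD pD] by (simp add: C_def)
    from sl[OF this] have "s ?c \<le> (Q (p a) + Q (p b)) / 2 - L2_sq U (\<lambda>x. p a x - p b x) / 4"
      unfolding mid(2)[OF pD pD] .
    moreover have "s a + s b - 2 * s ?c \<le> \<bar>s a - s b\<bar>" by (auto simp: min_def)
    ultimately show "L2_sq U (\<lambda>x. p a x - p b x) < 2 * \<bar>s a - s b\<bar> + 4 * inverse (real (Suc n))"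
      using p(2)[of a] p(2)[of b] i by argo
  qed
  have small: "\<exists>N. 4 * inverse (real (Suc N)) < e" if "e > 0" for e :: real
    using reals_Archimedean[of "e / 4"] that by (auto simp: field_simps)
  obtain q g where q: "q \<in> ?D" and g: "g \<in> L2 U" "AE x in lebesgue_on U. weak_div U q x = g x"
    "(\<lambda>n. L2_sq U (\<lambda>x. weak_div U (p n) x - g x)) \<longlonglongrightarrow> 0"
  proof (rule ball_H0div_closed[OF U pD])
    fix e :: real assume e: "e > 0"
    obtain N1 where N1: "4 * inverse (real (Suc N1)) < e / 2" using small[of "e / 2"] e by auto
    obtain N2 where N2: "\<And>a b. a \<ge> N2 \<Longrightarrow> b \<ge> N2 \<Longrightarrow> \<bar>s a - s b\<bar> < e / 4"
      using sC e unfolding Cauchy_def dist_real_def by (metis divide_pos_pos zero_less_numeral)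
    have "L2_sq U (\<lambda>x. p a x - p b x) < e" if "a \<ge> max N1 N2" "b \<ge> max N1 N2" for a b
      using cp[of N1 a b] N1 N2[of a b] that by simp
    then show "\<exists>N. \<forall>a\<ge>N. \<forall>b\<ge>N. L2_sq U (\<lambda>x. p a x - p b x) < e" by blast
    obtain N where "4 * inverse (real (Suc N)) < e" using small[OF e] by auto
    then show "\<exists>N. \<forall>a\<ge>N. \<forall>b\<ge>N. L2_sq U (\<lambda>x. weak_div U (p a) x - weak_div U (p b) x) < e"
      using cw order.strict_trans1 by blast
  qed (rule that)
  let ?w = "\<lambda>n x. weak_div U (p n) x" and ?r = "\<lambda>x. g x - f x"
  have w: "?w n \<in> L2 U" for n by (rule ball_H0divD(4)[OF pD])
  have r: "?r \<in> L2 U" by (rule L2_diff[OF g(1) f])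
  \<comment> \<open>Expanding about g reduces the convergence of J to that of a squared distance and
    of an inner product with a fixed function.\<close>
  have Jn: "J (p n) = L2_sq U (\<lambda>x. ?w n x - g x) + 2 * (L2_inner U (?w n) ?r - L2_inner U g ?r) + L2_sq U ?r" for n
  proof -
    have d: "(\<lambda>x. ?w n x - g x) \<in> L2 U" by (rule L2_diff[OF w g(1)])
    have "J (p n) = L2_sq U (\<lambda>x. (?w n x - g x) + 1 *\<^sub>R ?r x)" unfolding J_def by simp
    also have "\<dots> = L2_sq U (\<lambda>x. ?w n x - g x) + 2 * L2_inner U (\<lambda>x. ?w n x - g x) ?r + L2_sq U ?r"
      unfolding L2_inner_self_add_scaleR[OF d r] by simp
    finally show ?thesis unfolding L2_inner_diff_left[OF w g(1) r] .
  qed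
  have "(\<lambda>n. J (p n)) \<longlonglongrightarrow> 0 + 2 * (L2_inner U g ?r - L2_inner U g ?r) + L2_sq U ?r"
    unfolding Jn by (intro tendsto_intros g(3) L2_inner_tendsto[OF w g(1) r g(3)])
  moreover have "(\<lambda>n. m + inverse (real (Suc n))) \<longlonglongrightarrow> m + 0" by (intro tendsto_intros LIMSEQ_inverse_real_of_nat)
  ultimately have "L2_sq U ?r \<le> m" using LIMSEQ_le[of "\<lambda>n. J (p n)" _ "\<lambda>n. m + inverse (real (Suc n))"] pJ by auto
  moreover have "J q = L2_sq U ?r"
  proof -
    have e: "AE x in lebesgue_on U. weak_div U q x - f x = ?r x" using g(2) by eventually_elim simp
    note m1 = L2_measurable[OF L2_diff[OF ball_H0divD(4)[OF q] f]]
    show ?thesis unfolding J_def by (rule L2_inner_cong_AE[OF m1 L2_measurable[OF r] m1 L2_measurable[OF r] e e])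
  qed
  ultimately show ?thesis using q m by (intro bexI[of _ q]) (auto intro: order_trans)
qed

text \<open>First-order optimality along the segment from q to p: a negative slope <a, b> would beat
  the quadratic term for small t.\<close>

lemma best_approximation_variational_inequality:
  assumes U: "open U" "bounded U" and f: "f \<in> L2 U" and q: "q \<in> ball_H0div U" and p: "p \<in> ball_H0div U"
    and min: "\<And>p. p \<in> ball_H0div U \<Longrightarrow> L2_sq U (\<lambda>x. weak_div U q x - f x)
      \<le> L2_sq U (\<lambda>x. weak_div U p x - f x)"
  shows "L2_inner U (\<lambda>x. f x - weak_div U q x) (weak_div U p) \<le> L2_inner U (\<lambda>x. f x - weak_div U q x) (weak_div U q)"
proof -
  note w = ball_H0divD(4)[OF q] ball_H0divD(4)[OF p]
  define a where "a = (\<lambda>x. weak_div U q x - f x)"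
  define b where "b = (\<lambda>x. weak_div U p x - weak_div U q x)"
  have a: "a \<in> L2 U" and b: "b \<in> L2 U" unfolding a_def b_def by (rule L2_diff[OF w(1) f], rule L2_diff[OF w(2,1)])
  have quad: "0 \<le> 2 * L2_inner U a b + t * L2_sq U b" if t: "0 < t" "t \<le> 1" for t
  proof -
    have t01: "0 \<le> t" "t \<le> 1" using t by auto
    note c = ball_H0div_convex[OF U q p t01]
    let ?c = "\<lambda>x. (1 - t) *\<^sub>R q x + t *\<^sub>R p x"
    have tb: "(\<lambda>x. t *\<^sub>R b x) \<in> L2 U" by (rule L2_scaleR[OF b])
    have ae: "AE x in lebesgue_on U. weak_div U ?c x - f x = a x + t *\<^sub>R b x"
      using c(2) by eventually_elim (simp add: a_def b_def algebra_simps)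
    note m = L2_measurable[OF L2_diff[OF ball_H0divD(4)[OF c(1)] f]] L2_measurable[OF L2_add[OF a tb]]
    have "L2_sq U a \<le> L2_sq U (\<lambda>x. weak_div U ?c x - f x)"
      unfolding a_def by (rule min[OF c(1)])
    also have "\<dots> = L2_sq U (\<lambda>x. a x + t *\<^sub>R b x)"
      by (rule L2_inner_cong_AE[OF m m ae ae])
    also have "\<dots> = L2_sq U a + t * (2 * L2_inner U a b + t * L2_sq U b)"
      unfolding L2_inner_self_add_scaleR[OF a b] by (simp add: power2_eq_square algebra_simps)
    finally show ?thesis using t by (simp add: zero_le_mult_iff)
  qed
  have "0 \<le> L2_inner U a b"
  proof (rule ccontr)
    assume neg: "\<not> 0 \<le> L2_inner U a b"
    define B where "B = L2_sq U b"
    have B: "B \<ge> 0" unfolding B_def by (rule L2_inner_self_nonneg)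
    \<comment> \<open>This t keeps t B at most -<a, b>, so that \<open>quad\<close> would be bounded
      by <a, b> < 0; B + 1 allows B = 0, and the minimum with 1 stays on the segment.\<close>
    define t where "t = min 1 (- L2_inner U a b / (B + 1))"
    have t: "0 < t" "t \<le> 1" using neg B by (auto simp: t_def divide_neg_pos)
    have "t * B \<le> - L2_inner U a b / (B + 1) * B" using B by (intro mult_right_mono) (auto simp: t_def)
    also have "\<dots> = - L2_inner U a b * (B / (B + 1))" by simp
    also have "\<dots> \<le> - L2_inner U a b * 1" using neg B by (intro mult_left_mono) auto
    finally show False using quad[OF t] neg by (simp add: B_def)
  qed
  moreover have "L2_inner U a b = L2_inner U (\<lambda>x. f x - weak_div U q x) (weak_div U q) - L2_inner U (\<lambda>x. f x - weak_div U q x) (weak_div U p)"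
    unfolding a_def b_def L2_inner_diff_right[OF w(2,1) L2_diff[OF w(1) f]]
      L2_inner_diff_left[OF w(1) f w(1)] L2_inner_diff_left[OF w(1) f w(2)]
      L2_inner_diff_left[OF f w(1) w(1)] L2_inner_diff_left[OF f w(1) w(2)] by simp
  ultimately show ?thesis by linarith
qed

section \<open>The primal problem\<close>

lemma is_arg_min_add_const:
  fixes f g :: "'a \<Rightarrow> ereal"
  assumes "\<And>x. P x \<Longrightarrow> f x = g x + ereal c"
  shows "is_arg_min f P x = is_arg_min g P x"
proof -
  have "f y < f x \<longleftrightarrow> g y < g x" if "P x" "P y" for x y
    unfolding assms[OF that(1)] assms[OF that(2)] by (cases "g x"; cases "g y") auto
  then show ?thesis unfolding is_arg_min_def by blast
qed

text \<open>Completing the square in v = u - d0 with w = \<open>weak_div U \<xi>\<close>: the term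
  |w| squared over 2 \<alpha> is the square that was added, and <d0, w> arises from rewriting <v, w>
  as <u, w> - <d0, w>.\<close>

lemma primal_objective_eq_shifted:
  assumes \<alpha>: "\<alpha> > 0" and d0: "d0 \<in> L2 U" and w: "weak_div U \<xi> \<in> L2 U" and u: "u \<in> L2 U"
  shows "primal_objective U \<alpha> d0 \<xi> u = shifted_objective U \<alpha> d0 \<xi> u
    + ereal (L2_inner U d0 (weak_div U \<xi>) - L2_sq U (weak_div U \<xi>) / (2 * \<alpha>))"
proof -
  let ?w = "weak_div U \<xi>" and ?v = "\<lambda>x. u x - d0 x"
  have v: "?v \<in> L2 U" by (rule L2_diff[OF u d0])
  have "L2_sq U (\<lambda>x. ?v x + (1 / \<alpha>) *\<^sub>R ?w x) =
      L2_sq U ?v + 2 / \<alpha> * L2_inner U ?v ?w + 1 / \<alpha>\<^sup>2 * L2_sq U ?w"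
    unfolding L2_inner_self_add_scaleR[OF v w] by (simp add: power2_eq_square)
  then have sq: "(L2_norm U (\<lambda>x. u x - d0 x + 1 / \<alpha> * ?w x))\<^sup>2 =
      (L2_norm U ?v)\<^sup>2 + 2 / \<alpha> * L2_inner U ?v ?w + 1 / \<alpha>\<^sup>2 * L2_sq U ?w"
    unfolding L2_norm_square by simp
  have "\<alpha> / 2 * (X + 2 / \<alpha> * Y + 1 / \<alpha>\<^sup>2 * Z) = \<alpha> / 2 * X + Y + Z / (2 * \<alpha>)" for X Y Z :: real
    using \<alpha> by (simp add: power2_eq_square field_simps)
  then have "\<alpha> / 2 * (L2_norm U (\<lambda>x. u x - d0 x + 1 / \<alpha> * ?w x))\<^sup>2 =
      \<alpha> / 2 * (L2_norm U ?v)\<^sup>2 + L2_inner U ?v ?w + L2_sq U ?w / (2 * \<alpha>)"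
    unfolding sq by blast
  also have "L2_inner U ?v ?w = L2_inner U u ?w - L2_inner U d0 ?w" by (rule L2_inner_diff_left[OF u d0 w])
  finally have *: "\<alpha> / 2 * (L2_norm U (\<lambda>x. u x - d0 x + 1 / \<alpha> * ?w x))\<^sup>2 + (L2_inner U d0 ?w - L2_sq U ?w / (2 * \<alpha>))
      = L2_inner U u ?w + \<alpha> / 2 * (L2_norm U ?v)\<^sup>2" by linarith
  show ?thesis
    unfolding primal_objective_def shifted_objective_def add.assoc plus_ereal.simps(1) * ..
qed

text \<open>Minimality of d is applied to the single competitor e, so e has to be shown admissible;
  its finite total variation comes from the variational inequality for p.\<close>

lemma shifted_objective_minimizer:
  fixes U :: "'a::euclidean_space set"
  assumes U: "open U" "bounded U" "lipschitz_boundary U" and \<alpha>: "\<alpha> > 0" and d0: "d0 \<in> L2 U"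
    and \<xi>: "\<xi> \<in> ball_H0div U" and d: "is_arg_min (shifted_objective U \<alpha> d0 \<xi>) (\<lambda>u. u \<in> BV U \<inter> L2 U) d"
    and p: "is_arg_min (dual_objective U \<alpha> d0 \<xi>) (\<lambda>p. p \<in> ball_H0div U) p"
  shows "AE x in lebesgue_on U. d x = d0 x - 1 / \<alpha> * (weak_div U p x + weak_div U \<xi> x)"
proof -
  interpret finite_measure "lebesgue_on U" by (rule finite_measure_lebesgue_on_bounded_open[OF U(1,2)])
  define f where "f = (\<lambda>x. \<alpha> * d0 x - weak_div U \<xi> x)"
  have f: "f \<in> L2 U" unfolding f_def by (rule L2_diff[OF L2_cmult[OF d0] ball_H0divD(4)[OF \<xi>]])
  have pB: "p \<in> ball_H0div U" using p by (simp add: is_arg_min_def)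
  define w where "w = weak_div U p"
  have w: "w \<in> L2 U" unfolding w_def by (rule ball_H0divD(4)[OF pB])
  \<comment> \<open>The claimed solution, as (f - w) / \<alpha> = d0 - (w + div \<xi>) /
    \<alpha>.\<close>
  define e where "e = (\<lambda>x. (1 / \<alpha>) *\<^sub>R (f x - w x))"
  have e: "e \<in> L2 U" unfolding e_def by (rule L2_scaleR[OF L2_diff[OF f w]])
  have vi: "L2_inner U e (weak_div U q) \<le> L2_inner U e w" if q: "q \<in> ball_H0div U" for q
  proof -
    have "L2_inner U (\<lambda>x. f x - weak_div U p x) (weak_div U q) \<le> L2_inner U (\<lambda>x. f x - weak_div U p x) (weak_div U p)"
    proof (rule best_approximation_variational_inequality[OF U(1,2) f pB q])
      fix q assume "q \<in> ball_H0div U"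
      then show "L2_sq U (\<lambda>x. weak_div U p x - f x)
          \<le> L2_sq U (\<lambda>x. weak_div U q x - f x)"
        using p unfolding is_arg_min_def dual_objective_def L2_norm_square f_def by (simp add: not_less)
    qed
    then show ?thesis unfolding e_def L2_inner_scaleR_left using \<alpha> by (simp add: w_def divide_right_mono)
  qed
  have TVe: "TV U e \<le> ereal (L2_inner U e w)" unfolding TV_def
  proof (rule SUP_least)
    fix q :: "'a \<Rightarrow> 'a" assume "q \<in> {p \<in> C1c U. AE x in lebesgue_on U. norm (p x) \<le> 1}"
    then have q: "q \<in> C1c U" "AE x in lebesgue_on U. norm (q x) \<le> 1" by auto
    note qB = C1c_in_ball_H0div[OF U(1,2) q]
    note m = L2_measurable[OF e] L2_measurable[OF e] L2_measurable[OF ball_H0divD(4)[OF qB(1)]]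
      L2_measurable[OF classical_div_L2[OF U(1,2) q(1)]]
    have "(LINT x|lebesgue_on U. e x * classical_div q x) = L2_inner U e (weak_div U q)"
      using L2_inner_cong_AE[OF m _ qB(2)] by (simp add: L2_inner_def)
    then show "ereal (LINT x|lebesgue_on U. e x * classical_div q x) \<le> ereal (L2_inner U e w)"
      using vi[OF qB(1)] by simp
  qed
  have "integrable (lebesgue_on U) e"
    by (rule square_integrable_imp_integrable[OF L2_measurable[OF e]]) (use e in \<open>simp add: L2_def\<close>)
  then have eBV: "e \<in> BV U \<inter> L2 U"
    using e le_less_trans[OF TVe, of \<infinity>] by (simp add: BV_def L1_def)
  \<comment> \<open>The part of the expansion that does not depend on u. The shifted argument u - d0
    + div \<xi> / \<alpha> equals (u - e) - w / \<alpha>, and <e, w> stems from its cross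
    term.\<close>
  define c where "c = L2_inner U e w + L2_sq U w / (2 * \<alpha>)"
  have shift: "shifted_objective U \<alpha> d0 \<xi> u = TV U u + ereal (\<alpha> / 2 * L2_sq U (\<lambda>x. u x - e x)
      - L2_inner U u w + c)" if u: "u \<in> L2 U" for u
  proof -
    let ?v = "\<lambda>x. u x - e x"
    have v: "?v \<in> L2 U" by (rule L2_diff[OF u e])
    have "(\<lambda>x. u x - d0 x + 1 / \<alpha> * weak_div U \<xi> x) = (\<lambda>x. ?v x + (- 1 / \<alpha>) *\<^sub>R w x)"
      using \<alpha> by (simp add: e_def f_def fun_eq_iff field_simps)
    then have "(L2_norm U (\<lambda>x. u x - d0 x + 1 / \<alpha> * weak_div U \<xi> x))\<^sup>2 = L2_sq U (\<lambda>x. ?v x + (- 1 / \<alpha>) *\<^sub>R w x)"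
      by (simp only: L2_norm_square)
    also have "\<dots> = L2_sq U ?v - 2 / \<alpha> * L2_inner U ?v w + 1 / \<alpha>\<^sup>2 * L2_sq U w"
      unfolding L2_inner_self_add_scaleR[OF v w] by (simp add: power2_eq_square)
    finally have sq: "(L2_norm U (\<lambda>x. u x - d0 x + 1 / \<alpha> * weak_div U \<xi> x))\<^sup>2 = \<dots>" .
    have "\<alpha> / 2 * (X - 2 / \<alpha> * Y + 1 / \<alpha>\<^sup>2 * Z) = \<alpha> / 2 * X - Y + Z / (2 * \<alpha>)" for X Y Z :: real
      using \<alpha> by (simp add: power2_eq_square field_simps)
    then have "\<alpha> / 2 * (L2_norm U (\<lambda>x. u x - d0 x + 1 / \<alpha> * weak_div U \<xi> x))\<^sup>2
        = \<alpha> / 2 * L2_sq U ?v - L2_inner U ?v w + L2_sq U w / (2 * \<alpha>)"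
      unfolding sq by blast
    also have "\<dots> = \<alpha> / 2 * L2_sq U ?v - L2_inner U u w + c"
      unfolding L2_inner_diff_left[OF u e w] by (simp add: c_def)
    finally show ?thesis unfolding shifted_objective_def by (simp only:)
  qed
  have dL: "d \<in> L2 U" using d by (simp add: is_arg_min_def)
  let ?N = "L2_sq U (\<lambda>x. d x - e x)"
  \<comment> \<open>Green's inequality bounds \<open>TV\<close> below at d and the variational
    inequality bounds it above at e; both inner products with w cancel, and only c remains beside
    the squared distance.\<close>
  have "ereal (\<alpha> / 2 * ?N + c) = ereal (L2_inner U d w) + ereal (\<alpha> / 2 * ?N - L2_inner U d w + c)" by simp
  also have "\<dots> \<le> shifted_objective U \<alpha> d0 \<xi> d"
    unfolding shift[OF dL] w_def by (intro add_right_mono L2_inner_weak_div_le_TV[OF U pB dL])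
  also have "\<dots> \<le> shifted_objective U \<alpha> d0 \<xi> e" using d eBV by (auto simp: is_arg_min_def not_less)
  also have "\<dots> \<le> ereal (L2_inner U e w) + ereal (c - L2_inner U e w)"
    unfolding shift[OF e] using TVe by (intro add_mono) (simp_all add: L2_inner_def)
  finally have "\<alpha> / 2 * ?N \<le> 0" by simp
  then have "?N = 0" using \<alpha> L2_inner_self_nonneg[of U "\<lambda>x. d x - e x"] by (simp add: mult_le_0_iff)
  from L2_inner_self_eq_0[OF L2_diff[OF dL e] this] show ?thesis
  proof eventually_elim
    case (elim x)
    then show ?case using \<alpha> by (simp add: e_def f_def w_def field_simps)
  qed
qed

text \<open>Existence of a dual solution is asserted as well, so that the formula for every dual
  solution is not vacuous.\<close>

theorem corollary6:
  fixes \<Omega> :: "(real^2) set" and \<xi> :: "real^2 \<Rightarrow> real^2" and \<alpha> :: real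
    and d0 d :: "real^2 \<Rightarrow> real"
  assumes "open \<Omega>" and "\<Omega> \<noteq> {}" and "bounded \<Omega>" and "simply_connected \<Omega>"
    and "lipschitz_boundary \<Omega>"
    and "\<xi> \<in> ball_H0div \<Omega>" and "\<alpha> > 0" and "d0 \<in> L2 \<Omega>"
    and "is_arg_min (primal_objective \<Omega> \<alpha> d0 \<xi>) (\<lambda>u. u \<in> BV \<Omega> \<inter> L2 \<Omega>) d"
  shows "(\<forall>u. is_arg_min (primal_objective \<Omega> \<alpha> d0 \<xi>) (\<lambda>u. u \<in> BV \<Omega> \<inter> L2 \<Omega>) u \<longleftrightarrow>
              is_arg_min (shifted_objective \<Omega> \<alpha> d0 \<xi>) (\<lambda>u. u \<in> BV \<Omega> \<inter> L2 \<Omega>) u)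
    \<and> (\<exists>p. is_arg_min (dual_objective \<Omega> \<alpha> d0 \<xi>) (\<lambda>p. p \<in> ball_H0div \<Omega>) p)
    \<and> (\<forall>p. is_arg_min (dual_objective \<Omega> \<alpha> d0 \<xi>) (\<lambda>p. p \<in> ball_H0div \<Omega>) p \<longrightarrow>
          (AE x in lebesgue_on \<Omega>.
             d x = d0 x - 1 / \<alpha> * (weak_div \<Omega> p x + weak_div \<Omega> \<xi> x)))"
proof (intro conjI allI impI)
  note w = ball_H0divD(4)[OF \<open>\<xi> \<in> ball_H0div \<Omega>\<close>]
  show eq: "is_arg_min (primal_objective \<Omega> \<alpha> d0 \<xi>) (\<lambda>u. u \<in> BV \<Omega> \<inter> L2 \<Omega>) u \<longleftrightarrow>
      is_arg_min (shifted_objective \<Omega> \<alpha> d0 \<xi>) (\<lambda>u. u \<in> BV \<Omega> \<inter> L2 \<Omega>) u" for u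
    by (rule is_arg_min_add_const[OF primal_objective_eq_shifted[OF \<open>\<alpha> > 0\<close> \<open>d0 \<in> L2 \<Omega>\<close> w]]) simp
  have "(\<lambda>x. \<alpha> * d0 x - weak_div \<Omega> \<xi> x) \<in> L2 \<Omega>"
    by (rule L2_diff[OF L2_cmult[OF \<open>d0 \<in> L2 \<Omega>\<close>] w])
  from exists_best_approximation[OF \<open>open \<Omega>\<close> \<open>bounded \<Omega>\<close> this]
  show "\<exists>p. is_arg_min (dual_objective \<Omega> \<alpha> d0 \<xi>) (\<lambda>p. p \<in> ball_H0div \<Omega>) p"
    unfolding is_arg_min_def dual_objective_def L2_norm_square by (meson not_less)
  fix p assume "is_arg_min (dual_objective \<Omega> \<alpha> d0 \<xi>) (\<lambda>p. p \<in> ball_H0div \<Omega>) p"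
  then show "AE x in lebesgue_on \<Omega>. d x = d0 x - 1 / \<alpha> * (weak_div \<Omega> p x + weak_div \<Omega> \<xi> x)"
    using assms eq by (intro shifted_objective_minimizer) blast+
qed

end
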